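(* Let $u_0$ be a smooth function on $[0,1]$ satisfying $u_0(0)=u_0(1)=0$, and suppose that $u_0'$ attains its greatest value $M_0>0$ at finitely many points $\overline\alpha_1,\dots,\overline\alpha_n\in[0,1]$. If $u_0''(\overline\alpha_i)\neq 0$ for all $1\le i\le n$, then there is a finite time $t_*>0$ such that the smooth solution $u$ of the problem below, with Dirichlet boundary conditions, satisfies $\|u_x(\cdot,t)\|_{L^\infty[0,1]}\to\infty$ as $t\uparrow t_*$. More precisely, $M(t)=u_x(\gamma(\overline\alpha_i,t),t)\to+\infty$ as $t\uparrow t_*$, while for every $\alpha\in[0,1]$ with $\alpha\neq\overline\alpha_i$ for all $i$, $u_x(\gamma(\alpha,t),t)\to-\infty$ as $t\uparrow t_*$.
   Context: Consider the initial value problem $u_{xt}+u u_{xx}-u_x^2=-2\int_0^1 u_x^2\,dx$ for $t>0$, $x\in[0,1]$, with $u(x,0)=u_0(x)$, under Dirichlet boundary conditions $u(0,t)=u(1,t)=0$ (this arises from stagnation-point form solutions $\boldsymbol u=(u(x,t),-y u_x(x,t))$ of the 2D incompressible Euler equations). For $\alpha\in[0,1]$ the Lagrangian flow $\gamma(\alpha,t)$ is defined by $\dot\gamma(\alpha,t)=u(\gamma(\alpha,t),t)$, $\gamma(\alpha,0)=\alpha$, where the dot denotes $d/dt$. Set $M(t)=\sup_{\alpha\in[0,1]}u_x(\gamma(\alpha,t),t)$. "Blow-up" means $u_x$ diverging in the $L^\infty[0,1]$ norm. *)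

theory Defs
  imports "HOL-Analysis.Analysis"
begin

text \<open>C^k regularity on a set via iterated Frechet directional derivatives
  (meant for open sets S); smooth = C^k for every k.\<close>
primrec hdiff :: "nat \<Rightarrow> 'a set \<Rightarrow> ('a::real_normed_vector \<Rightarrow> real) \<Rightarrow> bool" where
  "hdiff 0 S f = continuous_on S f"
| "hdiff (Suc n) S f =
     (f differentiable_on S \<and> (\<forall>v. hdiff n S (\<lambda>x. frechet_derivative f (at x) v)))"

definition smooth_on :: "'a set \<Rightarrow> ('a::real_normed_vector \<Rightarrow> real) \<Rightarrow> bool" where
  "smooth_on S f \<longleftrightarrow> (\<forall>n. hdiff n S f)"

definition pdx :: "(real \<Rightarrow> real \<Rightarrow> real) \<Rightarrow> real \<Rightarrow> real \<Rightarrow> real" where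
  "pdx u x t = deriv (\<lambda>y. u y t) x"

definition pdt :: "(real \<Rightarrow> real \<Rightarrow> real) \<Rightarrow> real \<Rightarrow> real \<Rightarrow> real" where
  "pdt u x t = deriv (\<lambda>s. u x s) t"

definition is_solution :: "(real \<Rightarrow> real) \<Rightarrow> real \<Rightarrow> (real \<Rightarrow> real \<Rightarrow> real) \<Rightarrow> bool" where
  "is_solution u0 T u \<longleftrightarrow>
     (\<exists>U. open U \<and> {0..1} \<times> {0..<T} \<subseteq> U \<and> smooth_on U (\<lambda>(x, t). u x t)) \<and>
     (\<forall>x\<in>{0..1}. u x 0 = u0 x) \<and>
     (\<forall>t\<in>{0..<T}. u 0 t = 0 \<and> u 1 t = 0) \<and>
     (\<forall>t\<in>{0<..<T}. \<forall>x\<in>{0..1}.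
        pdt (pdx u) x t + u x t * pdx (pdx u) x t - (pdx u x t)\<^sup>2
          = - 2 * integral {0..1} (\<lambda>y. (pdx u y t)\<^sup>2))"

definition lagrangian_flow :: "(real \<Rightarrow> real \<Rightarrow> real) \<Rightarrow> real \<Rightarrow> (real \<Rightarrow> real \<Rightarrow> real) \<Rightarrow> bool" where
  "lagrangian_flow u T \<gamma> \<longleftrightarrow>
     (\<forall>\<alpha>\<in>{0..1}. \<gamma> \<alpha> 0 = \<alpha> \<and>
        (\<forall>t\<in>{0..<T}. ((\<gamma> \<alpha>) has_real_derivative u (\<gamma> \<alpha> t) t) (at t within {0..<T})))"

end

theory Submission
  imports Defs
begin

text \<open>
  Along a particle path the equation reads \<open>v' = v\<^sup>2 + I(t)\<close> for \<open>v = u_x(\<gamma>(\<alpha>,t),t)\<close>, and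
  \<open>1 / \<gamma>_\<alpha>\<close> solves a linear second order equation whose coefficients do not depend on \<open>\<alpha>\<close>.
  Hence \<open>\<gamma>_\<alpha> = 1 / (K(\<eta>) (1 - \<eta> u0'(\<alpha>)))\<close> for some function \<open>\<eta>(t)\<close>, and the boundary
  conditions force \<open>K(\<eta>) = \<integral>\<^sub>0\<^sup>1 d\<alpha> / (1 - \<eta> u0'(\<alpha>))\<close> and \<open>dt/d\<eta> = K(\<eta>)\<^sup>2\<close>. The maximum of
  \<open>u0'\<close> is nondegenerate, so it is attained at endpoints only; there \<open>K\<close> grows merely like
  \<open>log (1 / (1 - \<eta> M0))\<close>, whence \<open>K\<^sup>2\<close> is integrable up to \<open>\<eta> = 1 / M0\<close>, which is reached at the
  finite time \<open>t\<^sub>*\<close>. In \<open>v = K\<^sup>-\<^sup>2 (u0' / (1 - \<eta> u0') - K' / K)\<close> the first term dominates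
  exactly where \<open>u0' = M0\<close>, and elsewhere it stays bounded while \<open>K' / K\<^sup>3\<close> tends to infinity.

  Conversely, these formulas define a solution: one inverts
  \<open>(\<alpha>, \<eta>) \<mapsto> (\<gamma>, t)\<close> on an open set, using invariance of domain.
\<close>

section \<open>Smooth functions of two variables\<close>

text \<open>The blow-up claim concerns every smooth solution, so the formula must be derived as well
  as verified. With \<open>y = 1 / \<gamma>_\<alpha>\<close> the linear equation is
  \<open>y'' = - I y\<close> with \<open>y(0) = 1\<close>, \<open>y'(0) = - u0'(\<alpha>)\<close>.
  Rolle supplies a label \<rho> with \<open>u0'(\<rho>) = 0\<close>, and reduction of order turns
  its solution \<open>y_\<rho>\<close> into a second one, \<open>\<eta> y_\<rho>\<close> with
  \<open>\<eta>' = 1 / y_\<rho>\<^sup>2\<close>; superposition gives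
  \<open>y_\<alpha> = y_\<rho> (1 - \<eta> u0'(\<alpha>))\<close>. Since \<eta> then has to invert
  one explicit function of \<eta>, all solutions share the same velocity gradient along particles.
  At a maximum point both terms of \<open>v\<close> are large: with \<open>e = 1 - \<eta> M0\<close>
  the first is \<open>M0 / (e K\<^sup>2)\<close>, the second at most a constant times
  \<open>1 / (e K\<^sup>3)\<close>. Only the extra factor \<open>1 / K\<close> separates them, so
  the merely logarithmic divergence of \<open>K\<close> decides the sign. For the existence half the
  obstacle is that smoothness is demanded on an open set around the strip, up to
  \<open>x = 0\<close>, \<open>x = 1\<close> and \<open>t = 0\<close>.\<close>

lemma hdiff_cong:
  assumes "open S" "\<And>x. x \<in> S \<Longrightarrow> f x = g x" "hdiff n S f"
  shows "hdiff n S g"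
  using assms(2,3)
proof (induction n arbitrary: f g)
  case 0
  then show ?case by (metis continuous_on_cong hdiff.simps(1))
next
  case (Suc n)
  have d: "f differentiable_on S" using Suc.prems by simp
  then have fd: "f differentiable at x" if "x \<in> S" for x
    using that \<open>open S\<close> differentiable_on_eq_differentiable_at by blast
  have eq: "frechet_derivative f (at x) = frechet_derivative g (at x)" if "x \<in> S" for x
    by (rule frechet_derivative_transform_within_open[OF fd[OF that] \<open>open S\<close> that Suc.prems(1)])
  have "(g has_derivative frechet_derivative f (at x)) (at x)" if "x \<in> S" for x
    by (rule has_derivative_transform_within_open
        [OF fd[OF that, unfolded frechet_derivative_works] \<open>open S\<close> that Suc.prems(1)])
  then have "g differentiable_on S"
    by (intro differentiable_at_imp_differentiable_on) (auto intro: differentiableI)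
  moreover have "hdiff n S (\<lambda>x. frechet_derivative g (at x) v)" for v
  proof (rule Suc.IH)
    show "hdiff n S (\<lambda>x. frechet_derivative f (at x) v)" using Suc.prems(2) by simp
  qed (simp add: eq)
  ultimately show ?case by simp
qed

text \<open>This is full differentiability, not mere existence of two partial derivatives, so the
  chain rule holds along curves and under composition.\<close>

definition has_partials :: "(real \<times> real \<Rightarrow> real) \<Rightarrow> real \<Rightarrow> real \<Rightarrow> real \<times> real \<Rightarrow> bool" where
  "has_partials f a b z \<longleftrightarrow> (f has_derivative (\<lambda>p. a * fst p + b * snd p)) (at z)"

lemma has_partials_continuous: "has_partials f a b z \<Longrightarrow> isCont f z"
  unfolding has_partials_def by (rule has_derivative_continuous)

lemma has_partials_const: "has_partials (\<lambda>z. c) 0 0 z"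
  unfolding has_partials_def by (auto intro!: derivative_eq_intros)

lemma has_partials_snd: "has_partials snd 0 1 z"
  unfolding has_partials_def by (auto intro!: derivative_eq_intros)

lemma has_partials_add:
  assumes "has_partials f a b z" "has_partials g c d z"
  shows "has_partials (\<lambda>z. f z + g z) (a + c) (b + d) z"
  using has_derivative_add[OF assms[unfolded has_partials_def]]
  unfolding has_partials_def by (simp add: algebra_simps)

lemma has_partials_mult:
  assumes "has_partials f a b z" "has_partials g c d z"
  shows "has_partials (\<lambda>z. f z * g z) (a * g z + f z * c) (b * g z + f z * d) z"
  using has_derivative_mult[OF assms[unfolded has_partials_def]]
  unfolding has_partials_def by (simp add: algebra_simps)

lemma has_partials_DERIV_fst:
  assumes "(f has_real_derivative d) (at (fst z))"
  shows "has_partials (\<lambda>z. f (fst z)) d 0 z"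
  using has_derivative_compose[OF has_derivative_fst[OF has_derivative_ident]
      assms[unfolded has_field_derivative_def]]
  unfolding has_partials_def by simp

lemma has_partials_DERIV_snd:
  assumes "(f has_real_derivative d) (at (snd z))"
  shows "has_partials (\<lambda>z. f (snd z)) 0 d z"
  using has_derivative_compose[OF has_derivative_snd[OF has_derivative_ident]
      assms[unfolded has_field_derivative_def]]
  unfolding has_partials_def by simp

lemma has_partials_compose:
  assumes "has_partials f a b (p z, q z)" "has_partials p c d z" "has_partials q c' d' z"
  shows "has_partials (\<lambda>z. f (p z, q z)) (a * c + b * c') (a * d + b * d') z"
  using has_derivative_compose[OF
      has_derivative_Pair[OF assms(2,3)[unfolded has_partials_def]] assms(1)[unfolded has_partials_def]]
  unfolding has_partials_def by (simp add: algebra_simps)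

lemma has_partials_curve:
  assumes "has_partials f a b (p s, q s)"
    and "(p has_real_derivative c) (at s within S)" "(q has_real_derivative d) (at s within S)"
  shows "((\<lambda>s. f (p s, q s)) has_real_derivative (a * c + b * d)) (at s within S)"
  using has_derivative_compose[OF
      has_derivative_Pair[OF assms(2,3)[unfolded has_field_derivative_def]] assms(1)[unfolded has_partials_def]]
  unfolding has_field_derivative_def
  by (rule has_derivative_eq_rhs) (auto simp: algebra_simps)

lemma has_partials_fst_DERIV:
  "has_partials f a b (x, t) \<Longrightarrow> ((\<lambda>y. f (y, t)) has_real_derivative a) (at x)"
  using has_partials_curve[of f a b "\<lambda>x. x" x "\<lambda>_. t" 1 UNIV 0] by simp

lemma has_partials_snd_DERIV:
  "has_partials f a b (x, t) \<Longrightarrow> ((\<lambda>s. f (x, s)) has_real_derivative b) (at t)"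
  using has_partials_curve[of f a b "\<lambda>_. x" t "\<lambda>t. t" 0 UNIV 1] by simp

lemma has_partials_cong:
  assumes "has_partials f a b z" "a = a'" "b = b'"
  shows "has_partials f a' b' z"
  using assms by simp

text \<open>A directional derivative of a member of \<open>C\<close> is a combination of its two
  partials with constant coefficients, hence again in \<open>C\<close>. The induction on the order
  runs over all of \<open>C\<close> at once, so no higher derivative needs a formula.\<close>

lemma smooth_on_class:
  assumes "open S"
    and part: "\<And>f. f \<in> C \<Longrightarrow> \<exists>fx\<in>C. \<exists>ft\<in>C. \<forall>z\<in>S. has_partials f (fx z) (ft z) z"
    and lin: "\<And>f g a b. f \<in> C \<Longrightarrow> g \<in> C \<Longrightarrow> (\<lambda>z. f z * a + g z * b) \<in> C"
    and "f \<in> C"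
  shows "smooth_on S f"
proof -
  have "hdiff n S f" for n using \<open>f \<in> C\<close>
  proof (induction n arbitrary: f)
    case 0
    from part[OF this] obtain fx ft where "\<forall>z\<in>S. has_partials f (fx z) (ft z) z" by blast
    then show ?case
      using has_partials_continuous by (metis continuous_at_imp_continuous_on hdiff.simps(1))
  next
    case (Suc n)
    from part[OF Suc.prems] obtain fx ft where C: "fx \<in> C" "ft \<in> C"
      and p: "\<forall>z\<in>S. has_partials f (fx z) (ft z) z" by blast
    have "f differentiable_on S"
      using p by (meson differentiable_at_imp_differentiable_on differentiable_def has_partials_def)
    moreover have "hdiff n S (\<lambda>z. frechet_derivative f (at z) v)" for v
    proof (rule hdiff_cong[OF \<open>open S\<close> _ Suc.IH[OF lin[OF C, of "fst v" "snd v"]]])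
      fix z assume "z \<in> S"
      then have "frechet_derivative f (at z) = (\<lambda>p. fx z * fst p + ft z * snd p)"
        using p by (intro frechet_derivative_at[symmetric]) (simp add: has_partials_def)
      then show "fx z * fst v + ft z * snd v = frechet_derivative f (at z) v" by simp
    qed
    ultimately show ?case by simp
  qed
  then show ?thesis by (simp add: smooth_on_def)
qed

lemma smooth_on_frechet:
  assumes "smooth_on S f"
  shows "smooth_on S (\<lambda>z. frechet_derivative f (at z) v)"
  using assms unfolding smooth_on_def by (metis hdiff.simps(2))

lemma smooth_on_has_derivative:
  assumes "open S" "smooth_on S f" "z \<in> S"
  shows "(f has_derivative frechet_derivative f (at z)) (at z)"
proof -
  have "f differentiable_on S" using assms(2) unfolding smooth_on_def by (metis hdiff.simps(2))
  then show ?thesis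
    using assms by (metis at_within_open differentiable_on_def frechet_derivative_works)
qed

lemma smooth_on_partials:
  assumes "open S" "smooth_on S f"
  obtains fx ft where "smooth_on S fx" "smooth_on S ft"
    "\<And>z. z \<in> S \<Longrightarrow> has_partials f (fx z) (ft z) z"
proof
  show "smooth_on S (\<lambda>z. frechet_derivative f (at z) (1,0))"
    "smooth_on S (\<lambda>z. frechet_derivative f (at z) (0,1))"
    using smooth_on_frechet[OF assms(2)] by auto
  fix z assume "z \<in> S"
  have d: "(f has_derivative frechet_derivative f (at z)) (at z)"
    using smooth_on_has_derivative[OF assms \<open>z \<in> S\<close>] .
  interpret bounded_linear "frechet_derivative f (at z)" using d by (rule has_derivative_bounded_linear)
  have "frechet_derivative f (at z) p
      = frechet_derivative f (at z) (1,0) * fst p + frechet_derivative f (at z) (0,1) * snd p" for p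
  proof -
    have "p = fst p *\<^sub>R (1,0) + snd p *\<^sub>R (0,1)" by (cases p) simp
    then have "frechet_derivative f (at z) p
        = frechet_derivative f (at z) (fst p *\<^sub>R (1,0) + snd p *\<^sub>R (0,1))" by simp
    also have "\<dots> = fst p *\<^sub>R frechet_derivative f (at z) (1,0) + snd p *\<^sub>R frechet_derivative f (at z) (0,1)"
      by (simp only: add scaleR)
    finally show ?thesis by simp
  qed
  then show "has_partials f (frechet_derivative f (at z) (1,0)) (frechet_derivative f (at z) (0,1)) z"
    using d unfolding has_partials_def by (metis (no_types, lifting) ext)
qed

lemma smooth_on_UNIV_deriv:
  fixes f :: "real \<Rightarrow> real"
  assumes "smooth_on UNIV f"
  shows "(f has_real_derivative deriv f x) (at x)" "smooth_on UNIV (deriv f)"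
proof -
  have d: "(f has_derivative frechet_derivative f (at x)) (at x)" for x
    by (rule smooth_on_has_derivative[OF open_UNIV assms UNIV_I])
  have "frechet_derivative f (at x) = (\<lambda>h. frechet_derivative f (at x) 1 * h)" for x
  proof -
    interpret bounded_linear "frechet_derivative f (at x)"
      using d by (rule has_derivative_bounded_linear)
    show ?thesis
    proof
      fix h
      show "frechet_derivative f (at x) h = frechet_derivative f (at x) 1 * h"
        using scaleR[of h 1] by (metis mult.commute mult.right_neutral real_scaleR_def)
    qed
  qed
  then have r: "(f has_real_derivative frechet_derivative f (at x) 1) (at x)" for x
    using d[of x] unfolding has_field_derivative_def by metis
  then have eq: "deriv f x = frechet_derivative f (at x) 1" for x by (rule DERIV_imp_deriv)
  show "(f has_real_derivative deriv f x) (at x)" using r eq by simp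
  have "deriv f = (\<lambda>x. frechet_derivative f (at x) 1)" using eq by auto
  then show "smooth_on UNIV (deriv f)" using smooth_on_frechet[OF assms] by simp
qed

lemma smooth_on_UNIV_iterated_deriv:
  fixes f :: "real \<Rightarrow> real"
  assumes "smooth_on UNIV f"
  shows "((deriv ^^ k) f has_real_derivative (deriv ^^ Suc k) f x) (at x)"
proof -
  have "smooth_on UNIV ((deriv ^^ k) f)"
    by (induction k) (use assms smooth_on_UNIV_deriv(2) in auto)
  from smooth_on_UNIV_deriv(1)[OF this] show ?thesis by simp
qed

section \<open>Calculus on the line\<close>

text \<open>Since \<open>integral {0..x}\<close> vanishes for \<open>x < 0\<close>, the second term supplies the signed integral there.\<close>

definition sint :: "(real \<Rightarrow> real) \<Rightarrow> real \<Rightarrow> real" where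
  "sint f x = integral {0..x} f - integral {x..0} f"

lemma sint_0 [simp]: "sint f 0 = 0"
  by (simp add: sint_def)

lemma sint_nonneg: "0 \<le> x \<Longrightarrow> sint f x = integral {0..x} f"
  by (cases "x = 0") (auto simp: sint_def)

lemma sint_DERIV:
  assumes "continuous_on {lo..hi} f" "lo < 0" "0 < hi" "lo < x" "x < hi"
  shows "(sint f has_real_derivative f x) (at x)"
proof -
  have int: "f integrable_on {a..b}" if "lo \<le> a" "b \<le> hi" for a b
    using assms(1) continuous_on_subset[of "{lo..hi}" f "{a..b}"] that
    by (intro integrable_continuous_real) auto
  have eq: "integral {lo..y} f - integral {lo..0} f = sint f y" if "y \<in> {lo<..<hi}" for y
  proof (cases "y \<ge> 0")
    case True
    then show ?thesis
      using Henstock_Kurzweil_Integration.integral_combine[of lo 0 y f] int[of lo y] that assms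
      by (auto simp: sint_nonneg)
  next
    case False
    then show ?thesis
      using Henstock_Kurzweil_Integration.integral_combine[of lo y 0 f] int[of lo 0] that assms
      by (auto simp: sint_def)
  qed
  have "((\<lambda>y. integral {lo..y} f) has_real_derivative f x) (at x within {lo..hi})"
    by (rule integral_has_real_derivative) (use assms in auto)
  then have "((\<lambda>y. integral {lo..y} f) has_real_derivative f x) (at x)"
    using assms by (simp add: at_within_Icc_at)
  then have "((\<lambda>y. integral {lo..y} f - integral {lo..0} f) has_real_derivative f x) (at x)"
    by (auto intro!: derivative_eq_intros)
  then show ?thesis
    by (rule has_field_derivative_transform_within_open[of _ _ _ "{lo<..<hi}"]) (use assms eq in auto)
qed

text \<open>The weighted square \<open>y\<^sup>2 * exp (- 2 * L * (t - a))\<close> is nonincreasing;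
  squaring avoids differentiating an absolute value. Differentiability is asked only inside the
  interval, as particle paths have one-sided derivatives at time 0.\<close>

lemma gronwall_abs:
  fixes y y' :: "real \<Rightarrow> real"
  assumes "continuous_on {a..b} y" "a \<le> b"
    and "\<And>t. a < t \<Longrightarrow> t < b \<Longrightarrow> (y has_real_derivative y' t) (at t)"
    and "\<And>t. a < t \<Longrightarrow> t < b \<Longrightarrow> \<bar>y' t\<bar> \<le> L * \<bar>y t\<bar>"
  shows "\<bar>y b\<bar> \<le> exp (L * (b - a)) * \<bar>y a\<bar>"
proof -
  let ?z = "\<lambda>t. (y t)\<^sup>2 * exp (- 2 * L * (t - a))"
  have "?z b \<le> ?z a"
  proof (rule DERIV_nonpos_imp_decreasing_open[OF \<open>a \<le> b\<close>])
    fix t assume t: "a < t" "t < b"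
    have "(?z has_real_derivative (2 * y t * y' t - 2 * L * (y t)\<^sup>2) * exp (- 2 * L * (t - a))) (at t)"
      by (auto intro!: derivative_eq_intros assms(3)[OF t] simp: algebra_simps)
    moreover have "y t * y' t \<le> \<bar>y t\<bar> * (L * \<bar>y t\<bar>)"
      using abs_ge_self[of "y t * y' t"] mult_left_mono[OF assms(4)[OF t] abs_ge_zero[of "y t"]]
      by (simp add: abs_mult)
    then have "y t * y' t \<le> L * (y t)\<^sup>2"
      by (metis mult.left_commute power2_abs power2_eq_square)
    then have "2 * y t * y' t - 2 * L * (y t)\<^sup>2 \<le> 0"
      by linarith
    ultimately show "\<exists>d. (?z has_real_derivative d) (at t) \<and> d \<le> 0"
      by (meson exp_ge_zero mult_nonneg_nonneg mult_nonpos_nonneg)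
  qed (auto intro!: continuous_intros assms)
  then have "(y b)\<^sup>2 \<le> (y a)\<^sup>2 * exp (2 * L * (b - a))"
    using mult_right_mono[of "?z b" "?z a" "exp (2 * L * (b - a))"]
    by (simp add: mult.assoc mult_exp_exp)
  also have "exp (2 * L * (b - a)) = (exp (L * (b - a)))\<^sup>2"
    using exp_double[of "L * (b - a)"] by (simp add: mult.assoc)
  finally have "\<bar>y b\<bar>\<^sup>2 \<le> (exp (L * (b - a)) * \<bar>y a\<bar>)\<^sup>2"
    by (simp add: power_mult_distrib mult.commute)
  then show ?thesis
    by (rule power2_le_imp_le) simp
qed

text \<open>Model integrals for an integrand peaked at the left or at the right endpoint. With
  \<open>e = 1 - \<eta> * M\<close> the first power gives the logarithmic size of \<open>K\<close>,
  the square the size \<open>1 / e\<close> of \<open>J 0 2 1\<close>.\<close>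

lemma has_integral_inverse_affine:
  fixes e d :: real
  assumes "e > 0" "d > 0"
  shows "((\<lambda>s. inverse (e + d * s)) has_integral ln ((e + d) / e) / d) {0..1}"
    and "((\<lambda>s. inverse (e + d * (1 - s))) has_integral ln ((e + d) / e) / d) {0..1}"
    and "((\<lambda>s. (inverse (e + d * s))\<^sup>2) has_integral inverse (e * (e + d))) {0..1}"
    and "((\<lambda>s. (inverse (e + d * (1 - s)))\<^sup>2) has_integral inverse (e * (e + d))) {0..1}"
proof -
  have pos: "e + d * s > 0" "e + d * (1 - s) > 0" if "s \<in> {0..1}" for s
    using that assms by (auto intro: add_pos_nonneg)
  have D: "((\<lambda>s. ln (e + d * s) / d) has_real_derivative inverse (e + d * s)) (at s)"
    "((\<lambda>s. - inverse (e + d * s) / d) has_real_derivative (inverse (e + d * s))\<^sup>2) (at s)"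
    if "e + d * s > 0" for s
    using that assms by (auto intro!: derivative_eq_intros simp: divide_simps power2_eq_square)
  have R: "((\<lambda>s. - f (1 - s)) has_real_derivative f' (1 - s)) (at s)"
    if "(f has_real_derivative f' (1 - s)) (at (1 - s))" for f f' :: "real \<Rightarrow> real" and s
    using that by (auto intro!: derivative_eq_intros DERIV_chain2[of f])
  have F: "(f' has_integral f 1 - f 0) {0..1}"
    if "\<And>s. s \<in> {0..1} \<Longrightarrow> (f has_real_derivative f' s) (at s)" for f f' :: "real \<Rightarrow> real"
    by (rule fundamental_theorem_of_calculus)
      (use that in \<open>auto simp: has_real_derivative_iff_has_vector_derivative[symmetric]
        intro: has_field_derivative_at_within\<close>)
  have eq: "inverse e / d - inverse (e + d) / d = inverse (e * (e + d))"
    using assms by (simp add: divide_simps)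
  show "((\<lambda>s. inverse (e + d * s)) has_integral ln ((e + d) / e) / d) {0..1}"
    using F[OF D(1)[OF pos(1)]] assms by (simp add: ln_div diff_divide_distrib)
  show "((\<lambda>s. inverse (e + d * (1 - s))) has_integral ln ((e + d) / e) / d) {0..1}"
    using F[OF R[where f = "\<lambda>s. ln (e + d * s) / d" and f' = "\<lambda>s. inverse (e + d * s)", OF D(1)[OF pos(2)]]] assms by (simp add: ln_div diff_divide_distrib)
  show "((\<lambda>s. (inverse (e + d * s))\<^sup>2) has_integral inverse (e * (e + d))) {0..1}"
    using F[OF D(2)[OF pos(1)]] eq by simp
  show "((\<lambda>s. (inverse (e + d * (1 - s)))\<^sup>2) has_integral inverse (e * (e + d))) {0..1}"
    using F[OF R[where f = "\<lambda>s. - inverse (e + d * s) / d" and f' = "\<lambda>s. (inverse (e + d * s))\<^sup>2", OF D(2)[OF pos(2)]]] eq by simp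
qed

text \<open>If \<open>h 0 = 0\<close>, nonnegativity forces the nonzero slope \<open>h'\<close> to
  be positive; if \<open>h 0 > 0\<close>, continuity gives a positive constant, which dominates a
  linear function on a short interval. An endpoint can thus be treated without knowing whether the
  maximum is attained there.\<close>

lemma linear_growth_right:
  fixes h :: "real \<Rightarrow> real"
  assumes "(h has_real_derivative h') (at 0)" and nonneg: "\<And>s. 0 \<le> s \<Longrightarrow> s \<le> 1 \<Longrightarrow> h s \<ge> 0"
    and "h 0 = 0 \<Longrightarrow> h' \<noteq> 0"
  obtains d c where "0 < d" "d < 1" "0 < c" "\<And>s. 0 \<le> s \<Longrightarrow> s \<le> d \<Longrightarrow> c * s \<le> h s"
proof (cases "h 0 = 0")
  case True
  have lim: "((\<lambda>s. h s / s) \<longlongrightarrow> h') (at_right 0)"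
    using assms(1) True by (simp add: has_field_derivative_iff filterlim_at_split)
  have "eventually (\<lambda>s. h s / s \<ge> 0) (at_right 0)"
    unfolding eventually_at_right_field by (rule exI[of _ 1]) (auto intro!: divide_nonneg_nonneg nonneg)
  then have "h' \<ge> 0" by (rule tendsto_lowerbound[OF lim]) simp
  then have "h' / 2 < h'" "h' > 0" using assms(3) True by auto
  from order_tendstoD(1)[OF lim this(1)] obtain b where b: "b > 0" "\<And>s. s > 0 \<Longrightarrow> s < b \<Longrightarrow> h' / 2 < h s / s"
    unfolding eventually_at_right_field by auto
  show ?thesis
  proof (rule that[of "min (b / 2) (1 / 2)" "h' / 2"])
    fix s assume s: "0 \<le> s" "s \<le> min (b / 2) (1 / 2)"
    show "h' / 2 * s \<le> h s"
    proof (cases "s = 0")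
      case False
      then show ?thesis using b(2)[of s] s b(1) by (auto simp: field_simps)
    qed (use True in simp)
  qed (use b \<open>h' > 0\<close> in auto)
next
  case False
  then have pos: "h 0 / 2 < h 0" "h 0 > 0" using nonneg[of 0] by auto
  have "isCont h 0" using assms(1) DERIV_isCont by blast
  then have "(h \<longlongrightarrow> h 0) (at_right 0)" by (simp add: isCont_def filterlim_at_split)
  from order_tendstoD(1)[OF this pos(1)] obtain b where b: "b > 0" "\<And>s. s > 0 \<Longrightarrow> s < b \<Longrightarrow> h 0 / 2 < h s"
    unfolding eventually_at_right_field by auto
  show ?thesis
  proof (rule that[of "min (b / 2) (1 / 2)" "h 0 / 2"])
    fix s assume s: "0 \<le> s" "s \<le> min (b / 2) (1 / 2)"
    have "h 0 / 2 * s \<le> h 0 / 2 * 1" using s pos by (intro mult_left_mono) auto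
    also have "\<dots> \<le> h s" using b(2)[of s] s b(1) pos by (cases "s = 0") auto
    finally show "h 0 / 2 * s \<le> h s" .
  qed (use b pos in auto)
qed

section \<open>The integrals of the solution formula\<close>

text \<open>\<open>a0\<close> is one maximum point; the other endpoint may or may not be a second
  one, which is why \<open>nondeg\<close> is conditional. One maximum point suffices for lower
  bounds on the integrals, whereas upper bounds must control both ends.\<close>

locale profile =
  fixes u0 :: "real \<Rightarrow> real" and M a0 :: real
  assumes smooth: "smooth_on UNIV u0"
    and u0_0: "u0 0 = 0" and u0_1: "u0 1 = 0"
    and M_pos: "M > 0"
    and le_M: "\<And>x. x \<in> {0..1} \<Longrightarrow> deriv u0 x \<le> M"
    and a0: "a0 \<in> {0, 1}" and at_a0: "deriv u0 a0 = M"
    and lt_M: "\<And>x. x \<in> {0<..<1} \<Longrightarrow> deriv u0 x < M"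
    and nondeg: "\<And>x. x \<in> {0, 1} \<Longrightarrow> deriv u0 x = M \<Longrightarrow> deriv (deriv u0) x \<noteq> 0"
begin

abbreviation "g \<equiv> deriv u0"

lemma u0_DERIV: "(u0 has_real_derivative g x) (at x)"
  using smooth_on_UNIV_iterated_deriv[OF smooth, of 0 x] by simp

lemma g_DERIV: "(g has_real_derivative deriv g x) (at x)"
  using smooth_on_UNIV_iterated_deriv[OF smooth, of 1 x] by simp

lemma g_cont: "isCont g x"
  using g_DERIV DERIV_isCont by blast

lemma g_continuous_on [continuous_intros]:
  "continuous_on S f \<Longrightarrow> continuous_on S (\<lambda>x. g (f x))"
  using continuous_on_compose2[of UNIV g S f] continuous_at_imp_continuous_on g_cont by blast

text \<open>The parameters for which all denominators stay positive on \<open>{lo..hi}\<close>. The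
  interval is variable so that it can be slightly larger than \<open>{0..1}\<close>.\<close>

definition dom :: "real \<Rightarrow> real \<Rightarrow> real set" where
  "dom lo hi = {\<eta>. \<forall>s\<in>{lo..hi}. \<eta> * g s < 1}"

lemma domD: "\<eta> \<in> dom lo hi \<Longrightarrow> lo \<le> s \<Longrightarrow> s \<le> hi \<Longrightarrow> \<eta> * g s < 1"
  by (simp add: dom_def)

lemma zero_in_dom: "0 \<in> dom lo hi"
  by (simp add: dom_def)

lemma convex_dom: "convex (dom lo hi)"
proof -
  have "dom lo hi = (\<Inter>s\<in>{lo..hi}. {\<eta>. g s \<bullet> \<eta> < 1})"
    by (auto simp: dom_def mult.commute)
  then show ?thesis by (auto intro!: convex_INT convex_halfspace_lt simp del: inner_real_def)
qed

lemma dom_extend: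
  assumes "\<eta> \<in> dom lo hi" "lo \<le> hi"
  obtains lo' hi' where "lo' < lo" "hi < hi'" "\<eta> \<in> dom lo' hi'"
proof -
  have nb: "\<exists>d>0. \<forall>s. \<bar>s - c\<bar> < d \<longrightarrow> \<eta> * g s < 1" if "\<eta> * g c < 1" for c
  proof -
    have "isCont (\<lambda>s. \<eta> * g s) c" by (intro continuous_intros g_cont)
    from LIM_D[OF isContD[OF this], of "1 - \<eta> * g c"] that
    obtain d where d: "d > 0" "\<And>s. s \<noteq> c \<Longrightarrow> \<bar>s - c\<bar> < d \<Longrightarrow> \<bar>\<eta> * g s - \<eta> * g c\<bar> < 1 - \<eta> * g c"
      by auto
    have "\<eta> * g s < 1" if "\<bar>s - c\<bar> < d" for s
      using d(2)[of s] that \<open>\<eta> * g c < 1\<close> by (cases "s = c") auto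
    then show ?thesis using d(1) by blast
  qed
  obtain d1 where d1: "d1 > 0" "\<forall>s. \<bar>s - lo\<bar> < d1 \<longrightarrow> \<eta> * g s < 1"
    using nb[of lo] domD[OF assms(1), of lo] assms(2) by auto
  obtain d2 where d2: "d2 > 0" "\<forall>s. \<bar>s - hi\<bar> < d2 \<longrightarrow> \<eta> * g s < 1"
    using nb[of hi] domD[OF assms(1), of hi] assms(2) by auto
  have "\<eta> \<in> dom (lo - d1 / 2) (hi + d2 / 2)"
    unfolding dom_def
  proof (intro CollectI ballI)
    fix s assume s: "s \<in> {lo - d1 / 2..hi + d2 / 2}"
    consider "s < lo" | "lo \<le> s" "s \<le> hi" | "hi < s" by linarith
    then show "\<eta> * g s < 1"
    proof cases
      case 1 then show ?thesis using d1 s by auto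
    next
      case 2 then show ?thesis using domD[OF assms(1)] by auto
    next
      case 3 then show ?thesis using d2 s by auto
    qed
  qed
  then show ?thesis by (rule that[rotated 2]) (use d1 d2 in auto)
qed

text \<open>The complement is the projection of a closed set along the compact factor
  \<open>{lo..hi}\<close>, hence closed.\<close>

lemma open_dom: "open (dom lo hi)"
proof -
  define W where "W = {z \<in> {lo..hi} \<times> UNIV. snd z * g (fst z) \<ge> 1}"
  have "closed W"
  proof -
    have "closed {z :: real \<times> real. snd z * g (fst z) \<ge> 1}"
      by (intro closed_Collect_le continuous_intros)
    then have "closed (({lo..hi} \<times> UNIV) \<inter> {z. snd z * g (fst z) \<ge> 1})"
      by (intro closed_Int closed_Times) auto
    then show ?thesis by (simp add: W_def Int_def)
  qed
  then have "closedin (top_of_set ({lo..hi} \<times> UNIV)) W"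
    by (intro closed_subset) (auto simp: W_def)
  from closedin_compact_projection[OF compact_Icc this]
  have "closed {\<eta>. \<exists>s. s \<in> {lo..hi} \<and> (s, \<eta>) \<in> W}" by simp
  moreover have "dom lo hi = - {\<eta>. \<exists>s. s \<in> {lo..hi} \<and> (s, \<eta>) \<in> W}"
    by (auto simp: dom_def W_def) (meson atLeastAtMost_iff not_less)
  ultimately show ?thesis by (simp add: open_Compl)
qed

text \<open>Differentiation in \<eta> raises both exponents by one, so the doubly indexed family is
  closed under it up to constants. The signed integral admits negative labels.\<close>

definition J :: "nat \<Rightarrow> nat \<Rightarrow> real \<Rightarrow> real \<Rightarrow> real" where
  "J k m \<alpha> \<eta> = sint (\<lambda>s. g s ^ k * inverse (1 - \<eta> * g s) ^ m) \<alpha>"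

lemma continuous_on_integrand:
  assumes "\<eta> \<in> dom lo hi"
  shows "continuous_on {lo..hi} (\<lambda>s. g s ^ k * inverse (1 - \<eta> * g s) ^ m)"
proof -
  have "1 - \<eta> * g s \<noteq> 0" if "s \<in> {lo..hi}" for s
    using domD[OF assms, of s] that by auto
  then show ?thesis by (intro continuous_intros) auto
qed

lemma J_0 [simp]: "J k m 0 \<eta> = 0"
  by (simp add: J_def)

lemma J_1: "J k m 1 \<eta> = integral {0..1} (\<lambda>s. g s ^ k * inverse (1 - \<eta> * g s) ^ m)"
  by (simp add: J_def sint_nonneg)

lemma J_DERIV_fst:
  assumes "\<eta> \<in> dom lo hi" "lo < 0" "0 < hi" "lo < \<alpha>" "\<alpha> < hi"
  shows "((\<lambda>\<alpha>. J k m \<alpha> \<eta>) has_real_derivative g \<alpha> ^ k * inverse (1 - \<eta> * g \<alpha>) ^ m) (at \<alpha>)"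
  using sint_DERIV[OF continuous_on_integrand[OF assms(1)] assms(2-)]
  by (simp add: J_def[abs_def])

lemma J_DERIV_snd:
  assumes "\<eta> \<in> dom lo hi" "lo \<le> 0" "0 \<le> hi" "lo \<le> \<alpha>" "\<alpha> \<le> hi"
  shows "((\<lambda>\<eta>. J k m \<alpha> \<eta>) has_real_derivative real m * J (Suc k) (Suc m) \<alpha> \<eta>) (at \<eta>)"
proof -
  let ?f = "\<lambda>\<eta> s. g s ^ k * inverse (1 - \<eta> * g s) ^ m"
  let ?f' = "\<lambda>\<eta> s. real m * (g s ^ Suc k * inverse (1 - \<eta> * g s) ^ Suc m)"
  have *: "((\<lambda>\<eta>. integral {a..b} (?f \<eta>)) has_real_derivative integral {a..b} (?f' \<eta>)) (at \<eta>)"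
    if ab: "lo \<le> a" "b \<le> hi" for a b
  proof -
    have ne: "x * g s \<noteq> 1" if "x \<in> dom lo hi" "s \<in> {a..b}" for x s
      using domD[of x lo hi s] that ab by auto
    \<comment> \<open>The Leibniz rule wants a convex parameter set; openness of
      \<open>dom lo hi\<close> afterwards makes the derivative two-sided.\<close>
    have "((\<lambda>\<eta>. integral (cbox a b) (?f \<eta>)) has_real_derivative integral (cbox a b) (?f' \<eta>))
        (at \<eta> within dom lo hi)"
    proof (rule leibniz_rule_field_derivative)
      fix x s assume x: "x \<in> dom lo hi" and s: "s \<in> cbox a b"
      have n: "1 - x * g s \<noteq> 0" using ne[of x s] x s by auto
      have inv: "((\<lambda>x. inverse (1 - x * g s)) has_real_derivative g s * (inverse (1 - x * g s))\<^sup>2)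
          (at x within dom lo hi)"
        using n by (auto intro!: derivative_eq_intros simp: power2_eq_square)
      show "((\<lambda>x. ?f x s) has_real_derivative ?f' x s) (at x within dom lo hi)"
        using DERIV_cmult[OF DERIV_power[OF inv, of m], of "g s ^ k"]
        by (cases m) (simp_all add: power2_eq_square mult_ac)
    next
      fix x assume x: "x \<in> dom lo hi"
      show "?f x integrable_on cbox a b"
        unfolding interval_cbox[symmetric]
        by (intro integrable_continuous_real continuous_on_subset[OF continuous_on_integrand[OF x]])
          (use ab in auto)
    next
      show "continuous_on (dom lo hi \<times> cbox a b) (\<lambda>(x, t). ?f' x t)"
        unfolding split_beta by (intro continuous_intros) (use ne in auto)
    qed (use assms convex_dom in auto)
    then show ?thesis by (simp add: at_within_open[OF assms(1) open_dom])
  qed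
  have lin: "integral {a..b} (?f' \<eta>) = real m * integral {a..b} (\<lambda>s. g s ^ Suc k * inverse (1 - \<eta> * g s) ^ Suc m)"
    for a b by (rule integral_mult_right)
  have "((\<lambda>\<eta>. integral {0..\<alpha>} (?f \<eta>) - integral {\<alpha>..0} (?f \<eta>)) has_real_derivative
      integral {0..\<alpha>} (?f' \<eta>) - integral {\<alpha>..0} (?f' \<eta>)) (at \<eta>)"
    by (intro DERIV_diff *) (use assms in auto)
  then show ?thesis
    unfolding J_def sint_def lin by (simp add: right_diff_distrib)
qed


lemma J_strict_mono:
  assumes "\<eta> \<in> dom lo hi" "lo < 0" "0 < hi" "lo < \<alpha>" "\<alpha> < \<beta>" "\<beta> < hi"
  shows "J 0 1 \<alpha> \<eta> < J 0 1 \<beta> \<eta>"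
proof (rule DERIV_pos_imp_increasing[OF \<open>\<alpha> < \<beta>\<close>])
  fix s assume "\<alpha> \<le> s" "s \<le> \<beta>"
  then show "\<exists>y. ((\<lambda>\<alpha>. J 0 1 \<alpha> \<eta>) has_real_derivative y) (at s) \<and> 0 < y"
    using J_DERIV_fst[OF assms(1-3), of s 0 1] domD[OF assms(1), of s] assms
    by (intro exI[of _ "inverse (1 - \<eta> * g s)"]) auto
qed

text \<open>\<open>K1\<close> and, below, \<open>K2\<close> are the first and second derivative of \<open>K\<close>; \<open>F\<close> is the time as a function of \<open>\<eta>\<close>.\<close>

definition "K \<eta> = J 0 1 1 \<eta>"
definition "K1 \<eta> = J 1 2 1 \<eta>"

lemma K_pos:
  assumes "\<eta> \<in> dom 0 1"
  shows "K \<eta> > 0"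
proof -
  obtain lo hi where "lo < 0" "1 < hi" "\<eta> \<in> dom lo hi"
    using dom_extend[OF assms] by auto
  then show ?thesis using J_strict_mono[of \<eta> lo hi 0 1] by (simp add: K_def)
qed

lemma K_DERIV:
  assumes "\<eta> \<in> dom 0 1"
  shows "(K has_real_derivative K1 \<eta>) (at \<eta>)"
  using J_DERIV_snd[OF assms, of 1 0 1] by (simp add: K_def[abs_def] K1_def numeral_2_eq_2)

lemma K_cont: "\<eta> \<in> dom 0 1 \<Longrightarrow> isCont K \<eta>"
  using K_DERIV DERIV_isCont by blast

lemma dom_interval:
  "\<alpha> \<in> dom lo hi \<Longrightarrow> \<beta> \<in> dom lo hi \<Longrightarrow> \<alpha> \<le> s \<Longrightarrow> s \<le> \<beta> \<Longrightarrow> s \<in> dom lo hi"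
  using convex_dom mem_is_interval_1_I is_interval_convex_1 by blast

definition "F = sint (\<lambda>\<eta>. (K \<eta>)\<^sup>2)"

lemma F_0: "F 0 = 0" by (simp add: F_def)

lemma F_DERIV:
  assumes "\<eta> \<in> dom 0 1"
  shows "(F has_real_derivative (K \<eta>)\<^sup>2) (at \<eta>)"
proof -
  have nb: "\<exists>d>0. \<forall>s. \<bar>s - c\<bar> \<le> d \<longrightarrow> s \<in> dom 0 1" if c: "c \<in> dom 0 1" for c
  proof -
    obtain d where "d > 0" "cball c d \<subseteq> dom 0 1"
      using open_contains_cball open_dom c by blast
    then show ?thesis
      by (intro exI[of _ d]) (auto simp: cball_def dist_real_def abs_minus_commute subset_eq)
  qed
  \<comment> \<open>The integral from 0 to \<eta> needs an interval of admissible parameters with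
    both 0 and \<eta> in its interior: openness gives the margins, convexity everything in
    between.\<close>
  obtain d1 where d1: "d1 > 0" "\<forall>s. \<bar>s - min 0 \<eta>\<bar> \<le> d1 \<longrightarrow> s \<in> dom 0 1"
    using nb[of "min 0 \<eta>"] assms zero_in_dom by (metis min_def)
  obtain d2 where d2: "d2 > 0" "\<forall>s. \<bar>s - max 0 \<eta>\<bar> \<le> d2 \<longrightarrow> s \<in> dom 0 1"
    using nb[of "max 0 \<eta>"] assms zero_in_dom by (metis max_def)
  let ?lo = "min 0 \<eta> - d1" and ?hi = "max 0 \<eta> + d2"
  have "?lo \<in> dom 0 1" "?hi \<in> dom 0 1" using d1 d2 by auto
  then have "{?lo..?hi} \<subseteq> dom 0 1"
    using dom_interval by (meson atLeastAtMost_iff subsetI)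
  then have "continuous_on {?lo..?hi} (\<lambda>\<eta>. (K \<eta>)\<^sup>2)"
    by (intro continuous_at_imp_continuous_on ballI continuous_intros K_cont) auto
  then show ?thesis unfolding F_def
    by (rule sint_DERIV) (use d1 d2 in auto)
qed

lemma dom_01: "\<eta> \<in> dom 0 1 \<Longrightarrow> \<eta> * M < 1"
  using domD[of \<eta> 0 1 a0] a0 at_a0 by auto

lemma in_dom_01:
  assumes "0 \<le> \<eta>" "\<eta> * M < 1"
  shows "\<eta> \<in> dom 0 1"
  unfolding dom_def
proof (intro CollectI ballI)
  fix s :: real assume "s \<in> {0..1}"
  then have "\<eta> * g s \<le> \<eta> * M" using le_M assms by (intro mult_left_mono) auto
  then show "\<eta> * g s < 1" using assms by simp
qed

lemma F_strict_mono:
  assumes "\<alpha> \<in> dom 0 1" "\<beta> \<in> dom 0 1" "\<alpha> < \<beta>"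
  shows "F \<alpha> < F \<beta>"
proof (rule DERIV_pos_imp_increasing[OF \<open>\<alpha> < \<beta>\<close>])
  fix s assume "\<alpha> \<le> s" "s \<le> \<beta>"
  then have "s \<in> dom 0 1" using assms dom_interval by blast
  then show "\<exists>y. (F has_real_derivative y) (at s) \<and> 0 < y"
    by (intro exI[of _ "(K s)\<^sup>2"] conjI F_DERIV zero_less_power K_pos)
qed

section \<open>Asymptotics at the blow-up time\<close>

text \<open>The counterpart of \<open>g_gap\<close>: a bound on how fast \<open>g\<close> falls away
  from its maximum, which is what makes the integrals large.\<close>

lemma g_lipschitz:
  obtains L where "L > 0" "\<And>s. s \<in> {0..1} \<Longrightarrow> M - g s \<le> L * \<bar>s - a0\<bar>"
proof -
  have "smooth_on UNIV (deriv g)"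
    using smooth_on_UNIV_deriv(2)[OF smooth_on_UNIV_deriv(2)[OF smooth]] .
  then have "continuous_on {0..1} (deriv g)"
    unfolding smooth_on_def by (metis continuous_on_subset hdiff.simps(1) subset_UNIV)
  then have "bounded (deriv g ` {0..1})"
    by (intro compact_imp_bounded compact_continuous_image) auto
  then obtain B where B: "B > 0" "\<And>s. s \<in> {0..1} \<Longrightarrow> \<bar>deriv g s\<bar> \<le> B"
    unfolding bounded_pos by auto
  have "norm (g s - g a0) \<le> B * norm (s - a0)" if "s \<in> {0..1}" for s
    by (rule field_differentiable_bound[of "{0..1}" g "deriv g"])
      (use that B a0 in \<open>auto intro!: has_field_derivative_at_within g_DERIV\<close>)
  then have "M - g s \<le> B * \<bar>s - a0\<bar>" if "s \<in> {0..1}" for s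
    using that at_a0 by (fastforce simp: abs_le_iff)
  then show ?thesis using that B(1) by blast
qed

text \<open>The weight \<open>s * (1 - s)\<close> vanishes linearly at both ends and so serves
  whichever of them carry the maximum. Nondegeneracy gives linear growth near the ends, compactness
  a positive gap in the middle.\<close>

lemma g_gap:
  obtains c where "c > 0" "\<And>s. s \<in> {0..1} \<Longrightarrow> c * (s * (1 - s)) \<le> M - g s"
proof -
  have D0: "((\<lambda>s. M - g s) has_real_derivative - deriv g 0) (at 0)"
    by (auto intro!: derivative_eq_intros g_DERIV)
  have D1: "((\<lambda>s. M - g (1 - s)) has_real_derivative deriv g 1) (at 0)"
    using g_DERIV[of 1] by (auto intro!: derivative_eq_intros DERIV_chain2[of g])
  obtain d0 c0 where 0: "0 < d0" "d0 < 1" "0 < c0" "\<And>s. 0 \<le> s \<Longrightarrow> s \<le> d0 \<Longrightarrow> c0 * s \<le> M - g s"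
    by (rule linear_growth_right[OF D0]) (use le_M nondeg[of 0] in auto)
  obtain d1 c1 where 1: "0 < d1" "d1 < 1" "0 < c1" "\<And>s. 0 \<le> s \<Longrightarrow> s \<le> d1 \<Longrightarrow> c1 * s \<le> M - g (1 - s)"
    by (rule linear_growth_right[OF D1]) (use le_M nondeg[of 1] in auto)
  \<comment> \<open>The two end pieces may overlap; then the middle interval is empty and any
    positive \<open>m\<close> will do.\<close>
  have "\<exists>m>0. \<forall>s\<in>{d0..1 - d1}. m \<le> M - g s"
  proof (cases "d0 \<le> 1 - d1")
    case True
    have "\<exists>x\<in>{d0..1 - d1}. \<forall>y\<in>{d0..1 - d1}. M - g x \<le> M - g y"
      by (rule continuous_attains_inf) (use True in \<open>auto intro!: continuous_intros\<close>)
    then obtain x where "x \<in> {d0..1 - d1}" "\<forall>y\<in>{d0..1 - d1}. M - g x \<le> M - g y" by blast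
    then show ?thesis using lt_M[of x] 0 1 by (intro exI[of _ "M - g x"]) auto
  qed (auto intro!: exI[of _ 1])
  then obtain m where m: "m > 0" "\<And>s. s \<in> {d0..1 - d1} \<Longrightarrow> m \<le> M - g s" by blast
  define c where "c = min m (min c0 c1)"
  have c: "c > 0" "c \<le> m" "c \<le> c0" "c \<le> c1" using m 0 1 by (auto simp: c_def)
  have "c * (s * (1 - s)) \<le> M - g s" if s: "s \<in> {0..1}" for s
  proof -
    have b: "s * (1 - s) \<le> s" "s * (1 - s) \<le> 1 - s" "s * (1 - s) \<le> 1" "0 \<le> s * (1 - s)"
      using s mult_left_le[of "1 - s" s] mult_right_le_one_le[of "1 - s" s] by (auto simp: mult.commute)
    consider "s \<le> d0" | "s \<in> {d0..1 - d1}" | "1 - d1 \<le> s" by fastforce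
    then show ?thesis
    proof cases
      case 1
      have "c * (s * (1 - s)) \<le> c0 * s" using b c s by (intro mult_mono) auto
      then show ?thesis using 0(4)[of s] s 1 by auto
    next
      case 2
      have "c * (s * (1 - s)) \<le> m * 1" using b c by (intro mult_mono) auto
      then show ?thesis using m(2)[OF 2] by auto
    next
      case 3
      have "c * (s * (1 - s)) \<le> c1 * (1 - s)" using b c s by (intro mult_mono) auto
      then show ?thesis using 1(4)[of "1 - s"] s 3 by auto
    qed
  qed
  then show ?thesis using that c(1) by blast
qed

lemma J_has_integral:
  assumes "\<eta> \<in> dom 0 1"
  shows "((\<lambda>s. g s ^ k * inverse (1 - \<eta> * g s) ^ m) has_integral J k m 1 \<eta>) {0..1}"
  unfolding J_1
  by (intro integrable_integral integrable_continuous_real continuous_on_integrand assms)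

text \<open>With \<open>b = inverse (1 - \<eta> * g s)\<close> one has
  \<open>b - 1 = \<eta> * g s * b\<close>. This rewrites \<open>K1\<close>, whose integrand changes
  sign, by integrals of positive functions, which can be estimated by comparison.\<close>

lemma K1_eq:
  assumes "\<eta> \<in> dom 0 1"
  shows "\<eta> * K1 \<eta> = J 0 2 1 \<eta> - K \<eta>"
proof -
  have "((\<lambda>s. g s ^ 0 * inverse (1 - \<eta> * g s) ^ 2 - g s ^ 0 * inverse (1 - \<eta> * g s) ^ 1)
      has_integral J 0 2 1 \<eta> - J 0 1 1 \<eta>) {0..1}"
    by (intro has_integral_diff J_has_integral assms)
  moreover have "((\<lambda>s. \<eta> * (g s ^ 1 * inverse (1 - \<eta> * g s) ^ 2)) has_integral \<eta> * J 1 2 1 \<eta>) {0..1}"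
    by (intro has_integral_mult_right J_has_integral assms)
  moreover have "g s ^ 0 * inverse (1 - \<eta> * g s) ^ 2 - g s ^ 0 * inverse (1 - \<eta> * g s) ^ 1
      = \<eta> * (g s ^ 1 * inverse (1 - \<eta> * g s) ^ 2)" if "s \<in> {0..1}" for s
  proof -
    have "1 - \<eta> * g s \<noteq> 0" using domD[OF assms, of s] that by auto
    then have "inverse (1 - \<eta> * g s) - 1 = \<eta> * g s * inverse (1 - \<eta> * g s)"
      by (simp add: field_simps)
    then show ?thesis
      by (simp add: power2_eq_square mult_ac) (metis mult.assoc mult.commute right_diff_distrib mult.right_neutral)
  qed
  ultimately show ?thesis
    unfolding K1_def K_def by (metis (no_types, lifting) has_integral_cong has_integral_unique)
qed


text \<open>The fourth root keeps all exponents integral: \<open>K \<le> C / r\<close> is weaker than the true logarithmic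
  growth, but it suffices.\<close>

definition r :: "real \<Rightarrow> real" where "r \<eta> = sqrt (sqrt (1 - \<eta> * M))"

lemma r_pos: "\<eta> * M < 1 \<Longrightarrow> r \<eta> > 0"
  by (simp add: r_def)

lemma r_power4: "\<eta> * M < 1 \<Longrightarrow> r \<eta> ^ 4 = 1 - \<eta> * M"
  using power_mult[of "r \<eta>" 2 2] by (simp add: r_def)

text \<open>By \<open>g_gap\<close> the denominator lies above one of two affine functions, peaked
  at the two ends; the sum of both reciprocals dominates in either case. Keeping \<eta> away from 0
  makes \<open>\<eta> * (M - g s)\<close> comparable to the gap itself.\<close>

lemma upper_bounds:
  obtains C where "C > 0"
    "\<And>\<eta>. 1 / (2 * M) \<le> \<eta> \<Longrightarrow> \<eta> * M < 1 \<Longrightarrow> K \<eta> \<le> C / r \<eta> \<and> J 0 2 1 \<eta> \<le> C / r \<eta> ^ 4"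
proof -
  obtain c where c: "c > 0" "\<And>s. s \<in> {0..1} \<Longrightarrow> c * (s * (1 - s)) \<le> M - g s" using g_gap by blast
  \<comment> \<open>The factor \<open>1 / (2 * M)\<close> is the lower bound of \<eta>; a further
    half is lost in \<open>s * (1 - s) \<ge> s / 2\<close> on the left half of the interval, and
    symmetrically on the right.\<close>
  define d where "d = c / (4 * M)"
  have d: "d > 0" using c M_pos by (simp add: d_def)
  define C where "C = max (8 / d * sqrt (sqrt (1 + d))) (2 / d)"
  have "K \<eta> \<le> C / r \<eta> \<and> J 0 2 1 \<eta> \<le> C / r \<eta> ^ 4" if \<eta>: "1 / (2 * M) \<le> \<eta>" "\<eta> * M < 1" for \<eta>
  proof
    have "\<eta> > 0" using \<eta>(1) M_pos by (meson divide_pos_pos less_le_trans mult_pos_pos zero_less_numeral zero_less_one)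
    then have dom: "\<eta> \<in> dom 0 1" using in_dom_01 \<eta> by simp
    define e where "e = 1 - \<eta> * M"
    have e: "0 < e" "e < 1" using \<eta> \<open>\<eta> > 0\<close> M_pos by (auto simp: e_def)
    have lower: "1 - \<eta> * g s \<ge> e + d * s \<or> 1 - \<eta> * g s \<ge> e + d * (1 - s)" if s: "s \<in> {0..1}" for s
    proof -
      have "2 * d * (s * (1 - s)) = 1 / (2 * M) * (c * (s * (1 - s)))" by (simp add: d_def)
      also have "\<dots> \<le> \<eta> * (M - g s)"
        by (rule mult_mono) (use \<eta> c s \<open>\<eta> > 0\<close> in auto)
      finally have *: "e + 2 * d * (s * (1 - s)) \<le> 1 - \<eta> * g s" by (simp add: e_def algebra_simps)
      show ?thesis
      proof (cases "s \<le> 1 / 2")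
        case True
        then have "s * (1 / 2) \<le> s * (1 - s)" using s by (intro mult_left_mono) auto
        then have "d * (s * (1 / 2)) \<le> d * (s * (1 - s))" by (rule mult_left_mono) (use d in simp)
        then show ?thesis using * by simp
      next
        case False
        then have "(1 / 2) * (1 - s) \<le> s * (1 - s)" using s by (intro mult_right_mono) auto
        then have "d * ((1 / 2) * (1 - s)) \<le> d * (s * (1 - s))" by (rule mult_left_mono) (use d in simp)
        then show ?thesis using * by simp
      qed
    qed
    have pos: "e + d * s > 0" "e + d * (1 - s) > 0" if "s \<in> {0..1}" for s
      using that e d by (auto intro: add_pos_nonneg)
    have inv: "inverse (1 - \<eta> * g s) \<le> inverse (e + d * s) \<or> inverse (1 - \<eta> * g s) \<le> inverse (e + d * (1 - s))"
      if s: "s \<in> {0..1}" for s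
      using lower[OF s] pos[OF s] le_imp_inverse_le by blast
    have inv0: "0 \<le> inverse (1 - \<eta> * g s)" "0 \<le> inverse (e + d * s)" "0 \<le> inverse (e + d * (1 - s))"
      if s: "s \<in> {0..1}" for s
      using domD[OF dom, of s] pos[OF s] s by (auto intro!: less_imp_le)
    note I = has_integral_inverse_affine[OF e(1) d]
    have "K \<eta> \<le> ln ((e + d) / e) / d + ln ((e + d) / e) / d"
      unfolding K_def
    proof (rule has_integral_le[OF J_has_integral[OF dom] has_integral_add[OF I(1,2)]])
      fix s :: real assume s: "s \<in> {0..1}"
      show "g s ^ 0 * inverse (1 - \<eta> * g s) ^ 1 \<le> inverse (e + d * s) + inverse (e + d * (1 - s))"
        using inv[OF s] inv0[OF s] by (simp del: inverse_nonnegative_iff_nonnegative) linarith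
    qed
    also have "\<dots> = 2 / d * ln ((e + d) / e)" by simp
    also have "\<dots> \<le> 2 / d * (4 * sqrt (sqrt (1 + d)) / r \<eta>)"
    proof (rule mult_left_mono)
      have r: "r \<eta> > 0" "r \<eta> ^ 4 = e" using r_pos r_power4 \<eta> by (auto simp: e_def)
      have q: "sqrt (sqrt (1 + d)) ^ 4 = 1 + d" 
        using d power_mult[of "sqrt (sqrt (1 + d))" 2 2] by simp
      have "ln ((e + d) / e) \<le> ln ((1 + d) / e)"
        using e d by (intro ln_mono divide_right_mono divide_pos_pos) auto
      also have "\<dots> = ln ((sqrt (sqrt (1 + d)) / r \<eta>) ^ 4)" by (simp add: power_divide q r)
      \<comment> \<open>Extracting the fourth root before applying \<open>ln x \<le> x\<close>
        trades the logarithm for a multiple of \<open>1 / r \<eta>\<close>.\<close>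
      also have "\<dots> = 4 * ln (sqrt (sqrt (1 + d)) / r \<eta>)"
        using r(1) d by (subst ln_realpow) auto
      also have "\<dots> \<le> 4 * (sqrt (sqrt (1 + d)) / r \<eta>)"
        using r(1) d ln_bound[of "sqrt (sqrt (1 + d)) / r \<eta>"] by simp
      finally show "ln ((e + d) / e) \<le> 4 * sqrt (sqrt (1 + d)) / r \<eta>" by simp
    qed (use d in simp)
    also have "\<dots> = (8 / d * sqrt (sqrt (1 + d))) / r \<eta>" by simp
    also have "\<dots> \<le> C / r \<eta>"
      using r_pos[OF \<eta>(2)] by (intro divide_right_mono) (auto simp: C_def)
    finally show "K \<eta> \<le> C / r \<eta>" .
    have "J 0 2 1 \<eta> \<le> inverse (e * (e + d)) + inverse (e * (e + d))"
    proof (rule has_integral_le[OF J_has_integral[OF dom] has_integral_add[OF I(3,4)]])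
      fix s :: real assume s: "s \<in> {0..1}"
      have "(inverse (1 - \<eta> * g s))\<^sup>2 \<le> (inverse (e + d * s))\<^sup>2 \<or>
          (inverse (1 - \<eta> * g s))\<^sup>2 \<le> (inverse (e + d * (1 - s)))\<^sup>2"
        using inv[OF s] inv0[OF s] power_mono by blast
      then show "g s ^ 0 * inverse (1 - \<eta> * g s) ^ 2 \<le> (inverse (e + d * s))\<^sup>2 + (inverse (e + d * (1 - s)))\<^sup>2"
        by (auto intro: add_increasing add_increasing2)
    qed
    also have "\<dots> = 2 / (e * (e + d))" by (simp add: inverse_eq_divide)
    also have "\<dots> \<le> 2 / (e * d)"
      using e d by (intro divide_left_mono mult_left_mono) auto
    also have "\<dots> = (2 / d) / e" by simp
    also have "\<dots> \<le> C / e" using e by (intro divide_right_mono) (auto simp: C_def)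
    finally show "J 0 2 1 \<eta> \<le> C / r \<eta> ^ 4" using r_power4[OF \<eta>(2)] by (simp add: e_def)
  qed
  moreover have "C > 0" using d by (simp add: C_def less_max_iff_disj)
  ultimately show ?thesis using that by blast
qed

text \<open>The integrands are positive, so comparison with one affine function attached to
  \<open>a0\<close> is enough. \<open>L = L' / M\<close> arises from the Lipschitz constant and
  \<open>\<eta> \<le> 1 / M\<close>.\<close>

lemma lower_bounds:
  obtains L where "L > 0"
    "\<And>\<eta>. 0 \<le> \<eta> \<Longrightarrow> \<eta> * M < 1 \<Longrightarrow>
      ln ((1 - \<eta> * M + L) / (1 - \<eta> * M)) / L \<le> K \<eta> \<and>
      inverse (1 + L) / r \<eta> ^ 4 \<le> J 0 2 1 \<eta>"
proof -
  obtain L' where L': "L' > 0" "\<And>s. s \<in> {0..1} \<Longrightarrow> M - g s \<le> L' * \<bar>s - a0\<bar>" using g_lipschitz by blast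
  define L where "L = L' / M"
  have L: "L > 0" using L' M_pos by (simp add: L_def)
  have "ln ((1 - \<eta> * M + L) / (1 - \<eta> * M)) / L \<le> K \<eta> \<and> inverse (1 + L) / r \<eta> ^ 4 \<le> J 0 2 1 \<eta>"
    if \<eta>: "0 \<le> \<eta>" "\<eta> * M < 1" for \<eta>
  proof -
    have dom: "\<eta> \<in> dom 0 1" using in_dom_01 \<eta> by simp
    define e where "e = 1 - \<eta> * M"
    have e: "0 < e" "e \<le> 1" using \<eta> M_pos by (auto simp: e_def)
    have up: "1 - \<eta> * g s \<le> e + L * \<bar>s - a0\<bar>" if s: "s \<in> {0..1}" for s
    proof -
      have "\<eta> \<le> 1 / M" using \<eta> M_pos by (simp add: field_simps)
      then have "\<eta> * (M - g s) \<le> 1 / M * (L' * \<bar>s - a0\<bar>)"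
        by (rule mult_mono) (use L' s le_M[OF s] M_pos in auto)
      then show ?thesis by (simp add: e_def L_def algebra_simps)
    qed
    define f where "f = (\<lambda>s. inverse (e + L * \<bar>s - a0\<bar>))"
    have f0: "0 \<le> f s" for s using e L by (simp add: f_def)
    have le: "f s \<le> inverse (1 - \<eta> * g s)" if s: "s \<in> {0..1}" for s
      unfolding f_def using up[OF s] domD[OF dom, of s] s by (intro le_imp_inverse_le) auto
    note I = has_integral_inverse_affine[OF e(1) L]
    have fs: "f s = (if a0 = 0 then inverse (e + L * s) else inverse (e + L * (1 - s)))"
      if "s \<in> {0..1}" for s
      using a0 that by (auto simp: f_def)
    have "(f has_integral ln ((e + L) / e) / L) {0..1}"
      by (rule has_integral_eq[rotated, of "\<lambda>s. if a0 = 0 then inverse (e + L * s) else inverse (e + L * (1 - s))"])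
        (cases "a0 = 0"; use I(1,2) fs in simp)+
    then have "ln ((e + L) / e) / L \<le> K \<eta>"
      unfolding K_def by (rule has_integral_le[OF _ J_has_integral[OF dom]]) (use le in auto)
    moreover have "((\<lambda>s. (f s)\<^sup>2) has_integral inverse (e * (e + L))) {0..1}"
      by (rule has_integral_eq[rotated, of "\<lambda>s. if a0 = 0 then (inverse (e + L * s))\<^sup>2 else (inverse (e + L * (1 - s)))\<^sup>2"])
        (cases "a0 = 0"; use I(3,4) fs in simp)+
    then have "inverse (e * (e + L)) \<le> J 0 2 1 \<eta>"
      by (rule has_integral_le[OF _ J_has_integral[OF dom]]) (use le f0 in \<open>auto intro: power_mono\<close>)
    moreover have "inverse (1 + L) / e \<le> inverse (e * (e + L))"
      using e L by (auto simp: divide_inverse mult.commute intro!: mult_left_mono le_imp_inverse_le)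
    ultimately show ?thesis using r_power4[OF \<eta>(2)] by (simp add: e_def)
  qed
  then show ?thesis using that L by blast
qed


text \<open>The velocity gradient at a particle with \<open>u0' = p\<close>, as a function of \<open>\<eta>\<close>.\<close>

definition vel :: "real \<Rightarrow> real \<Rightarrow> real" where
  "vel p \<eta> = p / (1 - \<eta> * p) / (K \<eta>)\<^sup>2 - K1 \<eta> / (K \<eta>) ^ 3"

lemma ev_left:
  assumes "b < 1 / M"
  shows "\<forall>\<^sub>F \<eta> in at_left (1 / M). b < \<eta> \<and> \<eta> * M < 1"
  using assms M_pos unfolding eventually_at_left_field
  by (intro exI[of _ b]) (auto simp: field_simps)

lemma ev_half: "\<forall>\<^sub>F \<eta> in at_left (1 / M). 1 / (2 * M) < \<eta> \<and> \<eta> * M < 1"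
  by (rule ev_left) (use M_pos in \<open>simp add: field_simps\<close>)

lemma half_nonneg: "1 / (2 * M) < \<eta> \<Longrightarrow> 0 < \<eta>"
  using M_pos by (meson divide_pos_pos less_trans mult_pos_pos zero_less_numeral zero_less_one)

lemma e_tendsto: "((\<lambda>\<eta>. 1 - \<eta> * M) \<longlongrightarrow> 0) (at_left (1 / M))"
proof -
  have "((\<lambda>\<eta>. 1 - \<eta> * M) \<longlongrightarrow> 1 - (1 / M) * M) (at_left (1 / M))"
    by (intro tendsto_intros)
  then show ?thesis using M_pos by simp
qed

lemma inverse_r_at_top: "filterlim (\<lambda>\<eta>. inverse (r \<eta>)) at_top (at_left (1 / M))"
proof (rule filterlim_inverse_at_top)
  have "((\<lambda>\<eta>. sqrt (sqrt (1 - \<eta> * M))) \<longlongrightarrow> sqrt (sqrt 0)) (at_left (1 / M))"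
    by (intro tendsto_real_sqrt e_tendsto)
  then show "(r \<longlongrightarrow> 0) (at_left (1 / M))" by (simp add: r_def[abs_def])
  show "\<forall>\<^sub>F \<eta> in at_left (1 / M). 0 < r \<eta>"
    using ev_half by eventually_elim (simp add: r_pos)
qed

text \<open>Dropping \<open>1 - \<eta> * M\<close> from the numerator inside the logarithm leaves
  \<open>ln (L / (1 - \<eta> * M)) / L\<close>, which still diverges.\<close>

lemma K_at_top: "filterlim K at_top (at_left (1 / M))"
proof -
  obtain L where L: "L > 0" "\<And>\<eta>. 0 \<le> \<eta> \<Longrightarrow> \<eta> * M < 1 \<Longrightarrow>
      ln ((1 - \<eta> * M + L) / (1 - \<eta> * M)) / L \<le> K \<eta> \<and> inverse (1 + L) / r \<eta> ^ 4 \<le> J 0 2 1 \<eta>"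
    using lower_bounds by blast
  have "filterlim (\<lambda>\<eta>. inverse (1 - \<eta> * M)) at_top (at_left (1 / M))"
  proof (rule filterlim_inverse_at_top[OF e_tendsto])
    show "\<forall>\<^sub>F \<eta> in at_left (1 / M). 0 < 1 - \<eta> * M"
      using ev_half by eventually_elim simp
  qed
  then have "filterlim (\<lambda>\<eta>. (1 / L) * ln (L * inverse (1 - \<eta> * M))) at_top (at_left (1 / M))"
    using L(1) by (intro filterlim_tendsto_pos_mult_at_top[OF tendsto_const]
        filterlim_compose[OF ln_at_top]) auto
  then show ?thesis
  proof (rule filterlim_at_top_mono)
    show "\<forall>\<^sub>F \<eta> in at_left (1 / M). (1 / L) * ln (L * inverse (1 - \<eta> * M)) \<le> K \<eta>"
      using ev_half
    proof eventually_elim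
      case (elim \<eta>)
      have "ln (L * inverse (1 - \<eta> * M)) \<le> ln ((1 - \<eta> * M + L) / (1 - \<eta> * M))"
        unfolding divide_inverse using elim L(1) by (intro ln_mono mult_right_mono) auto
      then have "ln (L * inverse (1 - \<eta> * M)) / L \<le> ln ((1 - \<eta> * M + L) / (1 - \<eta> * M)) / L"
        using L(1) by (intro divide_right_mono) auto
      then show ?case using L(2)[of \<eta>] elim half_nonneg[of \<eta>] by auto
    qed
  qed
qed

text \<open>The negative term carries one factor \<open>1 / K\<close> more than the positive one, so
  it eventually takes away at most half of it. The remaining half exceeds a multiple of
  \<open>1 / r\<^sup>2\<close>, because \<open>K \<le> C / r\<close>.\<close>

lemma vel_max_at_top: "filterlim (vel M) at_top (at_left (1 / M))"
proof -
  obtain C where C: "C > 0"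
    "\<And>\<eta>. 1 / (2 * M) \<le> \<eta> \<Longrightarrow> \<eta> * M < 1 \<Longrightarrow> K \<eta> \<le> C / r \<eta> \<and> J 0 2 1 \<eta> \<le> C / r \<eta> ^ 4"
    using upper_bounds by blast
  have "filterlim (\<lambda>\<eta>. M / (2 * C\<^sup>2) * (inverse (r \<eta>))\<^sup>2) at_top (at_left (1 / M))"
    using C(1) M_pos
    by (intro filterlim_tendsto_pos_mult_at_top[OF tendsto_const] filterlim_pow_at_top inverse_r_at_top) auto
  then show ?thesis
  proof (rule filterlim_at_top_mono)
    \<comment> \<open>From \<open>1 / \<eta> \<le> 2 * M\<close> the negative term is at most
      \<open>2 * M * C / (r ^ 4 * K ^ 3)\<close>; the threshold \<open>4 * C\<close> makes this half
      of \<open>M / (r ^ 4 * K\<^sup>2)\<close>.\<close>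
    have "\<forall>\<^sub>F \<eta> in at_left (1 / M). 4 * C \<le> K \<eta>"
      using K_at_top unfolding filterlim_at_top by blast
    then show "\<forall>\<^sub>F \<eta> in at_left (1 / M). M / (2 * C\<^sup>2) * (inverse (r \<eta>))\<^sup>2 \<le> vel M \<eta>"
      using ev_half
    proof eventually_elim
      case (elim \<eta>)
      note \<eta>0 = half_nonneg[OF conjunct1[OF elim(2)]]
      have dom: "\<eta> \<in> dom 0 1" using in_dom_01 \<eta>0 elim by simp
      define k j \<rho> where "k = K \<eta>" and "j = J 0 2 1 \<eta>" and "\<rho> = r \<eta>"
      have k: "k > 0" "4 * C \<le> k" "k \<le> C / \<rho>" and j: "j \<le> C / \<rho> ^ 4" and \<rho>: "\<rho> > 0" "\<rho> ^ 4 = 1 - \<eta> * M"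
        using K_pos[OF dom] C(2)[of \<eta>] elim r_pos[of \<eta>] r_power4[of \<eta>] by (auto simp: k_def j_def \<rho>_def)
      have "K1 \<eta> = (j - k) / \<eta>" using K1_eq[OF dom] \<eta>0 by (simp add: k_def j_def field_simps)
      also have "\<dots> \<le> (C / \<rho> ^ 4) / \<eta>" using j k \<eta>0 by (intro divide_right_mono) auto
      also have "\<dots> \<le> (C / \<rho> ^ 4) * (2 * M)"
      proof -
        have "1 / \<eta> \<le> 2 * M" using elim(2) M_pos \<eta>0 by (simp add: field_simps)
        then have "(C / \<rho> ^ 4) * (1 / \<eta>) \<le> (C / \<rho> ^ 4) * (2 * M)"
          using C(1) \<rho>(1) by (intro mult_left_mono) auto
        then show ?thesis by simp
      qed
      finally have "K1 \<eta> / k ^ 3 \<le> (C / \<rho> ^ 4) * (2 * M) / k ^ 3"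
        using k by (intro divide_right_mono) auto
      also have "\<dots> = (2 * M * C) / (\<rho> ^ 4 * k\<^sup>2) / k" by (simp add: power3_eq_cube power2_eq_square mult_ac)
      also have "\<dots> \<le> (2 * M * C) / (\<rho> ^ 4 * k\<^sup>2) / (4 * C)"
        using k C(1) M_pos \<rho>(1) by (intro divide_left_mono) auto
      also have "\<dots> = M / (\<rho> ^ 4 * k\<^sup>2) / 2" using C(1) by (simp add: field_simps)
      finally have 1: "K1 \<eta> / k ^ 3 \<le> M / (\<rho> ^ 4 * k\<^sup>2) / 2" .
      have 2: "vel M \<eta> = M / (\<rho> ^ 4 * k\<^sup>2) - K1 \<eta> / k ^ 3"
        by (simp add: vel_def k_def \<rho>)
      have "k\<^sup>2 \<le> (C / \<rho>)\<^sup>2" using k by (intro power_mono) auto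
      then have "\<rho> ^ 4 * k\<^sup>2 \<le> \<rho> ^ 4 * (C / \<rho>)\<^sup>2" using \<rho>(1) by (intro mult_left_mono) auto
      also have "\<dots> = C\<^sup>2 * \<rho>\<^sup>2" using \<rho>(1) by (simp add: power2_eq_square power4_eq_xxxx)
      finally have "M / (C\<^sup>2 * \<rho>\<^sup>2) \<le> M / (\<rho> ^ 4 * k\<^sup>2)"
        using \<rho>(1) k(1) C(1) M_pos by (intro divide_left_mono) (auto intro!: mult_pos_pos)
      then have "M / (C\<^sup>2 * \<rho>\<^sup>2) / 2 \<le> vel M \<eta>"
      proof -
        have *: "x / 2 \<le> vel M \<eta>" if "x \<le> X" "y \<le> X / 2" "vel M \<eta> = X - y" for x y X :: real
          using that by linarith
        show ?thesis
          by (rule *[OF \<open>M / (C\<^sup>2 * \<rho>\<^sup>2) \<le> M / (\<rho> ^ 4 * k\<^sup>2)\<close> 1 2])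
      qed
      moreover have "M / (2 * C\<^sup>2) * (inverse \<rho>)\<^sup>2 = M / (C\<^sup>2 * \<rho>\<^sup>2) / 2"
        by (simp add: inverse_eq_divide power_divide)
      ultimately show ?case by (simp add: \<rho>_def)
    qed
  qed
qed

text \<open>Here \<open>1 - \<eta> * p\<close> stays away from 0 and the first term stays bounded.
  In \<open>K1 / K ^ 3\<close> the integral \<open>J 0 2 1\<close> contributes \<open>r\<close> to
  the power -4, and dividing by \<open>K ^ 3\<close> costs at most three of these four powers, so a
  multiple of \<open>1 / r\<close> survives.\<close>

lemma vel_at_bot:
  assumes "p < M"
  shows "filterlim (vel p) at_bot (at_left (1 / M))"
proof -
  obtain C where C: "C > 0"
    "\<And>\<eta>. 1 / (2 * M) \<le> \<eta> \<Longrightarrow> \<eta> * M < 1 \<Longrightarrow> K \<eta> \<le> C / r \<eta> \<and> J 0 2 1 \<eta> \<le> C / r \<eta> ^ 4"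
    using upper_bounds by blast
  obtain L where L: "L > 0" "\<And>\<eta>. 0 \<le> \<eta> \<Longrightarrow> \<eta> * M < 1 \<Longrightarrow>
      ln ((1 - \<eta> * M + L) / (1 - \<eta> * M)) / L \<le> K \<eta> \<and> inverse (1 + L) / r \<eta> ^ 4 \<le> J 0 2 1 \<eta>"
    using lower_bounds by blast
  \<comment> \<open>A common lower bound of \<open>1 - \<eta> * p\<close>: it is at least 1 for
    negative \<open>p\<close>, and at least \<open>1 - p / M\<close> otherwise.\<close>
  define m where "m = min 1 (1 - p / M)"
  have m: "m > 0" using assms M_pos by (simp add: m_def)
  \<comment> \<open>\<open>M\<close> bounds \<open>1 / \<eta>\<close> from below,
    \<open>inverse (1 + L)\<close> comes from the lower bound of \<open>J 0 2 1\<close>, and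
    \<open>C ^ 3\<close> from the upper bound of \<open>K ^ 3\<close>.\<close>
  define c where "c = M * inverse (1 + L) / C ^ 3"
  have c: "c > 0" using M_pos L C by (simp add: c_def)
  have "filterlim (\<lambda>\<eta>. - (\<bar>p\<bar> / m + 2 * M) + c * inverse (r \<eta>)) at_top (at_left (1 / M))"
    by (intro filterlim_tendsto_add_at_top[OF tendsto_const]
        filterlim_tendsto_pos_mult_at_top[OF tendsto_const c inverse_r_at_top])
  then have "filterlim (\<lambda>\<eta>. - vel p \<eta>) at_top (at_left (1 / M))"
  proof (rule filterlim_at_top_mono)
    have "\<forall>\<^sub>F \<eta> in at_left (1 / M). 1 \<le> K \<eta>"
      using K_at_top unfolding filterlim_at_top by blast
    then show "\<forall>\<^sub>F \<eta> in at_left (1 / M). - (\<bar>p\<bar> / m + 2 * M) + c * inverse (r \<eta>) \<le> - vel p \<eta>"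
      using ev_half
    proof eventually_elim
      case (elim \<eta>)
      note \<eta>0 = half_nonneg[OF conjunct1[OF elim(2)]]
      have dom: "\<eta> \<in> dom 0 1" using in_dom_01 \<eta>0 elim by simp
      define k j \<rho> where "k = K \<eta>" and "j = J 0 2 1 \<eta>" and "\<rho> = r \<eta>"
      have k: "k \<ge> 1" "k > 0" "k \<le> C / \<rho>" and j: "inverse (1 + L) / \<rho> ^ 4 \<le> j" and \<rho>: "\<rho> > 0"
        using C(2)[of \<eta>] L(2)[of \<eta>] elim \<eta>0 r_pos[of \<eta>] by (auto simp: k_def j_def \<rho>_def)
      have inv: "M \<le> 1 / \<eta>" "1 / \<eta> \<le> 2 * M" using elim(2) M_pos \<eta>0 by (auto simp: field_simps)
      have pm: "1 - \<eta> * p \<ge> m"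
      proof (cases "p \<ge> 0")
        case True
        have "\<eta> \<le> 1 / M" using elim(2) M_pos by (simp add: field_simps)
        then have "\<eta> * p \<le> 1 / M * p" using True by (intro mult_right_mono) auto
        then show ?thesis by (simp add: m_def)
      next
        case False
        then have "\<eta> * p \<le> 0" using \<eta>0 by (simp add: mult_nonneg_nonpos)
        then show ?thesis by (simp add: m_def)
      qed
      have "p / (1 - \<eta> * p) / k\<^sup>2 \<le> \<bar>p\<bar> / m / 1"
      proof (rule frac_le)
        show "p / (1 - \<eta> * p) \<le> \<bar>p\<bar> / m" using pm m by (rule_tac frac_le) auto
      qed (use k m in auto)
      then have 1: "p / (1 - \<eta> * p) / k\<^sup>2 \<le> \<bar>p\<bar> / m" by simp
      have "k / k ^ 3 \<le> 1"
        using power_increasing[of 1 3 k] k(1,2) by (simp add: divide_le_eq_1_pos)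
      then have 2: "(1 / \<eta>) * (k / k ^ 3) \<le> 2 * M * 1"
        by (intro mult_mono) (use inv k M_pos in auto)
      have "(C / \<rho>) ^ 3 \<ge> k ^ 3" using k by (intro power_mono) auto
      then have "inverse (1 + L) / \<rho> ^ 4 / (C / \<rho>) ^ 3 \<le> j / k ^ 3"
        using j k \<rho> L(1) order.trans[OF _ j, of 0] by (intro frac_le) auto
      then have "M * (inverse (1 + L) / \<rho> ^ 4 / (C / \<rho>) ^ 3) \<le> (1 / \<eta>) * (j / k ^ 3)"
        by (rule mult_mono[OF inv(1)]) (use \<eta>0 \<rho> L C in auto)
      moreover have "M * (inverse (1 + L) / \<rho> ^ 4 / (C / \<rho>) ^ 3) = c * inverse \<rho>"
      proof -
        have "M * (i / (\<rho> * q) / (C ^ 3 / q)) = M * i / C ^ 3 * inverse \<rho>" if "q > 0" for i q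
          using \<rho> C(1) that by (simp add: field_simps)
        from this[of "\<rho> ^ 3" "inverse (1 + L)"] show ?thesis
          using \<rho> by (simp add: c_def power_divide power3_eq_cube power4_eq_xxxx mult.assoc)
      qed
      moreover have "K1 \<eta> / k ^ 3 = (1 / \<eta>) * (j / k ^ 3) - (1 / \<eta>) * (k / k ^ 3)"
      proof -
        have "K1 \<eta> = (j - k) / \<eta>" using K1_eq[OF dom] \<eta>0 by (simp add: k_def j_def field_simps)
        then show ?thesis by (simp add: diff_divide_distrib)
      qed
      moreover have "vel p \<eta> = p / (1 - \<eta> * p) / k\<^sup>2 - K1 \<eta> / k ^ 3"
        by (simp add: vel_def k_def)
      ultimately show ?case using 1 2 unfolding \<rho>_def by linarith
    qed
  qed
  then show ?thesis by (simp add: filterlim_uminus_at_bot)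
qed

text \<open>The bound \<open>K\<^sup>2 \<le> C\<^sup>2 / sqrt (1 - \<eta> * M)\<close> has the
  bounded antiderivative \<open>- 2 * C\<^sup>2 / M * sqrt (1 - \<eta> * M)\<close>; adding the
  opposite term to \<open>F\<close> makes it nonincreasing. This is where the blow-up time becomes
  finite.\<close>

lemma F_bdd_above: "bdd_above (F ` {0..<1 / M})"
proof -
  obtain C where C: "C > 0"
    "\<And>\<eta>. 1 / (2 * M) \<le> \<eta> \<Longrightarrow> \<eta> * M < 1 \<Longrightarrow> K \<eta> \<le> C / r \<eta> \<and> J 0 2 1 \<eta> \<le> C / r \<eta> ^ 4"
    using upper_bounds by blast
  define h where "h = 1 / (2 * M)"
  define B where "B = F h + 2 * C\<^sup>2 / M * sqrt (1 - h * M)"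
  have h: "0 < h" "h * M < 1" "h < 1 / M" using M_pos by (auto simp: h_def field_simps)
  have B: "F \<eta> \<le> B" if \<eta>: "\<eta> \<ge> h" "\<eta> * M < 1" for \<eta>
  proof -
    have "F \<eta> + 2 * C\<^sup>2 / M * sqrt (1 - \<eta> * M) \<le> F h + 2 * C\<^sup>2 / M * sqrt (1 - h * M)"
    proof (rule DERIV_nonpos_imp_nonincreasing[OF \<eta>(1)])
      fix x assume x: "h \<le> x" "x \<le> \<eta>"
      have xM: "x * M < 1" using x \<eta> M_pos by (meson less_le_trans mult_right_mono not_le less_imp_le)
      have dom: "x \<in> dom 0 1" using in_dom_01 xM x h by simp
      have "((\<lambda>\<eta>. F \<eta> + 2 * C\<^sup>2 / M * sqrt (1 - \<eta> * M)) has_real_derivative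
          (K x)\<^sup>2 + 2 * C\<^sup>2 / M * (inverse (sqrt (1 - x * M)) / 2 * - M)) (at x)"
        using xM by (auto intro!: derivative_eq_intros F_DERIV[OF dom])
      moreover have "(K x)\<^sup>2 \<le> (C / r x)\<^sup>2"
        using C(2)[of x] K_pos[OF dom] xM x by (intro power_mono) (auto simp: h_def)
      then have "(K x)\<^sup>2 + 2 * C\<^sup>2 / M * (inverse (sqrt (1 - x * M)) / 2 * - M) \<le> 0"
        using xM M_pos by (simp add: r_def power_divide field_simps)
      ultimately show "\<exists>y. ((\<lambda>\<eta>. F \<eta> + 2 * C\<^sup>2 / M * sqrt (1 - \<eta> * M)) has_real_derivative y) (at x) \<and> y \<le> 0"
        by blast
    qed
    moreover have "0 \<le> 2 * C\<^sup>2 / M * sqrt (1 - \<eta> * M)" using \<eta> M_pos by simp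
    ultimately show ?thesis by (simp add: B_def)
  qed
  have "F \<eta> \<le> B" if "\<eta> \<in> {0..<1 / M}" for \<eta>
  proof (cases "\<eta> \<ge> h")
    case True
    then show ?thesis using B that M_pos by (simp add: field_simps)
  next
    case False
    have "\<eta> * M < 1" using that M_pos by (simp add: field_simps)
    then have "F \<eta> < F h" using False that h by (intro F_strict_mono in_dom_01) auto
    then show ?thesis using B[of h] h by simp
  qed
  then show ?thesis by (rule bdd_aboveI2)
qed

text \<open>\<open>F\<close> is increasing, so the supremum is its limit at \<open>1 / M\<close>,
  the time at which \<eta> arrives there.\<close>

definition "ts = (SUP \<eta>\<in>{0..<1 / M}. F \<eta>)"

lemma in_dom_01': "\<eta> \<in> {0..<1 / M} \<Longrightarrow> \<eta> \<in> dom 0 1"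
  using in_dom_01 M_pos by (simp add: field_simps)

lemma F_less_ts:
  assumes "\<eta> \<in> {0..<1 / M}"
  shows "F \<eta> < ts"
proof -
  obtain \<eta>' where "\<eta> < \<eta>'" "\<eta>' < 1 / M" using dense[of \<eta> "1 / M"] assms by auto
  then have "F \<eta> < F \<eta>'" "F \<eta>' \<le> ts"
    unfolding ts_def using assms F_bdd_above
    by (auto intro!: cSUP_upper F_strict_mono in_dom_01')
  then show ?thesis by simp
qed

lemma ts_pos: "ts > 0"
  using F_less_ts[of 0] M_pos F_0 by simp

lemma F_surj:
  assumes "0 \<le> t" "t < ts"
  obtains \<eta> where "\<eta> \<in> {0..<1 / M}" "F \<eta> = t"
proof -
  obtain h where h: "h \<in> {0..<1 / M}" "t < F h"
    using assms(2) F_bdd_above less_cSUP_iff[of "{0..<1 / M}" F t] M_pos unfolding ts_def by auto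
  have "\<exists>\<eta>\<ge>0. \<eta> \<le> h \<and> F \<eta> = t"
  proof (rule IVT)
    show "\<forall>x. 0 \<le> x \<and> x \<le> h \<longrightarrow> isCont F x"
      using h F_DERIV[OF in_dom_01'] DERIV_isCont by (metis atLeastLessThan_iff order_le_less_trans)
  qed (use assms h F_0 in auto)
  then obtain \<eta> where "0 \<le> \<eta>" "\<eta> \<le> h" "F \<eta> = t" by blast
  then show ?thesis using that[of \<eta>] h by simp
qed


section \<open>Existence of a smooth solution\<close>

text \<open>Just outside \<open>[0, 1]\<close> next to \<open>a0\<close> the slope \<open>g\<close>
  exceeds \<open>M\<close>, so the admissible margin shrinks to nothing as \<eta> approaches
  \<open>1 / M\<close>. No single interval works for all \<eta>, whence the union.\<close>

definition V :: "(real \<times> real) set" where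
  "V = (\<Union>(lo, hi)\<in>{..<0} \<times> {1<..}. {lo<..<hi} \<times> dom lo hi)"

lemma open_V: "open V"
  unfolding V_def by (intro open_UN ballI) (auto intro!: open_Times open_dom)

lemma VE:
  assumes "z \<in> V"
  obtains lo hi where "lo < 0" "1 < hi" "lo < fst z" "fst z < hi" "snd z \<in> dom lo hi"
  using assms unfolding V_def by fastforce

lemma VI: "lo < 0 \<Longrightarrow> 1 < hi \<Longrightarrow> lo < \<alpha> \<Longrightarrow> \<alpha> < hi \<Longrightarrow> \<eta> \<in> dom lo hi \<Longrightarrow> (\<alpha>, \<eta>) \<in> V"
  unfolding V_def by auto

lemma dom_antimono: "lo \<le> lo' \<Longrightarrow> hi' \<le> hi \<Longrightarrow> \<eta> \<in> dom lo hi \<Longrightarrow> \<eta> \<in> dom lo' hi'"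
  by (auto simp: dom_def)

lemma V_dom: "z \<in> V \<Longrightarrow> snd z \<in> dom 0 1"
  by (metis VE dom_antimono less_imp_le)

lemma V_pos: "z \<in> V \<Longrightarrow> 1 - snd z * g (fst z) > 0"
  by (metis VE domD less_imp_le diff_gt_0_iff_gt)

lemma V_I01:
  assumes "\<alpha> \<in> {0..1}" "\<eta> \<in> dom 0 1"
  shows "(\<alpha>, \<eta>) \<in> V"
proof -
  obtain lo hi where "lo < 0" "1 < hi" "\<eta> \<in> dom lo hi" using dom_extend[OF assms(2)] by auto
  then show ?thesis using VI[of lo hi \<alpha> \<eta>] assms by auto
qed

lemma has_partials_inv:
  assumes "z \<in> V"
  shows "has_partials (\<lambda>z. inverse (1 - snd z * g (fst z)))
    ((inverse (1 - snd z * g (fst z)))\<^sup>2 * snd z * deriv g (fst z))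
    ((inverse (1 - snd z * g (fst z)))\<^sup>2 * g (fst z)) z"
proof -
  have "has_partials (\<lambda>z. g (fst z)) (deriv g (fst z)) 0 z"
    by (rule has_partials_DERIV_fst[OF g_DERIV])
  from has_partials_mult[OF has_partials_snd this]
  have "has_partials (\<lambda>z. snd z * g (fst z)) (snd z * deriv g (fst z)) (g (fst z)) z"
    by simp
  then have "((\<lambda>z. inverse (1 - snd z * g (fst z))) has_derivative
      (\<lambda>h. - (inverse (1 - snd z * g (fst z)) *
        (0 - (snd z * deriv g (fst z) * fst h + g (fst z) * snd h)) * inverse (1 - snd z * g (fst z))))) (at z)"
    unfolding has_partials_def using V_pos[OF assms]
    by (intro Deriv.has_derivative_inverse has_derivative_diff has_derivative_const) auto
  then show ?thesis
    unfolding has_partials_def by (rule has_derivative_eq_rhs) (auto simp: algebra_simps power2_eq_square)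
qed

lemma has_partials_J:
  assumes "z \<in> V"
  shows "has_partials (\<lambda>z. J k m (fst z) (snd z))
    (g (fst z) ^ k * inverse (1 - snd z * g (fst z)) ^ m)
    (real m * J (Suc k) (Suc m) (fst z) (snd z)) z"
proof -
  obtain lo hi where lh: "lo < 0" "1 < hi" "lo < fst z" "fst z < hi" "snd z \<in> dom lo hi"
    using VE[OF assms] by blast
  define \<alpha> \<eta> where "\<alpha> = fst z" and "\<eta> = snd z"
  let ?d = "\<lambda>\<eta> \<alpha>. g \<alpha> ^ k * inverse (1 - \<eta> * g \<alpha>) ^ m"
  have ne: "1 - x * g y \<noteq> 0" if "x \<in> dom lo hi" "y \<in> {lo<..<hi}" for x y
    using domD[of x lo hi y] that by auto
  \<comment> \<open>Joint differentiability follows from one partial at the point and the other,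
    continuous, nearby. The arguments are swapped because the explicit, visibly continuous partial
    is the one in the label.\<close>
  have "((\<lambda>(x, y). J k m y x) has_derivative
      (\<lambda>(tx, ty). (real m * J (Suc k) (Suc m) \<alpha> \<eta>) * tx + blinfun_mult_right (?d \<eta> \<alpha>) ty))
      (at (\<eta>, \<alpha>) within dom lo hi \<times> {lo<..<hi})"
  proof (rule has_derivative_partialsI)
    show "((\<lambda>x. J k m \<alpha> x) has_derivative (*) (real m * J (Suc k) (Suc m) \<alpha> \<eta>)) (at \<eta> within dom lo hi)"
      using J_DERIV_snd[of \<eta> lo hi \<alpha> k m] lh
      by (auto simp: \<alpha>_def \<eta>_def has_field_derivative_def intro: has_derivative_at_withinI)
  next
    fix x y assume xy: "x \<in> dom lo hi" "y \<in> {lo<..<hi}"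
    show "((\<lambda>y. J k m y x) has_derivative blinfun_apply (blinfun_mult_right (?d x y))) (at y within {lo<..<hi})"
      using J_DERIV_fst[of x lo hi y k m] lh xy
      by (auto simp: has_field_derivative_def blinfun_mult_right.rep_eq intro: has_derivative_at_withinI)
  next
    have "continuous_on (dom lo hi \<times> {lo<..<hi}) (\<lambda>z. ?d (fst z) (snd z))"
      using ne by (intro continuous_intros) auto
    then have "continuous_on (dom lo hi \<times> {lo<..<hi}) (\<lambda>(x, y). blinfun_mult_right (?d x y))"
      unfolding split_beta
      by (rule bounded_linear.continuous_on[OF bounded_linear_blinfun_mult_right])
    then show "continuous (at (\<eta>, \<alpha>) within dom lo hi \<times> {lo<..<hi}) (\<lambda>(x, y). blinfun_mult_right (?d x y))"
      using lh by (auto simp: continuous_on_eq_continuous_within \<alpha>_def \<eta>_def)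
  qed (use lh in \<open>auto simp: \<alpha>_def\<close>)
  moreover have "at (\<eta>, \<alpha>) within dom lo hi \<times> {lo<..<hi} = at (\<eta>, \<alpha>)"
    by (rule at_within_open) (use lh in \<open>auto simp: \<alpha>_def \<eta>_def intro!: open_Times open_dom\<close>)
  ultimately have "has_partials (\<lambda>p. J k m (snd p) (fst p)) (real m * J (Suc k) (Suc m) \<alpha> \<eta>) (?d \<eta> \<alpha>) (\<eta>, \<alpha>)"
    unfolding has_partials_def
    by (simp add: case_prod_unfold blinfun_mult_right.rep_eq)
  then have *: "has_partials (\<lambda>p. J k m (snd p) (fst p)) (real m * J (Suc k) (Suc m) \<alpha> \<eta>) (?d \<eta> \<alpha>) (snd z, fst z)"
    by (simp add: \<alpha>_def \<eta>_def)
  have fst: "has_partials fst 1 0 z"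
    unfolding has_partials_def by (auto intro!: derivative_eq_intros)
  show ?thesis
    using has_partials_compose[OF * has_partials_snd fst] by (simp add: \<alpha>_def \<eta>_def)
qed

text \<open>Lagrangian expressions. They are closed under both partial derivatives, also after
  composition with the inverse of the flow map, which gives smoothness of all orders at once.\<close>

inductive_set Alg :: "(real \<times> real \<Rightarrow> real) set" where
  const: "(\<lambda>z. c) \<in> Alg"
| eta: "snd \<in> Alg"
| der: "(\<lambda>z. (deriv ^^ k) u0 (fst z)) \<in> Alg"
| inv: "(\<lambda>z. inverse (1 - snd z * g (fst z))) \<in> Alg"
| invK: "(\<lambda>z. inverse (K (snd z))) \<in> Alg"
| J: "(\<lambda>z. J k m (fst z) (snd z)) \<in> Alg"
| J1: "(\<lambda>z. J k m 1 (snd z)) \<in> Alg"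
| add: "f1 \<in> Alg \<Longrightarrow> f2 \<in> Alg \<Longrightarrow> (\<lambda>z. f1 z + f2 z) \<in> Alg"
| mult: "f1 \<in> Alg \<Longrightarrow> f2 \<in> Alg \<Longrightarrow> (\<lambda>z. f1 z * f2 z) \<in> Alg"

lemma Alg_power: "f \<in> Alg \<Longrightarrow> (\<lambda>z. f z ^ n) \<in> Alg"
  by (induction n) (auto intro: Alg.intros)

lemma Alg_diff:
  assumes "f1 \<in> Alg" "f2 \<in> Alg"
  shows "(\<lambda>z. f1 z - f2 z) \<in> Alg"
  using Alg.add[OF assms(1) Alg.mult[OF Alg.const[of "-1"] assms(2)]] by simp

lemma Alg_g: "(\<lambda>z. g (fst z)) \<in> Alg" "(\<lambda>z. deriv g (fst z)) \<in> Alg"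
  using Alg.der[of 1] Alg.der[of 2] by (simp_all add: numeral_2_eq_2)

lemmas Alg_intros = Alg.intros Alg_power Alg_diff Alg_g

lemma Alg_partials:
  assumes "f \<in> Alg"
  shows "\<exists>fx\<in>Alg. \<exists>ft\<in>Alg. \<forall>z\<in>V. has_partials f (fx z) (ft z) z"
  using assms
proof induction
  case (const c)
  then show ?case
    by (intro bexI[of _ "\<lambda>z. 0"] ballI has_partials_const Alg.intros)
next
  case eta
  then show ?case
    by (intro bexI[of _ "\<lambda>z. 0"] bexI[of _ "\<lambda>z. 1"] ballI has_partials_snd Alg.intros)
next
  case (der k)
  then show ?case
    by (intro bexI[of _ "\<lambda>z. (deriv ^^ Suc k) u0 (fst z)"] bexI[of _ "\<lambda>z. 0"] ballI
        has_partials_DERIV_fst[OF smooth_on_UNIV_iterated_deriv[OF smooth]] Alg.intros)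
next
  case inv
  show ?case
    by (intro bexI ballI, rule has_partials_inv) (auto intro!: Alg_intros)
next
  case invK
  show ?case
  proof (intro bexI ballI)
    fix z assume "z \<in> V"
    have "((\<lambda>\<eta>. inverse (K \<eta>)) has_real_derivative - 1 * inverse (K (snd z)) ^ 2 * J 1 2 1 (snd z)) (at (snd z))"
      using K_DERIV[OF V_dom[OF \<open>z \<in> V\<close>]] K_pos[OF V_dom[OF \<open>z \<in> V\<close>]]
      by (auto intro!: derivative_eq_intros simp: K1_def power2_eq_square)
    from has_partials_DERIV_snd[OF this]
    show "has_partials (\<lambda>z. inverse (K (snd z))) 0 (- 1 * inverse (K (snd z)) ^ 2 * J 1 2 1 (snd z)) z" .
  qed (intro Alg_intros)+
next
  case (J k m)
  show ?case
    by (intro bexI ballI, rule has_partials_J) (auto intro!: Alg_intros)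
next
  case (J1 k m)
  show ?case
  proof (intro bexI ballI)
    fix z assume "z \<in> V"
    show "has_partials (\<lambda>z. J k m 1 (snd z)) 0 (real m * J (Suc k) (Suc m) 1 (snd z)) z"
      by (rule has_partials_DERIV_snd[OF J_DERIV_snd[OF V_dom[OF \<open>z \<in> V\<close>]]]) auto
  qed (intro Alg_intros)+
next
  case (add f1 f2)
  then obtain a b c d where "a \<in> Alg" "b \<in> Alg" "\<forall>z\<in>V. has_partials f1 (a z) (b z) z"
    "c \<in> Alg" "d \<in> Alg" "\<forall>z\<in>V. has_partials f2 (c z) (d z) z" by blast
  then show ?case
    by (intro bexI[of _ "\<lambda>z. a z + c z"] bexI[of _ "\<lambda>z. b z + d z"] ballI has_partials_add Alg.intros) auto
next
  case (mult f1 f2)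
  then obtain a b c d where "a \<in> Alg" "b \<in> Alg" "\<forall>z\<in>V. has_partials f1 (a z) (b z) z"
    "c \<in> Alg" "d \<in> Alg" "\<forall>z\<in>V. has_partials f2 (c z) (d z) z" by blast
  then show ?case using mult.hyps
    by (intro bexI[of _ "\<lambda>z. a z * f2 z + f1 z * c z"] bexI[of _ "\<lambda>z. b z * f2 z + f1 z * d z"] ballI
        has_partials_mult Alg.intros) auto
qed

text \<open>In the coordinates \<open>(\<alpha>, \<eta>)\<close>, \<open>X\<close> is the particle position, \<open>W\<close> its velocity with respect to
  time, and \<open>G\<close> the reciprocal of \<open>\<partial>X / \<partial>\<alpha>\<close>.\<close>

definition X :: "real \<times> real \<Rightarrow> real" where
  "X z = J 0 1 (fst z) (snd z) * inverse (K (snd z))"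

definition W :: "real \<times> real \<Rightarrow> real" where
  "W z = (J 1 2 (fst z) (snd z) * inverse (K (snd z))
    - J 0 1 (fst z) (snd z) * J 1 2 1 (snd z) * inverse (K (snd z)) ^ 2) * inverse (K (snd z)) ^ 2"

definition G :: "real \<times> real \<Rightarrow> real" where
  "G z = (1 - snd z * g (fst z)) * J 0 1 1 (snd z)"

definition Phi :: "real \<times> real \<Rightarrow> real \<times> real" where
  "Phi z = (X z, F (snd z))"

lemma G_eq: "G z = (1 - snd z * g (fst z)) * K (snd z)"
  by (simp add: G_def K_def)

lemma G_pos: "z \<in> V \<Longrightarrow> G z > 0"
  using V_pos K_pos[OF V_dom] by (simp add: G_eq)

lemma X_partials:
  assumes "z \<in> V"
  shows "has_partials X (inverse (G z)) (W z * (K (snd z))\<^sup>2) z"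
proof -
  note k = K_pos[OF V_dom[OF assms]]
  have "((\<lambda>\<eta>. inverse (K \<eta>)) has_real_derivative - 1 * inverse (K (snd z)) ^ 2 * J 1 2 1 (snd z)) (at (snd z))"
    using K_DERIV[OF V_dom[OF assms]] k
    by (auto intro!: derivative_eq_intros simp: K1_def power2_eq_square)
  from has_partials_mult[OF has_partials_J[OF assms, of 0 1] has_partials_DERIV_snd[OF this]]
  have "has_partials X
    (g (fst z) ^ 0 * inverse (1 - snd z * g (fst z)) ^ 1 * inverse (K (snd z)) + J 0 1 (fst z) (snd z) * 0)
    (real 1 * J (Suc 0) (Suc 1) (fst z) (snd z) * inverse (K (snd z))
       + J 0 1 (fst z) (snd z) * (- 1 * inverse (K (snd z)) ^ 2 * J 1 2 1 (snd z))) z"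
    by (simp add: X_def[abs_def])
  then show ?thesis
    by (rule has_partials_cong) (use k in \<open>simp_all add: G_eq W_def field_simps numeral_2_eq_2\<close>)
qed

lemma Phi_derivative:
  assumes "z \<in> V"
  shows "(Phi has_derivative (\<lambda>h. (inverse (G z) * fst h + W z * (K (snd z))\<^sup>2 * snd h, (K (snd z))\<^sup>2 * snd h))) (at z)"
proof -
  have "has_partials (\<lambda>z. F (snd z)) 0 ((K (snd z))\<^sup>2) z"
    by (rule has_partials_DERIV_snd[OF F_DERIV[OF V_dom[OF assms]]])
  from has_derivative_Pair[OF X_partials[OF assms, unfolded has_partials_def] this[unfolded has_partials_def]]
  show ?thesis by (simp add: Phi_def[abs_def])
qed

text \<open>\<open>Phi\<close> is triangular: the time depends on \<eta> alone and is strictly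
  increasing in it, and for fixed \<eta> the position is strictly increasing in the label.\<close>

lemma Phi_inj: "inj_on Phi V"
proof (rule inj_onI)
  fix z w assume z: "z \<in> V" and w: "w \<in> V" and eq: "Phi z = Phi w"
  have e: "snd z = snd w"
    using eq F_strict_mono V_dom[OF z] V_dom[OF w] unfolding Phi_def
    by (metis linorder_neqE_linordered_idom order_less_irrefl prod.inject)
  obtain lo hi where a: "lo < 0" "1 < hi" "lo < fst z" "fst z < hi" "snd z \<in> dom lo hi" using VE[OF z] .
  obtain lo' hi' where b: "lo' < 0" "1 < hi'" "lo' < fst w" "fst w < hi'" "snd w \<in> dom lo' hi'" using VE[OF w] .
  \<comment> \<open>The two points come with different label intervals. Both contain
    \<open>[0, 1]\<close>, so their union has no gap and is again admissible.\<close>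
  have d: "snd z \<in> dom (min lo lo') (max hi hi')"
    unfolding dom_def
  proof (intro CollectI ballI)
    fix s assume "s \<in> {min lo lo'..max hi hi'}"
    then have "lo \<le> s \<and> s \<le> hi \<or> lo' \<le> s \<and> s \<le> hi'" using a b by auto
    then show "snd z * g s < 1" using domD[OF a(5), of s] domD[OF b(5), of s] e by auto
  qed
  have "J 0 1 (fst z) (snd z) = J 0 1 (fst w) (snd z)"
    using eq e K_pos[OF V_dom[OF z]] by (simp add: Phi_def X_def)
  then have "fst z = fst w"
    using J_strict_mono[OF d, of "fst z" "fst w"] J_strict_mono[OF d, of "fst w" "fst z"] a b
    by (cases "fst z" "fst w" rule: linorder_cases) (auto simp: min_less_iff_disj less_max_iff_disj)
  then show "z = w" using e by (simp add: prod_eq_iff)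
qed

section \<open>The inverse of the flow map\<close>

definition "U = Phi ` V"
definition "P = inv_into V Phi"

lemma Phi_continuous: "continuous_on V Phi"
  using Phi_derivative has_derivative_continuous continuous_at_imp_continuous_on by blast

lemma open_U: "open U"
  unfolding U_def by (rule invariance_of_domain[OF Phi_continuous open_V Phi_inj])

lemma P_Phi: "z \<in> V \<Longrightarrow> P (Phi z) = z"
  by (simp add: P_def inv_into_f_f[OF Phi_inj])

lemma P_in: "w \<in> U \<Longrightarrow> P w \<in> V" "w \<in> U \<Longrightarrow> Phi (P w) = w"
  by (auto simp: U_def P_Phi)

text \<open>The triangular derivative inverts by hand: \<open>d\<eta> = dt / K\<^sup>2\<close> and
  \<open>d\<alpha> = G * (dx - W * dt)\<close>. The second relation says that labels are transported
  with velocity \<open>W\<close>.\<close>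

lemma P_partials:
  assumes "w \<in> U"
  shows "has_partials (\<lambda>w. fst (P w)) (G (P w)) (- 1 * G (P w) * W (P w)) w"
    and "has_partials (\<lambda>w. snd (P w)) 0 (inverse (K (snd (P w))) ^ 2) w"
proof -
  let ?z = "P w"
  note z = P_in[OF assms]
  let ?k = "K (snd ?z)"
  have k: "?k > 0" "G ?z > 0" using K_pos[OF V_dom[OF z(1)]] G_pos[OF z(1)] by auto
  have "(P has_derivative (\<lambda>h. (G ?z * (fst h - W ?z * snd h), inverse ?k ^ 2 * snd h))) (at (Phi ?z))"
    by (rule has_derivative_inverse_strong[OF open_V z(1) Phi_continuous P_Phi Phi_derivative[OF z(1)]])
      (use k in \<open>auto simp: fun_eq_iff field_simps\<close>)
  then have "(P has_derivative (\<lambda>h. (G ?z * (fst h - W ?z * snd h), inverse ?k ^ 2 * snd h))) (at w)"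
    using z by simp
  from has_derivative_fst[OF this] has_derivative_snd[OF this]
  show "has_partials (\<lambda>w. fst (P w)) (G ?z) (- 1 * G ?z * W ?z) w"
    "has_partials (\<lambda>w. snd (P w)) 0 (inverse ?k ^ 2) w"
    by (simp_all add: has_partials_def algebra_simps)
qed

lemma Alg_comp_partials:
  assumes "w \<in> U" "has_partials f a b (P w)"
  shows "has_partials (\<lambda>w. f (P w)) (a * G (P w))
    (a * (- 1 * G (P w) * W (P w)) + b * inverse (K (snd (P w))) ^ 2) w"
  using has_partials_compose[of f a b "\<lambda>w. fst (P w)" w "\<lambda>w. snd (P w)", OF _ P_partials[OF assms(1)]] assms(2)
  by simp

text \<open>\<open>Alg\<close> has \<open>inverse (K (snd z))\<close> and
  \<open>J k m 1 (snd z)\<close> as generators; this is why \<open>G\<close> is written with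
  \<open>J 0 1 1\<close> and \<open>W\<close> with \<open>J 1 2 1\<close>.\<close>

lemma Alg_GW: "G \<in> Alg" "W \<in> Alg"
  unfolding G_def[abs_def] W_def[abs_def] by (intro Alg_intros)+

lemma Alg_smooth:
  assumes "f \<in> Alg"
  shows "smooth_on U (\<lambda>w. f (P w))"
proof (rule smooth_on_class[OF open_U, of "{\<lambda>w. f (P w) | f. f \<in> Alg}"])
  fix h assume "h \<in> {\<lambda>w. f (P w) | f. f \<in> Alg}"
  then obtain f where f: "f \<in> Alg" "h = (\<lambda>w. f (P w))" by blast
  obtain fx ft where p: "fx \<in> Alg" "ft \<in> Alg" "\<forall>z\<in>V. has_partials f (fx z) (ft z) z"
    using Alg_partials[OF f(1)] by blast
  define fx' where "fx' = (\<lambda>z. fx z * G z)"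
  define ft' where "ft' = (\<lambda>z. fx z * (- 1 * G z * W z) + ft z * inverse (K (snd z)) ^ 2)"
  have "fx' \<in> Alg" "ft' \<in> Alg"
    unfolding fx'_def ft'_def by (intro Alg_intros p Alg_GW)+
  moreover have "\<forall>w\<in>U. has_partials h (fx' (P w)) (ft' (P w)) w"
    unfolding f(2) fx'_def ft'_def using p(3) Alg_comp_partials P_in(1) by simp
  ultimately show "\<exists>fx\<in>{\<lambda>w. f (P w) | f. f \<in> Alg}. \<exists>ft\<in>{\<lambda>w. f (P w) | f. f \<in> Alg}.
      \<forall>z\<in>U. has_partials h (fx z) (ft z) z"
    by (intro bexI[of _ "\<lambda>w. fx' (P w)"] bexI[of _ "\<lambda>w. ft' (P w)"]) auto
next
  fix f h a b assume "f \<in> {\<lambda>w. f (P w) | f. f \<in> Alg}" "h \<in> {\<lambda>w. f (P w) | f. f \<in> Alg}"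
  then obtain f' h' where "f' \<in> Alg" "f = (\<lambda>w. f' (P w))" "h' \<in> Alg" "h = (\<lambda>w. h' (P w))" by blast
  then show "(\<lambda>z. f z * a + h z * b) \<in> {\<lambda>w. f (P w) | f. f \<in> Alg}"
    by (intro CollectI exI[of _ "\<lambda>z. f' z * a + h' z * b"]) (auto intro!: Alg_intros)
qed (use assms in blast)


text \<open>This is \<open>u_x\<close> in Lagrangian coordinates, equal to
  \<open>vel (g \<alpha>) \<eta>\<close>, written in the generators of \<open>Alg\<close>.\<close>

definition q :: "real \<times> real \<Rightarrow> real" where
  "q z = (g (fst z) * inverse (1 - snd z * g (fst z)) - J 1 2 1 (snd z) * inverse (K (snd z)))
    * inverse (K (snd z)) ^ 2"

lemma Alg_q: "q \<in> Alg"
  unfolding q_def[abs_def] by (intro Alg_intros)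

definition sol :: "real \<Rightarrow> real \<Rightarrow> real" where
  "sol x t = W (P (x, t))"

lemma J_fst_DERIV_V:
  assumes "(\<alpha>, \<eta>) \<in> V"
  shows "((\<lambda>\<alpha>. J k m \<alpha> \<eta>) has_real_derivative g \<alpha> ^ k * inverse (1 - \<eta> * g \<alpha>) ^ m) (at \<alpha>)"
  using has_partials_fst_DERIV[OF has_partials_J[OF assms, of k m]] by simp

lemma sol_DERIV:
  assumes "(x, t) \<in> U"
  shows "((\<lambda>y. sol y t) has_real_derivative q (P (x, t))) (at x)"
proof -
  obtain \<alpha> \<eta> where z: "P (x, t) = (\<alpha>, \<eta>)" "(\<alpha>, \<eta>) \<in> V"
    using P_in[OF assms] by (metis surj_pair)
  note k = K_pos[OF V_dom[OF z(2), simplified]] and p = V_pos[OF z(2), simplified]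
  \<comment> \<open>\<open>Alg_partials\<close> gives joint differentiability with unnamed partials;
    uniqueness of the one-variable derivative then identifies the needed one.\<close>
  obtain fx ft where f: "\<forall>z\<in>V. has_partials W (fx z) (ft z) z"
    using Alg_partials[OF Alg_GW(2)] by blast
  have "((\<lambda>\<alpha>. W (\<alpha>, \<eta>)) has_real_derivative
      (g \<alpha> * inverse (1 - \<eta> * g \<alpha>) ^ 2 * inverse (K \<eta>)
        - inverse (1 - \<eta> * g \<alpha>) * J 1 2 1 \<eta> * inverse (K \<eta>) ^ 2) * inverse (K \<eta>) ^ 2) (at \<alpha>)"
    unfolding W_def using J_fst_DERIV_V[OF z(2), of 1 2] J_fst_DERIV_V[OF z(2), of 0 1]
    by (auto intro!: derivative_eq_intros)
  then have fx: "fx (\<alpha>, \<eta>) = (g \<alpha> * inverse (1 - \<eta> * g \<alpha>) ^ 2 * inverse (K \<eta>)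
        - inverse (1 - \<eta> * g \<alpha>) * J 1 2 1 \<eta> * inverse (K \<eta>) ^ 2) * inverse (K \<eta>) ^ 2"
    using has_partials_fst_DERIV f z(2) DERIV_unique by blast
  have "((\<lambda>y. W (P (y, t))) has_real_derivative fx (\<alpha>, \<eta>) * G (\<alpha>, \<eta>)) (at x)"
    using has_partials_fst_DERIV[OF Alg_comp_partials[OF assms, of W "fx (\<alpha>, \<eta>)" "ft (\<alpha>, \<eta>)"]] f z by simp
  moreover have "fx (\<alpha>, \<eta>) * G (\<alpha>, \<eta>) = q (\<alpha>, \<eta>)"
  proof -
    have *: "(p * b ^ 2 * i - b * j * i ^ 2) * i ^ 2 * (c * k) = (p * b - j * i) * i ^ 2"
      if "b * c = 1" "i * k = 1" for p b i j c k :: real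
    proof -
      have "(p * b ^ 2 * i - b * j * i ^ 2) * i ^ 2 * (c * k)
          = (p * b * (b * c) * (i * k) - j * i * (b * c) * (i * k)) * i ^ 2"
        by (simp add: algebra_simps power2_eq_square)
      then show ?thesis by (simp add: that)
    qed
    show ?thesis unfolding fx G_eq q_def fst_conv snd_conv by (rule *) (use k p in auto)
  qed
  ultimately show ?thesis by (simp add: sol_def z)
qed

lemma pdx_sol: "(x, t) \<in> U \<Longrightarrow> pdx sol x t = q (P (x, t))"
  unfolding pdx_def by (rule DERIV_imp_deriv[OF sol_DERIV])

definition "K2 \<eta> = 2 * J 2 3 1 \<eta>"

lemma K1_DERIV:
  assumes "\<eta> \<in> dom 0 1"
  shows "(K1 has_real_derivative K2 \<eta>) (at \<eta>)"
  using J_DERIV_snd[OF assms, of 1 1 2]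
  by (simp add: K1_def[abs_def] K2_def numeral_2_eq_2 numeral_3_eq_3)

text \<open>Labels are transported, so the label derivative of \<open>q\<close> drops out and the
  left side is the \<eta>-derivative of \<open>q\<close> over \<open>K\<^sup>2\<close>, minus
  \<open>q\<^sup>2\<close>. There every term with \<open>g \<alpha>\<close> cancels; the rest
  depends on time alone, as the nonlocal right side must.\<close>

lemma material_derivative:
  assumes "(x, t) \<in> U" "P (x, t) = (\<alpha>, \<eta>)"
  shows "pdt (pdx sol) x t + sol x t * pdx (pdx sol) x t - (pdx sol x t)\<^sup>2
    = 2 * (K1 \<eta>)\<^sup>2 * inverse (K \<eta>) ^ 6 - K2 \<eta> * inverse (K \<eta>) ^ 5"
proof -
  have z: "(\<alpha>, \<eta>) \<in> V" using P_in(1)[OF assms(1)] assms(2) by simp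
  note d = V_dom[OF z, simplified] and p = V_pos[OF z, simplified]
  note k = K_pos[OF d]
  obtain qx qt where f: "\<forall>z\<in>V. has_partials q (qx z) (qt z) z"
    using Alg_partials[OF Alg_q] by blast
  define i b where "i = inverse (K \<eta>)" and "b = inverse (1 - \<eta> * g \<alpha>)"
  have "((\<lambda>\<eta>. q (\<alpha>, \<eta>)) has_real_derivative
      (g \<alpha> * (b * g \<alpha> * b) - (K2 \<eta> * i - K1 \<eta> * (i * K1 \<eta> * i))) * i ^ 2
      - (g \<alpha> * b - K1 \<eta> * i) * (2 * i * (i * K1 \<eta> * i))) (at \<eta>)"
  proof -
    have B: "((\<lambda>\<eta>. inverse (1 - \<eta> * g \<alpha>)) has_real_derivative b * g \<alpha> * b) (at \<eta>)"
      unfolding b_def using p by (auto intro!: derivative_eq_intros)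
    have I: "((\<lambda>\<eta>. inverse (K \<eta>)) has_real_derivative - (i * K1 \<eta> * i)) (at \<eta>)"
      unfolding i_def using k by (auto intro!: derivative_eq_intros K_DERIV[OF d])
    show ?thesis
      unfolding q_def fst_conv snd_conv K1_def[symmetric]
      by (rule DERIV_cong[OF DERIV_mult[OF DERIV_diff[OF DERIV_cmult[OF B] DERIV_mult[OF K1_DERIV[OF d] I]] DERIV_power[OF I]]])
        (simp add: i_def[symmetric] b_def[symmetric] algebra_simps)
  qed
  then have qt: "qt (\<alpha>, \<eta>) = (g \<alpha> * (b * g \<alpha> * b) - (K2 \<eta> * i - K1 \<eta> * (i * K1 \<eta> * i))) * i ^ 2
      - (g \<alpha> * b - K1 \<eta> * i) * (2 * i * (i * K1 \<eta> * i))"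
    using has_partials_snd_DERIV f z DERIV_unique by blast
  have hp: "has_partials (\<lambda>w. q (P w)) (qx (\<alpha>, \<eta>) * G (\<alpha>, \<eta>))
    (qx (\<alpha>, \<eta>) * (- 1 * G (\<alpha>, \<eta>) * W (\<alpha>, \<eta>)) + qt (\<alpha>, \<eta>) * i ^ 2) (x, t)"
    using Alg_comp_partials[OF assms(1), of q] f z assms(2) by (simp add: i_def)
  have "eventually (\<lambda>y. (y, t) \<in> U) (nhds x)" "eventually (\<lambda>s. (x, s) \<in> U) (nhds t)"
    using assms(1) eventually_nhds_in_open[OF open_vimage[OF open_U, of "\<lambda>y. (y, t)"], of x]
      eventually_nhds_in_open[OF open_vimage[OF open_U, of "\<lambda>s. (x, s)"], of t]
    by (simp_all add: continuous_intros)
  then have ev: "eventually (\<lambda>y. pdx sol y t = q (P (y, t))) (nhds x)"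
    "eventually (\<lambda>s. pdx sol x s = q (P (x, s))) (nhds t)"
    by (auto elim!: eventually_mono simp: pdx_sol)
  have xx: "pdx (pdx sol) x t = qx (\<alpha>, \<eta>) * G (\<alpha>, \<eta>)"
    unfolding pdx_def[of "pdx sol"] deriv_cong_ev[OF ev(1) refl]
    by (rule DERIV_imp_deriv[OF has_partials_fst_DERIV[OF hp]])
  have xt: "pdt (pdx sol) x t = qx (\<alpha>, \<eta>) * (- 1 * G (\<alpha>, \<eta>) * W (\<alpha>, \<eta>)) + qt (\<alpha>, \<eta>) * i ^ 2"
    unfolding pdt_def deriv_cong_ev[OF ev(2) refl]
    by (rule DERIV_imp_deriv[OF has_partials_snd_DERIV[OF hp]])
  have ux: "pdx sol x t = (g \<alpha> * b - K1 \<eta> * i) * i ^ 2"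
    using pdx_sol[OF assms(1)] assms(2) by (simp add: q_def i_def b_def K1_def)
  have u: "sol x t = W (\<alpha>, \<eta>)" by (simp add: sol_def assms(2))
  show ?thesis
    unfolding xx xt ux u qt i_def[symmetric]
    by (simp add: algebra_simps power2_eq_square power_numeral_reduce)
qed

lemma K_Suc: "J 0 (Suc 0) 1 \<eta> = K \<eta>"
  by (simp add: K_def)

text \<open>\<open>R\<close> in Lagrangian coordinates is an antiderivative of \<open>u_x\<^sup>2\<close> in \<open>x\<close>.\<close>

definition R :: "real \<times> real \<Rightarrow> real" where
  "R z = J 2 3 (fst z) (snd z) * inverse (K (snd z)) ^ 5
    - 2 * J 1 2 1 (snd z) * J 1 2 (fst z) (snd z) * inverse (K (snd z)) ^ 6
    + (J 1 2 1 (snd z))\<^sup>2 * J 0 1 (fst z) (snd z) * inverse (K (snd z)) ^ 7"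

text \<open>Because \<open>dx = d\<alpha> / G\<close>, the square \<open>q\<^sup>2\<close> divided
  by \<open>G\<close> expands into the integrands of \<open>J 2 3\<close>, \<open>J 1 2\<close> and
  \<open>J 0 1\<close>, with coefficients depending on time only.\<close>

lemma R_DERIV:
  assumes "(x, t) \<in> U"
  shows "((\<lambda>y. R (P (y, t))) has_real_derivative (pdx sol x t)\<^sup>2) (at x)"
proof -
  obtain \<alpha> \<eta> where z: "P (x, t) = (\<alpha>, \<eta>)" "(\<alpha>, \<eta>) \<in> V"
    using P_in[OF assms] by (metis surj_pair)
  note k = K_pos[OF V_dom[OF z(2), simplified]] and p = V_pos[OF z(2), simplified]
  have "R \<in> Alg" unfolding R_def[abs_def] by (intro Alg_intros)
  then obtain fx ft where f: "\<forall>z\<in>V. has_partials R (fx z) (ft z) z"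
    using Alg_partials by blast
  define i b j where "i = inverse (K \<eta>)" and "b = inverse (1 - \<eta> * g \<alpha>)" and "j = J 1 2 1 \<eta>"
  have "((\<lambda>\<alpha>. R (\<alpha>, \<eta>)) has_real_derivative
      g \<alpha> ^ 2 * b ^ 3 * i ^ 5 - 2 * j * (g \<alpha> ^ 1 * b ^ 2) * i ^ 6 + j\<^sup>2 * (g \<alpha> ^ 0 * b ^ 1) * i ^ 7) (at \<alpha>)"
    unfolding R_def fst_conv snd_conv i_def[symmetric] j_def[symmetric] b_def
    by (intro DERIV_add DERIV_diff DERIV_cmult DERIV_cmult_right J_fst_DERIV_V z)
  then have fx: "fx (\<alpha>, \<eta>) = g \<alpha> ^ 2 * b ^ 3 * i ^ 5 - 2 * j * (g \<alpha> ^ 1 * b ^ 2) * i ^ 6 + j\<^sup>2 * (g \<alpha> ^ 0 * b ^ 1) * i ^ 7"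
    using has_partials_fst_DERIV f z(2) DERIV_unique by blast
  have "((\<lambda>y. R (P (y, t))) has_real_derivative fx (\<alpha>, \<eta>) * G (\<alpha>, \<eta>)) (at x)"
    using has_partials_fst_DERIV[OF Alg_comp_partials[OF assms, of R "fx (\<alpha>, \<eta>)" "ft (\<alpha>, \<eta>)"]] f z by simp
  moreover have "fx (\<alpha>, \<eta>) * G (\<alpha>, \<eta>) = (q (\<alpha>, \<eta>))\<^sup>2"
  proof -
    have "(p ^ 2 * b ^ 3 * i ^ 5 - 2 * j * (p ^ 1 * b ^ 2) * i ^ 6 + j\<^sup>2 * (p ^ 0 * b ^ 1) * i ^ 7) * (c * k)
        = ((p * b - j * i) * i ^ 2) ^ 2"
      if "b * c = 1" "i * k = 1" for p b i j c k :: real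
    proof -
      have "(p ^ 2 * b ^ 3 * i ^ 5 - 2 * j * (p ^ 1 * b ^ 2) * i ^ 6 + j\<^sup>2 * (p ^ 0 * b ^ 1) * i ^ 7) * (c * k)
          = (p ^ 2 * b ^ 2 - 2 * j * i * p * b + j ^ 2 * i ^ 2) * i ^ 4 * ((b * c) * (i * k))"
        by (simp add: algebra_simps power_numeral_reduce)
      also have "\<dots> = ((p * b - j * i) * i ^ 2) ^ 2"
        by (simp add: that algebra_simps power_numeral_reduce)
      finally show ?thesis .
    qed
    then show ?thesis
      unfolding fx using k p by (simp add: G_eq q_def i_def b_def j_def)
  qed
  ultimately show ?thesis by (simp add: pdx_sol[OF assms] z)
qed

section \<open>Initial values, boundary values and equation for the constructed field\<close>

lemma strip:
  assumes "x \<in> {0..1}" "t \<in> {0..<ts}"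
  obtains \<alpha> \<eta> where "\<alpha> \<in> {0..1}" "\<eta> \<in> {0..<1 / M}" "F \<eta> = t" "(\<alpha>, \<eta>) \<in> V" "Phi (\<alpha>, \<eta>) = (x, t)"
proof -
  obtain \<eta> where e: "\<eta> \<in> {0..<1 / M}" "F \<eta> = t" using F_surj[of t] assms by auto
  note d = in_dom_01'[OF e(1)]
  have "\<exists>\<alpha>\<ge>0. \<alpha> \<le> 1 \<and> X (\<alpha>, \<eta>) = x"
  proof (rule IVT)
    show "\<forall>\<alpha>. 0 \<le> \<alpha> \<and> \<alpha> \<le> 1 \<longrightarrow> isCont (\<lambda>\<alpha>. X (\<alpha>, \<eta>)) \<alpha>"
      using X_partials[OF V_I01[OF _ d]] has_partials_fst_DERIV DERIV_isCont
      by (metis atLeastAtMost_iff)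
    show "x \<le> X (1, \<eta>)" using assms K_pos[OF d] by (simp add: X_def K_def)
    show "X (0, \<eta>) \<le> x" using assms by (simp add: X_def)
  qed simp
  then obtain \<alpha> where "\<alpha> \<in> {0..1}" "X (\<alpha>, \<eta>) = x" by auto
  then show ?thesis using that[of \<alpha> \<eta>] e V_I01[OF _ d, of \<alpha>] by (simp add: Phi_def)
qed

lemma strip_U: "{0..1} \<times> {0..<ts} \<subseteq> U"
proof clarify
  fix x t :: real assume "x \<in> {0..1}" "t \<in> {0..<ts}"
  then show "(x, t) \<in> U" using strip[of x t] unfolding U_def by (metis imageI)
qed

lemma P_0:
  assumes "\<eta> \<in> dom 0 1"
  shows "P (0, F \<eta>) = (0, \<eta>)" "P (1, F \<eta>) = (1, \<eta>)"
  using P_Phi[OF V_I01[OF _ assms], of 0] P_Phi[OF V_I01[OF _ assms], of 1] K_pos[OF assms]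
  by (simp_all add: Phi_def X_def K_def)

lemma is_solution_sol: "is_solution u0 ts sol"
  unfolding is_solution_def
proof (intro conjI ballI exI[of _ U])
  show "open U" by (rule open_U)
  show "{0..1} \<times> {0..<ts} \<subseteq> U" by (rule strip_U)
  have "(\<lambda>(x, t). sol x t) = (\<lambda>w. W (P w))" by (auto simp: sol_def)
  then show "smooth_on U (\<lambda>(x, t). sol x t)" using Alg_smooth[OF Alg_GW(2)] by simp
next
  fix x :: real assume x: "x \<in> {0..1}"
  have J1: "J 1 m x 0 = u0 x" if "x \<in> {0..1}" for m x
  proof -
    have "(g has_integral u0 x - u0 0) {0..x}"
      using that by (intro fundamental_theorem_of_calculus)
        (auto simp: has_real_derivative_iff_has_vector_derivative[symmetric]
          intro!: has_field_derivative_at_within u0_DERIV)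
    then show ?thesis using that by (simp add: J_def sint_nonneg u0_0 integral_unique)
  qed
  have J0: "J 0 m x 0 = x" if "x \<in> {0..1}" for m x
    using that by (simp add: J_def sint_nonneg)
  have K0: "K 0 = 1" by (simp add: K_def J0)
  have "Phi (x, 0) = (x, 0)" using x by (simp add: Phi_def X_def J0 K0 F_0)
  then have "P (x, 0) = (x, 0)" using P_Phi[OF V_I01[OF x zero_in_dom]] by simp
  \<comment> \<open>The correction term in \<open>W\<close> contains
    \<open>J 1 2 1 0 = u0 1 = 0\<close>, so only \<open>J 1 2 x 0 = u0 x\<close> remains.\<close>
  then show "sol x 0 = u0 x" using x
    by (simp add: sol_def W_def J1[simplified] J0[simplified] K0 u0_1)
next
  fix t assume t: "t \<in> {0..<ts}"
  obtain \<eta> where "\<eta> \<in> {0..<1 / M}" "F \<eta> = t" using F_surj[of t] t by auto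
  then have e: "\<eta> \<in> dom 0 1" "F \<eta> = t" using in_dom_01' by auto
  show "sol 0 t = 0" using P_0(1)[OF e(1)] e(2) by (simp add: sol_def W_def)
  show "sol 1 t = 0" using P_0(2)[OF e(1)] e(2) K_pos[OF e(1)]
    by (simp add: sol_def W_def power2_eq_square K_Suc)
next
  fix t x :: real assume t: "t \<in> {0<..<ts}" and x: "x \<in> {0..1}"
  then have t': "t \<in> {0..<ts}" by simp
  obtain \<alpha> \<eta> where z: "\<alpha> \<in> {0..1}" "\<eta> \<in> {0..<1 / M}" "F \<eta> = t" "(\<alpha>, \<eta>) \<in> V" "Phi (\<alpha>, \<eta>) = (x, t)"
    using strip[OF x t'] .
  have P: "P (x, t) = (\<alpha>, \<eta>)" using P_Phi[OF z(4)] z(5) by simp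
  note d = in_dom_01'[OF z(2)]
  have "((\<lambda>y. (pdx sol y t)\<^sup>2) has_integral R (P (1, t)) - R (P (0, t))) {0..1}"
  proof (rule fundamental_theorem_of_calculus)
    fix y :: real assume "y \<in> {0..1}"
    then have "(y, t) \<in> U" using strip_U t' by blast
    from R_DERIV[OF this] show "((\<lambda>y. R (P (y, t))) has_vector_derivative (pdx sol y t)\<^sup>2) (at y within {0..1})"
      by (simp add: has_real_derivative_iff_has_vector_derivative[symmetric] has_field_derivative_at_within)
  qed simp
  \<comment> \<open>All label integrals vanish at label 0 and are the derivatives of
    \<open>K\<close>, up to a factor, at label 1. Multiplied by -2 the value is the right side of
    \<open>material_derivative\<close>.\<close>
  moreover have "R (P (1, t)) - R (P (0, t)) = K2 \<eta> * inverse (K \<eta>) ^ 5 / 2 - (K1 \<eta>)\<^sup>2 * inverse (K \<eta>) ^ 6"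
  proof -
    have "inverse (K \<eta>) ^ 6 = K \<eta> * inverse (K \<eta>) ^ 7"
      using K_pos[OF d] power_Suc[of "inverse (K \<eta>)" 6] by simp
    then show ?thesis
      using P_0[OF d] z(3) by (simp add: R_def K2_def K1_def power2_eq_square K_Suc)
  qed
  ultimately have "integral {0..1} (\<lambda>y. (pdx sol y t)\<^sup>2) = K2 \<eta> * inverse (K \<eta>) ^ 5 / 2 - (K1 \<eta>)\<^sup>2 * inverse (K \<eta>) ^ 6"
    by (simp add: integral_unique)
  then show "pdt (pdx sol) x t + sol x t * pdx (pdx sol) x t - (pdx sol x t)\<^sup>2
      = - 2 * integral {0..1} (\<lambda>y. (pdx sol y t)\<^sup>2)"
    using material_derivative[OF _ P] strip_U t' x by (simp add: subset_eq)
qed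

end

section \<open>Particle paths of an arbitrary solution\<close>

lemma DERIV_withinI_quadratic:
  fixes f :: "real \<Rightarrow> real"
  assumes "\<And>y. y \<in> S \<Longrightarrow> \<bar>f y - f x - d * (y - x)\<bar> \<le> C * (y - x)\<^sup>2"
  shows "(f has_real_derivative d) (at x within S)"
  unfolding has_field_derivative_iff
proof (rule LIM_zero_cancel, rule Lim_null_comparison)
  show "\<forall>\<^sub>F y in at x within S. norm ((f y - f x) / (y - x) - d) \<le> C * \<bar>y - x\<bar>"
    unfolding eventually_at_filter
  proof (rule always_eventually, intro allI impI)
    fix y assume "y \<noteq> x" "y \<in> S"
    have "(f y - f x) / (y - x) - d = (f y - f x - d * (y - x)) / (y - x)"
      using \<open>y \<noteq> x\<close> by (simp add: field_simps)
    then have "norm ((f y - f x) / (y - x) - d) = \<bar>f y - f x - d * (y - x)\<bar> / \<bar>y - x\<bar>" by simp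
    also have "\<dots> \<le> C * (y - x)\<^sup>2 / \<bar>y - x\<bar>"
      using assms[OF \<open>y \<in> S\<close>] by (rule divide_right_mono) simp
    also have "\<dots> = C * \<bar>y - x\<bar>"
      using \<open>y \<noteq> x\<close> by (simp add: field_simps power2_eq_square abs_mult[symmetric])
    finally show "norm ((f y - f x) / (y - x) - d) \<le> C * \<bar>y - x\<bar>" .
  qed
  have "((\<lambda>y. C * \<bar>y - x\<bar>) \<longlongrightarrow> C * \<bar>x - x\<bar>) (at x within S)"
    by (intro tendsto_intros)
  then show "((\<lambda>y. C * \<bar>y - x\<bar>) \<longlongrightarrow> 0) (at x within S)" by simp
qed

text \<open>The nonlocal term enters only as a function \<open>I\<close> of time. The equation is
  available for positive times; continuity up to time 0 provides the link to the initial
  data.\<close>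

locale particle_paths =
  fixes u :: "real \<Rightarrow> real \<Rightarrow> real" and \<gamma> :: "real \<Rightarrow> real \<Rightarrow> real" and T :: real
    and D :: "(real \<times> real) set" and ux ut uxx uxt :: "real \<times> real \<Rightarrow> real" and I :: "real \<Rightarrow> real"
  assumes open_D: "open D" and strip_D: "{0..1} \<times> {0..<T} \<subseteq> D"
    and u_partials: "\<And>z. z \<in> D \<Longrightarrow> has_partials (\<lambda>z. u (fst z) (snd z)) (ux z) (ut z) z"
    and ux_partials: "\<And>z. z \<in> D \<Longrightarrow> has_partials ux (uxx z) (uxt z) z"
    and uxx_cont: "continuous_on D uxx"
    and bc: "\<And>t c. t \<in> {0..<T} \<Longrightarrow> c \<in> {0, 1} \<Longrightarrow> u c t = 0"
    and pde: "\<And>x t. 0 < t \<Longrightarrow> t < T \<Longrightarrow> x \<in> {0..1} \<Longrightarrow>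
      uxt (x, t) + u x t * uxx (x, t) - (ux (x, t))\<^sup>2 = I t"
    and flow: "lagrangian_flow u T \<gamma>"
begin

section \<open>Confinement of particles to the unit interval\<close>

lemma ux_cont: "continuous_on D ux"
  using ux_partials has_partials_continuous by (blast intro: continuous_at_imp_continuous_on)

lemma u_DERIV: "(x, t) \<in> D \<Longrightarrow> ((\<lambda>y. u y t) has_real_derivative ux (x, t)) (at x)"
  using has_partials_fst_DERIV[OF u_partials] by simp

lemma ux_DERIV: "(x, t) \<in> D \<Longrightarrow> ((\<lambda>y. ux (y, t)) has_real_derivative uxx (x, t)) (at x)"
  using has_partials_fst_DERIV[OF ux_partials] .

lemma flow_0: "\<alpha> \<in> {0..1} \<Longrightarrow> \<gamma> \<alpha> 0 = \<alpha>"
  using flow unfolding lagrangian_flow_def by blast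

lemma flow_DERIV_within:
  assumes "\<alpha> \<in> {0..1}" "t \<in> {a..b}" "0 \<le> a" "b < T"
  shows "(\<gamma> \<alpha> has_real_derivative u (\<gamma> \<alpha> t) t) (at t within {a..b})"
proof -
  have "(\<gamma> \<alpha> has_real_derivative u (\<gamma> \<alpha> t) t) (at t within {0..<T})"
    using flow assms unfolding lagrangian_flow_def by auto
  then show ?thesis by (rule has_field_derivative_subset) (use assms in auto)
qed

lemma flow_DERIV:
  assumes "\<alpha> \<in> {0..1}" "0 < t" "t < T"
  shows "(\<gamma> \<alpha> has_real_derivative u (\<gamma> \<alpha> t) t) (at t)"
proof -
  obtain b where "t < b" "b < T" using dense assms by blast
  then show ?thesis using flow_DERIV_within[of \<alpha> t 0 b] assms by (simp add: at_within_Icc_at)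
qed

lemma flow_cont:
  assumes "\<alpha> \<in> {0..1}" "0 \<le> a" "b < T"
  shows "continuous_on {a..b} (\<gamma> \<alpha>)"
  by (rule DERIV_continuous_on) (use flow_DERIV_within assms in blast)

text \<open>The sign \<open>\<sigma>\<close> selects the side of the endpoint \<open>c\<close> on which the particle stays. Nothing is known
  about \<open>u\<close> outside \<open>D\<close>, so the argument is local at the last contact time.\<close>

lemma no_crossing:
  assumes \<alpha>: "\<alpha> \<in> {0..1}" and c: "c \<in> {0, 1}" and \<sigma>: "\<sigma> \<in> {1, -1}"
    and init: "\<sigma> * (\<alpha> - c) \<ge> 0" and t1: "t1 \<in> {0..<T}"
  shows "\<sigma> * (\<gamma> \<alpha> t1 - c) \<ge> 0"
proof (rule ccontr)
  define z where "z t = \<sigma> * (\<gamma> \<alpha> t - c)" for t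
  assume "\<not> \<sigma> * (\<gamma> \<alpha> t1 - c) \<ge> 0"
  then have neg: "z t1 < 0" by (simp add: z_def)
  have zc: "continuous_on {0..t1} z"
    unfolding z_def[abs_def] by (intro continuous_intros flow_cont) (use \<alpha> t1 in auto)
  define S where "S = {t \<in> {0..t1}. 0 \<le> z t}"
  have "closed S" unfolding S_def
    by (intro continuous_closed_preimage_constant[unfolded vimage_def] continuous_on_closed_Collect_le
        continuous_on_const zc) auto
  then have "compact S"
    unfolding compact_eq_bounded_closed by (auto simp: S_def intro: bounded_subset[of "{0..t1}"])
  moreover have "0 \<in> S" using init t1 flow_0[OF \<alpha>] by (simp add: S_def z_def)
  ultimately obtain s where s: "s \<in> S" and smax: "\<And>t. t \<in> S \<Longrightarrow> t \<le> s"
    using compact_attains_sup[of S] by blast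
  have s01: "0 \<le> s" "s < t1" using s neg by (auto simp: S_def order_le_less)
  have after: "z t < 0" if "s < t" "t \<le> t1" for t
    using smax[of t] that s01 by (force simp: S_def)
  have at_s: "z s = 0"
  proof (rule ccontr)
    assume "z s \<noteq> 0"
    then have "z s > 0" using s by (simp add: S_def)
    moreover have "continuous (at s within {0..t1}) z"
      using zc s01 by (simp add: continuous_on_eq_continuous_within)
    ultimately obtain d where d: "d > 0" "\<And>t. t \<in> {0..t1} \<Longrightarrow> dist t s < d \<Longrightarrow> dist (z t) (z s) < z s"
      unfolding continuous_within_eps_delta by blast
    define t where "t = min t1 (s + d / 2)"
    have "z t < 0" by (rule after) (use s01 d in \<open>auto simp: t_def\<close>)
    moreover have "dist (z t) (z s) < z s"
      by (rule d(2)) (use s01 d(1) in \<open>auto simp: t_def dist_real_def min_def\<close>)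
    ultimately show False by (simp add: dist_real_def)
  qed
  then have \<gamma>s: "\<gamma> \<alpha> s = c" using \<sigma> by (auto simp: z_def)
  have cs: "(c, s) \<in> D" using strip_D c s01 t1 by auto
  define L where "L = \<bar>ux (c, s)\<bar> + 1"
  have "isCont ux (c, s)" using ux_partials[OF cs] by (rule has_partials_continuous)
  then obtain r1 where r1: "r1 > 0" "\<And>p. dist p (c, s) < r1 \<Longrightarrow> dist (ux p) (ux (c, s)) < 1"
    unfolding continuous_at_eps_delta by (meson zero_less_one)
  obtain r2 where r2: "r2 > 0" "ball (c, s) r2 \<subseteq> D" using open_D cs open_contains_ball by blast
  define r where "r = min r1 r2"
  have r: "r > 0" using r1 r2 by (simp add: r_def)
  have near: "(x, t) \<in> D \<and> \<bar>ux (x, t)\<bar> \<le> L" if "\<bar>x - c\<bar> < r / 2" "\<bar>t - s\<bar> < r / 2" for x t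
  proof -
    have "dist (x, t) (c, s) \<le> \<bar>x - c\<bar> + \<bar>t - s\<bar>"
      unfolding dist_prod_def dist_real_def fst_conv snd_conv by (rule sqrt_sum_squares_le_sum) auto
    then have *: "dist (x, t) (c, s) < r" using that by simp
    then have "\<bar>ux (x, t)\<bar> \<le> L" using r1(2)[of "(x, t)"] by (simp add: r_def L_def dist_real_def)
    then show ?thesis using * r2(2) by (auto simp: r_def dist_commute subset_eq)
  qed
  have "continuous (at s within {0..t1}) (\<gamma> \<alpha>)"
    using flow_cont[OF \<alpha>, of 0 t1] t1 s01 by (simp add: continuous_on_eq_continuous_within)
  then obtain d where d: "d > 0" "\<And>t. t \<in> {0..t1} \<Longrightarrow> dist t s < d \<Longrightarrow> dist (\<gamma> \<alpha> t) (\<gamma> \<alpha> s) < r / 2"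
    unfolding continuous_within_eps_delta using r by (meson half_gt_zero)
  define b where "b = min t1 (s + min d r / 4)"
  have b: "s < b" "b \<le> t1" "b - s < d" "b - s < r / 2" using s01 d(1) r by (auto simp: b_def min_def)
  \<comment> \<open>Since \<open>u c t = 0\<close> and \<open>ux\<close> is bounded by
    \<open>L\<close> nearby, the distance to \<open>c\<close> obeys a Gronwall inequality from the
    contact time on, where it is zero: the particle cannot leave \<open>c\<close>.\<close>
  have "\<bar>\<gamma> \<alpha> b - c\<bar> \<le> exp (L * (b - s)) * \<bar>\<gamma> \<alpha> s - c\<bar>"
  proof (rule gronwall_abs[where y' = "\<lambda>t. u (\<gamma> \<alpha> t) t"])
    show "continuous_on {s..b} (\<lambda>t. \<gamma> \<alpha> t - c)"
      by (intro continuous_intros flow_cont) (use \<alpha> s01 b t1 in auto)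
    fix t assume t: "s < t" "t < b"
    show "((\<lambda>t. \<gamma> \<alpha> t - c) has_real_derivative u (\<gamma> \<alpha> t) t) (at t)"
      using flow_DERIV[OF \<alpha>, of t] t s01 b t1 by (auto intro!: derivative_eq_intros)
    have y: "\<bar>\<gamma> \<alpha> t - c\<bar> < r / 2"
      using d(2)[of t] t s01 b \<gamma>s by (auto simp: dist_real_def)
    have seg: "\<bar>x - c\<bar> < r / 2" if "x \<in> {min c (\<gamma> \<alpha> t)..max c (\<gamma> \<alpha> t)}" for x
      using that y by (auto simp: min_def max_def split: if_splits)
    have nt: "\<bar>t - s\<bar> < r / 2" using t b by simp
    have "norm (u (\<gamma> \<alpha> t) t - u c t) \<le> L * norm (\<gamma> \<alpha> t - c)"
    proof (rule field_differentiable_bound[of "{min c (\<gamma> \<alpha> t)..max c (\<gamma> \<alpha> t)}" "\<lambda>x. u x t" "\<lambda>x. ux (x, t)"])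
      fix x assume x: "x \<in> {min c (\<gamma> \<alpha> t)..max c (\<gamma> \<alpha> t)}"
      note n = near[OF seg[OF x] nt]
      show "((\<lambda>x. u x t) has_real_derivative ux (x, t)) (at x within {min c (\<gamma> \<alpha> t)..max c (\<gamma> \<alpha> t)})"
        using n u_DERIV has_field_derivative_at_within by blast
      show "norm (ux (x, t)) \<le> L" using n by simp
    qed auto
    moreover have "u c t = 0" by (rule bc) (use t b s01 t1 c in auto)
    ultimately show "\<bar>u (\<gamma> \<alpha> t) t\<bar> \<le> L * \<bar>\<gamma> \<alpha> t - c\<bar>" by simp
  qed (use b in simp)
  then have "z b = 0" by (simp add: \<gamma>s z_def)
  then show False using after[OF b(1,2)] by simp
qed

lemma flow_endpoints: "t \<in> {0..<T} \<Longrightarrow> c \<in> {0, 1} \<Longrightarrow> \<gamma> c t = c"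
  using no_crossing[of c c 1 t] no_crossing[of c c "-1" t] by auto

lemma flow_in:
  assumes "\<alpha> \<in> {0..1}" "t \<in> {0..<T}"
  shows "\<gamma> \<alpha> t \<in> {0..1}"
  using no_crossing[OF assms(1), of 0 1 t] no_crossing[OF assms(1), of 1 "-1" t] assms by auto

lemma flow_D: "\<alpha> \<in> {0..1} \<Longrightarrow> t \<in> {0..<T} \<Longrightarrow> (\<gamma> \<alpha> t, t) \<in> D"
  using flow_in strip_D by blast

section \<open>Velocity gradient and stretching along a particle path\<close>

definition v :: "real \<Rightarrow> real \<Rightarrow> real" where "v \<alpha> t = ux (\<gamma> \<alpha> t, t)"

lemma v_cont:
  assumes "\<alpha> \<in> {0..1}" "0 \<le> a" "b < T"
  shows "continuous_on {a..b} (v \<alpha>)"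
  unfolding v_def[abs_def]
  by (rule continuous_on_compose2[OF ux_cont])
    (use assms flow_D in \<open>auto intro!: continuous_intros flow_cont\<close>)

lemma v_DERIV:
  assumes "\<alpha> \<in> {0..1}" "0 < t" "t < T"
  shows "(v \<alpha> has_real_derivative (v \<alpha> t)\<^sup>2 + I t) (at t)"
proof -
  have D: "(\<gamma> \<alpha> t, t) \<in> D" using flow_D assms by auto
  have "(v \<alpha> has_real_derivative uxx (\<gamma> \<alpha> t, t) * u (\<gamma> \<alpha> t) t + uxt (\<gamma> \<alpha> t, t) * 1) (at t)"
    unfolding v_def[abs_def]
    by (rule has_partials_curve[OF ux_partials[OF D] flow_DERIV[OF assms] DERIV_ident])
  moreover have "uxx (\<gamma> \<alpha> t, t) * u (\<gamma> \<alpha> t) t + uxt (\<gamma> \<alpha> t, t) * 1 = (v \<alpha> t)\<^sup>2 + I t"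
    using pde[OF assms(2,3) flow_in[OF assms(1)]] assms by (simp add: v_def algebra_simps)
  ultimately show ?thesis by simp
qed

text \<open>\<open>E\<close> turns out to be \<open>\<partial>\<gamma> / \<partial>\<alpha>\<close>.\<close>

definition E :: "real \<Rightarrow> real \<Rightarrow> real" where "E \<alpha> t = exp (integral {0..t} (v \<alpha>))"

lemma E_pos: "E \<alpha> t > 0" by (simp add: E_def)

lemma E_0: "E \<alpha> 0 = 1" by (simp add: E_def)

lemma E_DERIV_within:
  assumes "\<alpha> \<in> {0..1}" "t \<in> {0..b}" "b < T"
  shows "(E \<alpha> has_real_derivative v \<alpha> t * E \<alpha> t) (at t within {0..b})"
  unfolding E_def[abs_def]
  using integral_has_real_derivative[OF v_cont[OF assms(1) order_refl assms(3)] assms(2)]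
  by (auto intro!: derivative_eq_intros)

lemma E_DERIV:
  assumes "\<alpha> \<in> {0..1}" "0 < t" "t < T"
  shows "(E \<alpha> has_real_derivative v \<alpha> t * E \<alpha> t) (at t)"
proof -
  obtain b where "t < b" "b < T" using dense assms by blast
  then show ?thesis using E_DERIV_within[of \<alpha> t b] assms by (simp add: at_within_Icc_at)
qed

lemma E_cont: "\<alpha> \<in> {0..1} \<Longrightarrow> b < T \<Longrightarrow> continuous_on {0..b} (E \<alpha>)"
  by (rule DERIV_continuous_on) (use E_DERIV_within in blast)

text \<open>The forcing \<open>I\<close> cancels in \<open>v\<^sub>\<alpha> - v\<^sub>\<beta>\<close>, so this is conservation of the Wronskian of
  \<open>1 / E\<^sub>\<alpha>\<close> and \<open>1 / E\<^sub>\<beta>\<close>.\<close>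

lemma v_diff:
  assumes "\<alpha> \<in> {0..1}" "\<beta> \<in> {0..1}" "t \<in> {0..<T}"
  shows "v \<alpha> t - v \<beta> t = (v \<alpha> 0 - v \<beta> 0) * (E \<alpha> t * E \<beta> t)"
proof (cases "t = 0")
  case False
  have ne: "E \<alpha> s * E \<beta> s \<noteq> 0" for s using E_pos[of \<alpha> s] E_pos[of \<beta> s] by simp
  have "(v \<alpha> t - v \<beta> t) / (E \<alpha> t * E \<beta> t) = (v \<alpha> 0 - v \<beta> 0) / (E \<alpha> 0 * E \<beta> 0)"
  proof (rule DERIV_isconst_end[of 0 t "\<lambda>t. (v \<alpha> t - v \<beta> t) / (E \<alpha> t * E \<beta> t)"])
    show "continuous_on {0..t} (\<lambda>t. (v \<alpha> t - v \<beta> t) / (E \<alpha> t * E \<beta> t))"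
      by (intro continuous_intros v_cont E_cont) (use assms ne in auto)
    fix s assume s: "0 < s" "s < t"
    then have s': "0 < s" "s < T" using assms by auto
    have "((\<lambda>t. (v \<alpha> t - v \<beta> t) / (E \<alpha> t * E \<beta> t)) has_real_derivative
      ((((v \<alpha> s)\<^sup>2 + I s) - ((v \<beta> s)\<^sup>2 + I s)) * (E \<alpha> s * E \<beta> s)
        - (v \<alpha> s - v \<beta> s) * ((v \<alpha> s * E \<alpha> s) * E \<beta> s + (v \<beta> s * E \<beta> s) * E \<alpha> s))
      / ((E \<alpha> s * E \<beta> s) * (E \<alpha> s * E \<beta> s))) (at s)"
      by (intro DERIV_divide DERIV_diff DERIV_mult v_DERIV E_DERIV assms s' ne)
    then show "((\<lambda>t. (v \<alpha> t - v \<beta> t) / (E \<alpha> t * E \<beta> t)) has_real_derivative 0) (at s)"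
      by (rule DERIV_cong) (simp add: algebra_simps power2_eq_square)
  qed (use False assms in auto)
  then show ?thesis using ne[of t] by (simp add: E_0 field_simps)
qed (simp add: E_0)

text \<open>For \<open>w = \<gamma> \<beta> - \<gamma> \<alpha>\<close> the quotient
  \<open>w / E \<alpha>\<close> has a second order Taylor remainder of \<open>u\<close>, over
  \<open>E \<alpha>\<close>, as its time derivative. Gronwall makes \<open>w\<close>, and hence this
  remainder, of order \<open>\<bar>\<beta> - \<alpha>\<bar>\<close> and its square respectively, so
  \<open>w\<close> differs from \<open>E \<alpha> t * (\<beta> - \<alpha>)\<close> by a quadratic
  error.\<close>

lemma flow_DERIV_label:
  assumes t: "t \<in> {0..<T}" and \<alpha>: "\<alpha> \<in> {0..1}"
  shows "((\<lambda>\<alpha>. \<gamma> \<alpha> t) has_real_derivative E \<alpha> t) (at \<alpha> within {0..1})"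
proof -
  let ?Q = "{0..1::real} \<times> {0..t}"
  have Q: "compact ?Q" "?Q \<subseteq> D" using strip_D t by (auto intro!: compact_Times compact_Icc)
  obtain L where L: "L > 0" "\<And>p. p \<in> ?Q \<Longrightarrow> \<bar>ux p\<bar> \<le> L"
    using compact_imp_bounded[OF compact_continuous_image[OF continuous_on_subset[OF ux_cont Q(2)] Q(1)]]
    unfolding bounded_pos by auto
  obtain B where B: "B > 0" "\<And>p. p \<in> ?Q \<Longrightarrow> \<bar>uxx p\<bar> \<le> B"
    using compact_imp_bounded[OF compact_continuous_image[OF continuous_on_subset[OF uxx_cont Q(2)] Q(1)]]
    unfolding bounded_pos by auto
  have convex: "\<And>x y. x \<in> {0..1} \<Longrightarrow> y \<in> {0..1} \<Longrightarrow> {min x y..max x y} \<subseteq> {0..1::real}" by auto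
  have lip: "\<bar>u y s - u x s\<bar> \<le> L * \<bar>y - x\<bar>" if "x \<in> {0..1}" "y \<in> {0..1}" "s \<in> {0..t}" for x y s
  proof -
    have "norm (u y s - u x s) \<le> L * norm (y - x)"
    proof (rule field_differentiable_bound[of "{0..1}" "\<lambda>x. u x s" "\<lambda>x. ux (x, s)"])
      fix z :: real assume "z \<in> {0..1}"
      then have "(z, s) \<in> ?Q" using that by simp
      then show "((\<lambda>x. u x s) has_real_derivative ux (z, s)) (at z within {0..1})" "norm (ux (z, s)) \<le> L"
        using u_DERIV Q(2) L(2) has_field_derivative_at_within by (blast, simp)
    qed (use that in auto)
    then show ?thesis by simp
  qed
  have lip2: "\<bar>ux (y, s) - ux (x, s)\<bar> \<le> B * \<bar>y - x\<bar>" if "x \<in> {0..1}" "y \<in> {0..1}" "s \<in> {0..t}" for x y s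
  proof -
    have "norm (ux (y, s) - ux (x, s)) \<le> B * norm (y - x)"
    proof (rule field_differentiable_bound[of "{0..1}" "\<lambda>x. ux (x, s)" "\<lambda>x. uxx (x, s)"])
      fix z :: real assume "z \<in> {0..1}"
      then have "(z, s) \<in> ?Q" using that by simp
      then show "((\<lambda>x. ux (x, s)) has_real_derivative uxx (z, s)) (at z within {0..1})" "norm (uxx (z, s)) \<le> B"
        using ux_DERIV Q(2) B(2) has_field_derivative_at_within by (blast, simp)
    qed (use that in auto)
    then show ?thesis by simp
  qed
  have taylor: "\<bar>u y s - u x s - ux (x, s) * (y - x)\<bar> \<le> B * (y - x)\<^sup>2"
    if xy: "x \<in> {0..1}" "y \<in> {0..1}" and s: "s \<in> {0..t}" for x y s
  proof -
    \<comment> \<open>The mean value bound is applied to \<open>u\<close> minus its linear part at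
      \<open>x\<close>, whose slope is at most \<open>B * \<bar>y - x\<bar>\<close> between
      \<open>x\<close> and \<open>y\<close>.\<close>
    have "norm ((u y s - ux (x, s) * y) - (u x s - ux (x, s) * x)) \<le> (B * \<bar>y - x\<bar>) * norm (y - x)"
    proof (rule field_differentiable_bound[of "{min x y..max x y}" "\<lambda>z. u z s - ux (x, s) * z" "\<lambda>z. ux (z, s) - ux (x, s)"])
      fix z assume z: "z \<in> {min x y..max x y}"
      then have z01: "z \<in> {0..1}" using convex[OF xy] by blast
      then have "(z, s) \<in> D" using Q(2) s by blast
      from DERIV_diff[OF u_DERIV[OF this] DERIV_cmult[OF DERIV_ident, of "ux (x, s)"]]
      show "((\<lambda>z. u z s - ux (x, s) * z) has_real_derivative ux (z, s) - ux (x, s)) (at z within {min x y..max x y})"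
        by (simp add: has_field_derivative_at_within)
      have "\<bar>ux (z, s) - ux (x, s)\<bar> \<le> B * \<bar>z - x\<bar>" by (rule lip2) (use xy z01 s in auto)
      also have "\<dots> \<le> B * \<bar>y - x\<bar>" using z B(1) by (intro mult_left_mono) (auto simp: min_def max_def split: if_splits)
      finally show "norm (ux (z, s) - ux (x, s)) \<le> B * \<bar>y - x\<bar>" by simp
    qed auto
    then show ?thesis by (simp add: algebra_simps power2_eq_square)
  qed
  have v_bd: "\<bar>v \<alpha> s\<bar> \<le> L" if "s \<in> {0..t}" for s
    unfolding v_def by (rule L(2)) (use flow_in[OF \<alpha>, of s] that t in auto)
  have E_lo: "exp (- L * t) \<le> E \<alpha> s" and E_hi: "E \<alpha> s \<le> exp (L * t)" if s: "s \<in> {0..t}" for s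
  proof -
    have "norm (integral {0..s} (v \<alpha>)) \<le> L * (s - 0)"
      by (rule integral_bound) (use s t v_bd v_cont[OF \<alpha>, of 0 s] in auto)
    also have "\<dots> \<le> L * t" using s L(1) by simp
    finally show "exp (- L * t) \<le> E \<alpha> s" "E \<alpha> s \<le> exp (L * t)" by (auto simp: E_def)
  qed
  \<comment> \<open>One constant bounds the growth of path differences, \<open>E \<alpha>\<close>
    and its reciprocal on \<open>{0..t}\<close>.\<close>
  define c where "c = exp (L * t)"
  show ?thesis
  proof (rule DERIV_withinI_quadratic)
    fix \<beta> :: real assume \<beta>: "\<beta> \<in> {0..1}"
    define w where "w s = \<gamma> \<beta> s - \<gamma> \<alpha> s" for s
    have w_bd: "\<bar>w s\<bar> \<le> c * \<bar>\<beta> - \<alpha>\<bar>" if s: "s \<in> {0..t}" for s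
    proof -
      have "\<bar>w s\<bar> \<le> exp (L * (s - 0)) * \<bar>w 0\<bar>"
      proof (rule gronwall_abs[where y' = "\<lambda>r. u (\<gamma> \<beta> r) r - u (\<gamma> \<alpha> r) r"])
        show "continuous_on {0..s} w" unfolding w_def[abs_def]
          by (intro continuous_intros flow_cont \<alpha> \<beta>) (use s t in auto)
        fix r assume r: "0 < r" "r < s"
        show "(w has_real_derivative u (\<gamma> \<beta> r) r - u (\<gamma> \<alpha> r) r) (at r)" unfolding w_def[abs_def]
          by (intro DERIV_diff flow_DERIV \<alpha> \<beta>) (use s t r in auto)
        show "\<bar>u (\<gamma> \<beta> r) r - u (\<gamma> \<alpha> r) r\<bar> \<le> L * \<bar>w r\<bar>" unfolding w_def
          by (rule lip) (use flow_in \<alpha> \<beta> s t r in auto)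
      qed (use s in auto)
      also have "\<dots> \<le> c * \<bar>w 0\<bar>" using s L(1) by (intro mult_right_mono) (auto simp: c_def)
      finally show ?thesis by (simp add: w_def flow_0[OF \<alpha>] flow_0[OF \<beta>])
    qed
    have "norm (w t / E \<alpha> t - w 0 / E \<alpha> 0) \<le> (B * (c * \<bar>\<beta> - \<alpha>\<bar>)\<^sup>2 * c) * norm (t - 0)"
    proof (rule field_differentiable_bound[of "{0..t}" "\<lambda>s. w s / E \<alpha> s"
          "\<lambda>s. (u (\<gamma> \<beta> s) s - u (\<gamma> \<alpha> s) s - v \<alpha> s * w s) / E \<alpha> s"])
      fix s assume s: "s \<in> {0..t}"
      have ne: "E \<alpha> s \<noteq> 0" using E_pos[of \<alpha> s] by simp
      have "((\<lambda>s. w s / E \<alpha> s) has_real_derivative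
          ((u (\<gamma> \<beta> s) s - u (\<gamma> \<alpha> s) s) * E \<alpha> s - w s * (v \<alpha> s * E \<alpha> s)) / (E \<alpha> s * E \<alpha> s)) (at s within {0..t})"
        unfolding w_def
        by (intro DERIV_divide DERIV_diff flow_DERIV_within E_DERIV_within \<alpha> \<beta> s ne) (use t in auto)
      then show "((\<lambda>s. w s / E \<alpha> s) has_real_derivative (u (\<gamma> \<beta> s) s - u (\<gamma> \<alpha> s) s - v \<alpha> s * w s) / E \<alpha> s) (at s within {0..t})"
        by (rule DERIV_cong) (use ne in \<open>simp add: divide_simps, simp add: algebra_simps\<close>)
      have "\<bar>u (\<gamma> \<beta> s) s - u (\<gamma> \<alpha> s) s - v \<alpha> s * w s\<bar> \<le> B * (w s)\<^sup>2"
        unfolding w_def v_def by (rule taylor) (use flow_in \<alpha> \<beta> s t in auto)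
      also have "\<dots> \<le> B * (c * \<bar>\<beta> - \<alpha>\<bar>)\<^sup>2"
        using power_mono[OF w_bd[OF s] abs_ge_zero, of 2] B(1) by (intro mult_left_mono) auto
      finally have "\<bar>u (\<gamma> \<beta> s) s - u (\<gamma> \<alpha> s) s - v \<alpha> s * w s\<bar> / E \<alpha> s \<le> B * (c * \<bar>\<beta> - \<alpha>\<bar>)\<^sup>2 / exp (- L * t)"
        using E_lo[OF s] B(1) by (intro frac_le) auto
      then show "norm ((u (\<gamma> \<beta> s) s - u (\<gamma> \<alpha> s) s - v \<alpha> s * w s) / E \<alpha> s) \<le> B * (c * \<bar>\<beta> - \<alpha>\<bar>)\<^sup>2 * c"
        using E_pos[of \<alpha> s] by (simp add: c_def exp_minus divide_inverse abs_mult)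
    qed (use t in auto)
    then have "\<bar>w t / E \<alpha> t - (\<beta> - \<alpha>)\<bar> \<le> B * (c * \<bar>\<beta> - \<alpha>\<bar>)\<^sup>2 * c * t"
      using t by (simp add: E_0 w_def flow_0[OF \<alpha>] flow_0[OF \<beta>])
    then have "E \<alpha> t * \<bar>w t / E \<alpha> t - (\<beta> - \<alpha>)\<bar> \<le> c * (B * (c * \<bar>\<beta> - \<alpha>\<bar>)\<^sup>2 * c * t)"
      by (intro mult_mono) (use E_hi[of t] t B(1) E_pos[of \<alpha> t] in \<open>auto simp: c_def\<close>)
    moreover have "E \<alpha> t * \<bar>w t / E \<alpha> t - (\<beta> - \<alpha>)\<bar> = \<bar>\<gamma> \<beta> t - \<gamma> \<alpha> t - E \<alpha> t * (\<beta> - \<alpha>)\<bar>"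
    proof -
      have "E \<alpha> t * (w t / E \<alpha> t - (\<beta> - \<alpha>)) = \<gamma> \<beta> t - \<gamma> \<alpha> t - E \<alpha> t * (\<beta> - \<alpha>)"
      proof -
        have "E \<alpha> t * (w t / E \<alpha> t) = w t" using E_pos[of \<alpha> t] by simp
        then show ?thesis unfolding right_diff_distrib by (simp add: w_def)
      qed
      then show ?thesis using E_pos[of \<alpha> t] by (metis abs_mult abs_of_pos)
    qed
    ultimately show "\<bar>\<gamma> \<beta> t - \<gamma> \<alpha> t - E \<alpha> t * (\<beta> - \<alpha>)\<bar> \<le> (c * B * c\<^sup>2 * c * t) * (\<beta> - \<alpha>)\<^sup>2"
      by (simp add: power_mult_distrib mult_ac)
  qed
qed

text \<open>The endpoints do not move, so the total length of the particle interval is preserved.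
  This is the condition that later pins \<open>E \<rho>\<close> down as
  \<open>1 / K\<close>.\<close>

lemma E_has_integral:
  assumes "t \<in> {0..<T}"
  shows "((\<lambda>\<alpha>. E \<alpha> t) has_integral 1) {0..1}"
proof -
  have "((\<lambda>\<alpha>. E \<alpha> t) has_integral \<gamma> 1 t - \<gamma> 0 t) {0..1}"
    by (rule fundamental_theorem_of_calculus)
      (use flow_DERIV_label[OF assms] in \<open>auto simp: has_real_derivative_iff_has_vector_derivative[symmetric]\<close>)
  then show ?thesis using flow_endpoints[OF assms] by simp
qed

end

section \<open>Identification with the solution formula\<close>

text \<open>\<rho> is a critical point of \<open>u0\<close>, so \<open>1 / E \<rho>\<close> is the
  solution of the linear equation with initial slope 0, the natural reference for all other
  labels.\<close>

locale profile_paths = profile u0 M a0 + particle_paths u \<gamma> ts D ux ut uxx uxt I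
  for u0 :: "real \<Rightarrow> real" and M a0 :: real
    and u \<gamma> :: "real \<Rightarrow> real \<Rightarrow> real" and D :: "(real \<times> real) set"
    and ux ut uxx uxt :: "real \<times> real \<Rightarrow> real" and I :: "real \<Rightarrow> real" +
  fixes \<rho> :: real
  assumes rho: "\<rho> \<in> {0..1}" "deriv u0 \<rho> = 0"
    and v_init: "\<And>\<alpha>. \<alpha> \<in> {0..1} \<Longrightarrow> ux (\<alpha>, 0) = deriv u0 \<alpha>"
begin

lemma v_0: "\<alpha> \<in> {0..1} \<Longrightarrow> v \<alpha> 0 = g \<alpha>"
  by (simp add: v_def flow_0 v_init)

text \<open>Reduction of order: \<open>eta / E \<rho>\<close> is the solution of the same linear
  equation with initial value 0 and slope 1.\<close>

definition eta :: "real \<Rightarrow> real" where "eta t = integral {0..t} (\<lambda>s. (E \<rho> s)\<^sup>2)"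

lemma eta_0: "eta 0 = 0"
  by (simp add: eta_def)

lemma eta_DERIV_within:
  assumes "t \<in> {0..b}" "b < ts"
  shows "(eta has_real_derivative (E \<rho> t)\<^sup>2) (at t within {0..b})"
  unfolding eta_def[abs_def]
  by (rule integral_has_real_derivative) (use assms E_cont[OF rho(1)] in \<open>auto intro!: continuous_intros\<close>)

lemma eta_DERIV:
  assumes "0 < t" "t < ts"
  shows "(eta has_real_derivative (E \<rho> t)\<^sup>2) (at t)"
proof -
  obtain b where "t < b" "b < ts" using dense assms by blast
  then show ?thesis using eta_DERIV_within[of t b] assms by (simp add: at_within_Icc_at)
qed

lemma eta_cont: "b < ts \<Longrightarrow> continuous_on {0..b} eta"
  by (rule DERIV_continuous_on) (use eta_DERIV_within in blast)

text \<open>The ratio of two solutions \<open>1 / E\<close> has as derivative their Wronskian over a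
  square; by \<open>v_diff\<close> the Wronskian is constant, here
  \<open>- g \<alpha>\<close>.\<close>

lemma E_eq:
  assumes "\<alpha> \<in> {0..1}" "t \<in> {0..<ts}"
  shows "E \<rho> t / E \<alpha> t = 1 - eta t * g \<alpha>"
proof (cases "t = 0")
  case False
  have ne: "E \<beta> s \<noteq> 0" for \<beta> s using E_pos[of \<beta> s] by simp
  have "E \<rho> t / E \<alpha> t + eta t * g \<alpha> = E \<rho> 0 / E \<alpha> 0 + eta 0 * g \<alpha>"
  proof (rule DERIV_isconst_end[of 0 t "\<lambda>t. E \<rho> t / E \<alpha> t + eta t * g \<alpha>"])
    show "continuous_on {0..t} (\<lambda>t. E \<rho> t / E \<alpha> t + eta t * g \<alpha>)"
      by (intro continuous_intros E_cont eta_cont) (use assms rho ne in auto)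
    fix s assume "0 < s" "s < t"
    then have s: "0 < s" "s < ts" using assms by auto
    have "((\<lambda>t. E \<rho> t / E \<alpha> t + eta t * g \<alpha>) has_real_derivative
        ((v \<rho> s * E \<rho> s) * E \<alpha> s - E \<rho> s * (v \<alpha> s * E \<alpha> s)) / (E \<alpha> s * E \<alpha> s) + (E \<rho> s)\<^sup>2 * g \<alpha>) (at s)"
      by (intro DERIV_add DERIV_divide DERIV_cmult_right E_DERIV eta_DERIV rho assms s ne)
    moreover have "((v \<rho> s * E \<rho> s) * E \<alpha> s - E \<rho> s * (v \<alpha> s * E \<alpha> s)) / (E \<alpha> s * E \<alpha> s) + (E \<rho> s)\<^sup>2 * g \<alpha> = 0"
    proof -
      have "v \<alpha> s - v \<rho> s = g \<alpha> * (E \<alpha> s * E \<rho> s)"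
        using v_diff[OF assms(1) rho(1), of s] s v_0 assms rho by simp
      then have *: "v \<alpha> s = v \<rho> s + g \<alpha> * (E \<alpha> s * E \<rho> s)" by simp
      show ?thesis unfolding * using ne[of \<alpha> s] by (simp add: field_simps power2_eq_square)
    qed
    ultimately show "((\<lambda>t. E \<rho> t / E \<alpha> t + eta t * g \<alpha>) has_real_derivative 0) (at s)" by simp
  qed (use False assms in auto)
  then show ?thesis by (simp add: E_0 eta_0)
qed (simp add: E_0 eta_0)

text \<open>Positivity of \<open>E\<close> alone keeps every smooth solution within the range where
  the formulas make sense.\<close>

lemma eta_dom:
  assumes "t \<in> {0..<ts}"
  shows "eta t \<in> dom 0 1"
  unfolding dom_def
proof (intro CollectI ballI)
  fix s :: real assume "s \<in> {0..1}"
  from E_eq[OF this assms] divide_pos_pos[OF E_pos E_pos, of \<rho> t s t]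
  show "eta t * g s < 1" by simp
qed

lemma K_eta:
  assumes "t \<in> {0..<ts}"
  shows "E \<rho> t = inverse (K (eta t))"
proof -
  have "((\<lambda>s. E \<rho> t * (g s ^ 0 * inverse (1 - eta t * g s) ^ 1)) has_integral E \<rho> t * J 0 1 1 (eta t)) {0..1}"
    by (intro has_integral_mult_right J_has_integral eta_dom assms)
  moreover have "E \<rho> t * (g s ^ 0 * inverse (1 - eta t * g s) ^ 1) = E s t" if "s \<in> {0..1}" for s
    unfolding E_eq[OF that assms, symmetric] using E_pos[of \<rho> t] E_pos[of s t] by simp
  ultimately have "((\<lambda>s. E s t) has_integral E \<rho> t * K (eta t)) {0..1}"
    unfolding K_def by (rule has_integral_eq[rotated])
  then have "E \<rho> t * K (eta t) = 1"
    using E_has_integral[OF assms] has_integral_unique by blast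
  then show ?thesis by (metis inverse_unique mult.commute)
qed

text \<open>The time derivative of the left side is
  \<open>K\<^sup>2 * (E \<rho>)\<^sup>2 = 1\<close>. Hence \<open>eta\<close> inverts
  \<open>F\<close> and does not depend on the solution considered.\<close>

lemma F_eta:
  assumes "t \<in> {0..<ts}"
  shows "F (eta t) = t"
proof (cases "t = 0")
  case False
  have "F (eta t) - t = F (eta 0) - 0"
  proof (rule DERIV_isconst_end[of 0 t "\<lambda>t. F (eta t) - t"])
    have "continuous_on (dom 0 1) F"
      using F_DERIV DERIV_isCont by (blast intro: continuous_at_imp_continuous_on)
    then show "continuous_on {0..t} (\<lambda>t. F (eta t) - t)"
      using assms eta_dom
      by (intro continuous_intros continuous_on_compose2[of "dom 0 1" F _ eta] eta_cont) auto
    fix s assume "0 < s" "s < t"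
    then have s: "0 < s" "s < ts" "s \<in> {0..<ts}" using assms by auto
    have "((\<lambda>t. F (eta t) - t) has_real_derivative (K (eta s))\<^sup>2 * (E \<rho> s)\<^sup>2 - 1) (at s)"
      by (intro DERIV_diff DERIV_ident DERIV_chain2[OF F_DERIV[OF eta_dom[OF s(3)]] eta_DERIV[OF s(1,2)]])
    moreover have "(K (eta s))\<^sup>2 * (E \<rho> s)\<^sup>2 - 1 = 0"
      using K_pos[OF eta_dom[OF s(3)]] by (simp add: K_eta[OF s(3)] power_inverse)
    ultimately show "((\<lambda>t. F (eta t) - t) has_real_derivative 0) (at s)" by simp
  qed (use False assms in auto)
  then show ?thesis by (simp add: eta_0 F_0)
qed (simp add: eta_0 F_0)

text \<open>\<open>v \<rho>\<close> is the logarithmic derivative of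
  \<open>E \<rho> = 1 / K (eta t)\<close>, and \<open>eta\<close> has derivative
  \<open>1 / K\<^sup>2\<close>.\<close>

lemma v_rho:
  assumes "0 < t" "t < ts"
  shows "v \<rho> t = - (K1 (eta t) / K (eta t) ^ 3)"
proof -
  have t: "t \<in> {0..<ts}" using assms by simp
  note d = eta_dom[OF t]
  note k = K_pos[OF d]
  have "((\<lambda>s. inverse (K (eta s))) has_real_derivative
      - (inverse (K (eta t)) * (K1 (eta t) * (E \<rho> t)\<^sup>2) * inverse (K (eta t)))) (at t)"
    by (rule DERIV_inverse'[OF DERIV_chain2[OF K_DERIV[OF d] eta_DERIV[OF assms]]]) (use k in simp)
  then have "(E \<rho> has_real_derivative
      - (inverse (K (eta t)) * (K1 (eta t) * (E \<rho> t)\<^sup>2) * inverse (K (eta t)))) (at t)"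
    by (rule has_field_derivative_transform_within_open[where S = "{0<..<ts}"])
      (use assms K_eta in auto)
  then have "v \<rho> t * E \<rho> t = - (inverse (K (eta t)) * (K1 (eta t) * (E \<rho> t)\<^sup>2) * inverse (K (eta t)))"
    using E_DERIV[OF rho(1) assms] DERIV_unique by blast
  then show ?thesis
    unfolding K_eta[OF t] using k by (simp add: field_simps power2_eq_square power3_eq_cube)
qed

lemma v_eq_vel:
  assumes "\<alpha> \<in> {0..1}" "0 < t" "t < ts"
  shows "v \<alpha> t = vel (g \<alpha>) (eta t)"
proof -
  have t: "t \<in> {0..<ts}" using assms by simp
  have "E \<alpha> t = E \<rho> t / (1 - eta t * g \<alpha>)"
    unfolding E_eq[OF assms(1) t, symmetric] using E_pos[of \<rho> t] by simp
  then have "v \<alpha> t - v \<rho> t = g \<alpha> * (E \<rho> t / (1 - eta t * g \<alpha>) * E \<rho> t)"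
    using v_diff[OF assms(1) rho(1) t] v_0 assms(1) rho by simp
  then show ?thesis
    unfolding v_rho[OF assms(2,3)] vel_def K_eta[OF t] by (simp add: field_simps power2_eq_square)
qed

text \<open>\<open>eta\<close> exceeds a given \<open>e'\<close> as soon as \<open>t > F e'\<close>,
  because \<open>F\<close> is increasing and \<open>F (eta t) = t\<close>; by
  \<open>F_less_ts\<close> this happens before \<open>ts\<close>.\<close>

lemma eta_tendsto: "filterlim eta (at_left (1 / M)) (at_left ts)"
  unfolding filterlim_at
proof
  have lt: "eta t < 1 / M" if "t \<in> {0..<ts}" for t
    using dom_01[OF eta_dom[OF that]] M_pos by (simp add: field_simps)
  have pos: "\<forall>\<^sub>F t in at_left ts. 0 < t \<and> t < ts"
    unfolding eventually_at_left_field using ts_pos by blast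
  show "\<forall>\<^sub>F t in at_left ts. eta t \<in> {..<1 / M} \<and> eta t \<noteq> 1 / M"
    using pos
  proof eventually_elim
    case (elim t)
    then show ?case using lt[of t] by simp
  qed
  show "(eta \<longlongrightarrow> 1 / M) (at_left ts)"
  proof (rule order_tendstoI)
    fix e assume "e < 1 / M"
    define e' where "e' = max 0 e"
    have e': "e' \<in> {0..<1 / M}" using \<open>e < 1 / M\<close> M_pos by (simp add: e'_def)
    have "\<forall>\<^sub>F t in at_left ts. F e' < t \<and> t < ts"
      unfolding eventually_at_left_field using F_less_ts[OF e'] by blast
    then show "\<forall>\<^sub>F t in at_left ts. e < eta t"
      using pos
    proof eventually_elim
      case (elim t)
      then have t: "t \<in> {0..<ts}" by simp
      have "e' < eta t"
      proof (rule ccontr)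
        assume "\<not> e' < eta t"
        then have "F (eta t) \<le> F e'"
          using F_strict_mono[OF eta_dom[OF t] in_dom_01'[OF e']] by (cases "eta t = e'") auto
        then show False using F_eta[OF t] elim by simp
      qed
      then show ?case by (simp add: e'_def)
    qed
  next
    fix e assume "1 / M < e"
    show "\<forall>\<^sub>F t in at_left ts. eta t < e"
      using pos
    proof eventually_elim
      case (elim t)
      then show ?case using lt[of t] \<open>1 / M < e\<close> by simp
    qed
  qed
qed

lemma v_filterlim:
  assumes "\<alpha> \<in> {0..1}" "filterlim (vel (g \<alpha>)) \<F> (at_left (1 / M))"
  shows "filterlim (v \<alpha>) \<F> (at_left ts)"
proof -
  have "\<forall>\<^sub>F t in at_left ts. 0 < t \<and> t < ts"
    unfolding eventually_at_left_field using ts_pos by blast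
  then have "\<forall>\<^sub>F t in at_left ts. vel (g \<alpha>) (eta t) = v \<alpha> t"
    by eventually_elim (simp add: v_eq_vel[OF assms(1)])
  with filterlim_compose[OF assms(2) eta_tendsto] show ?thesis
    by (simp add: filterlim_cong[OF refl refl])
qed

text \<open>By \<open>v_diff\<close> particles keep the order of their initial slopes for all time,
  so a label maximizing \<open>u0'\<close> realizes the supremum throughout.\<close>

lemma v_at_max:
  assumes "a \<in> {0..1}" "g a = M"
  shows "filterlim (v a) at_top (at_left ts)"
    and "t \<in> {0..<ts} \<Longrightarrow> (SUP \<alpha>\<in>{0..1}. v \<alpha> t) = v a t"
proof -
  show "filterlim (v a) at_top (at_left ts)"
    by (rule v_filterlim) (use assms vel_max_at_top in auto)
  assume t: "t \<in> {0..<ts}"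
  have "v \<alpha> t \<le> v a t" if "\<alpha> \<in> {0..1}" for \<alpha>
  proof -
    have "v \<alpha> t - v a t = (g \<alpha> - g a) * (E \<alpha> t * E a t)"
      using v_diff[OF that assms(1) t] v_0 that assms(1) by simp
    also have "\<dots> \<le> 0"
      using le_M[OF that] assms(2) E_pos[of \<alpha> t] E_pos[of a t] by (intro mult_nonpos_nonneg) auto
    finally show ?thesis by simp
  qed
  then show "(SUP \<alpha>\<in>{0..1}. v \<alpha> t) = v a t"
    by (intro cSup_eq_maximum) (use assms in auto)
qed

lemma v_at_other:
  assumes "\<alpha> \<in> {0..1}" "g \<alpha> \<noteq> M"
  shows "filterlim (v \<alpha>) at_bot (at_left ts)"
proof (rule v_filterlim[OF assms(1)])
  have "g \<alpha> < M" using le_M[OF assms(1)] assms(2) by simp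
  then show "filterlim (vel (g \<alpha>)) at_bot (at_left (1 / M))" by (rule vel_at_bot)
qed

lemma sup_norm_at_top: "filterlim (\<lambda>t. SUP x\<in>{0..1}. \<bar>ux (x, t)\<bar>) at_top (at_left ts)"
proof (rule filterlim_at_top_mono)
  have a: "a0 \<in> {0..1}" using a0 by auto
  show "filterlim (v a0) at_top (at_left ts)" by (rule v_at_max(1)[OF a at_a0])
  have "\<forall>\<^sub>F t in at_left ts. 0 < t \<and> t < ts"
    unfolding eventually_at_left_field using ts_pos by blast
  then show "\<forall>\<^sub>F t in at_left ts. v a0 t \<le> (SUP x\<in>{0..1}. \<bar>ux (x, t)\<bar>)"
  proof eventually_elim
    case (elim t)
    then have t: "t \<in> {0..<ts}" by simp
    \<comment> \<open>The real supremum is an upper bound only for a bounded set, which compactness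
      provides.\<close>
    have "continuous_on {0..1} (\<lambda>x. \<bar>ux (x, t)\<bar>)"
      by (intro continuous_intros continuous_on_compose2[OF ux_cont]) (use strip_D t in auto)
    then have "bdd_above ((\<lambda>x. \<bar>ux (x, t)\<bar>) ` {0..1})"
      by (intro bounded_imp_bdd_above compact_imp_bounded compact_continuous_image) auto
    from cSUP_upper[OF flow_in[OF a t] this]
    have "\<bar>v a0 t\<bar> \<le> (SUP x\<in>{0..1}. \<bar>ux (x, t)\<bar>)" by (simp add: v_def)
    then show ?case by simp
  qed
qed

end

section \<open>From the definition of a solution to particle paths\<close>

lemma is_solution_partials:
  assumes "is_solution u0 T u"
  obtains D ux ut uxx uxt where "open D" "{0..1} \<times> {0..<T} \<subseteq> D"
    "\<And>z. z \<in> D \<Longrightarrow> has_partials (\<lambda>z. u (fst z) (snd z)) (ux z) (ut z) z"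
    "\<And>z. z \<in> D \<Longrightarrow> has_partials ux (uxx z) (uxt z) z" "continuous_on D uxx"
    "\<And>x t. (x, t) \<in> D \<Longrightarrow> pdx u x t = ux (x, t)"
    "\<And>x t. (x, t) \<in> D \<Longrightarrow> pdx (pdx u) x t = uxx (x, t)"
    "\<And>x t. (x, t) \<in> D \<Longrightarrow> pdt (pdx u) x t = uxt (x, t)"
proof -
  obtain D where D: "open D" "{0..1} \<times> {0..<T} \<subseteq> D" "smooth_on D (\<lambda>(x, t). u x t)"
    using assms unfolding is_solution_def by blast
  have "smooth_on D (\<lambda>z. u (fst z) (snd z))" using D(3) by (simp add: case_prod_unfold)
  from smooth_on_partials[OF D(1) this] obtain ux ut where
    1: "smooth_on D ux" "\<And>z. z \<in> D \<Longrightarrow> has_partials (\<lambda>z. u (fst z) (snd z)) (ux z) (ut z) z" by metis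
  from smooth_on_partials[OF D(1) 1(1)] obtain uxx uxt where
    2: "smooth_on D uxx" "\<And>z. z \<in> D \<Longrightarrow> has_partials ux (uxx z) (uxt z) z" by metis
  have c: "continuous_on D uxx" using 2(1) unfolding smooth_on_def by (metis hdiff.simps(1))
  have px: "pdx u x t = ux (x, t)" if "(x, t) \<in> D" for x t
    unfolding pdx_def using has_partials_fst_DERIV[OF 1(2)[OF that]] by (simp add: DERIV_imp_deriv)
  \<comment> \<open>\<open>pdx (pdx u)\<close> and \<open>pdt (pdx u)\<close> differentiate the
    function \<open>pdx u\<close>, so its value is needed on a neighbourhood and not just at the
    point.\<close>
  have ev: "eventually (\<lambda>y. pdx u y t = ux (y, t)) (nhds x)" "eventually (\<lambda>s. pdx u x s = ux (x, s)) (nhds t)"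
    if "(x, t) \<in> D" for x t
  proof -
    have "eventually (\<lambda>y. (y, t) \<in> D) (nhds x)" "eventually (\<lambda>s. (x, s) \<in> D) (nhds t)"
      using that eventually_nhds_in_open[OF open_vimage[OF D(1), of "\<lambda>y. (y, t)"], of x]
        eventually_nhds_in_open[OF open_vimage[OF D(1), of "\<lambda>s. (x, s)"], of t]
      by (simp_all add: continuous_intros)
    then show "eventually (\<lambda>y. pdx u y t = ux (y, t)) (nhds x)" "eventually (\<lambda>s. pdx u x s = ux (x, s)) (nhds t)"
      by (auto elim!: eventually_mono simp: px)
  qed
  show ?thesis
  proof (rule that[OF D(1,2) 1(2) 2(2) c px])
    fix x t assume xt: "(x, t) \<in> D"
    show "pdx (pdx u) x t = uxx (x, t)"
      unfolding pdx_def[of "pdx u"] deriv_cong_ev[OF ev(1)[OF xt] refl]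
      by (rule DERIV_imp_deriv[OF has_partials_fst_DERIV[OF 2(2)[OF xt]]])
    show "pdt (pdx u) x t = uxt (x, t)"
      unfolding pdt_def deriv_cong_ev[OF ev(2)[OF xt] refl]
      by (rule DERIV_imp_deriv[OF has_partials_snd_DERIV[OF 2(2)[OF xt]]])
  qed
qed

lemma DERIV_within_Icc_unique:
  fixes f :: "real \<Rightarrow> real"
  assumes "(f has_real_derivative c) (at x within {a..b})" "(f has_real_derivative d) (at x within {a..b})"
    and "a < b" "x \<in> {a..b}"
  shows "c = d"
  using vector_derivative_unique_within_closed_interval[of a b x f c d] assms
  by (simp add: has_real_derivative_iff_has_vector_derivative)

context profile
begin

lemma blowup:
  assumes sol: "is_solution u0 ts u" and flow: "lagrangian_flow u ts \<gamma>"
  shows "filterlim (\<lambda>t. Sup ((\<lambda>x. \<bar>pdx u x t\<bar>) ` {0..1})) at_top (at_left ts)"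
    and "\<And>a. a \<in> {0..1} \<Longrightarrow> g a = M \<Longrightarrow>
      (\<forall>t\<in>{0..<ts}. Sup ((\<lambda>\<alpha>. pdx u (\<gamma> \<alpha> t) t) ` {0..1}) = pdx u (\<gamma> a t) t) \<and>
      filterlim (\<lambda>t. pdx u (\<gamma> a t) t) at_top (at_left ts)"
    and "\<And>\<alpha>. \<alpha> \<in> {0..1} \<Longrightarrow> g \<alpha> \<noteq> M \<Longrightarrow> filterlim (\<lambda>t. pdx u (\<gamma> \<alpha> t) t) at_bot (at_left ts)"
proof -
  obtain D ux ut uxx uxt where D: "open D" "{0..1} \<times> {0..<ts} \<subseteq> D"
    and p: "\<And>z. z \<in> D \<Longrightarrow> has_partials (\<lambda>z. u (fst z) (snd z)) (ux z) (ut z) z"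
      "\<And>z. z \<in> D \<Longrightarrow> has_partials ux (uxx z) (uxt z) z" "continuous_on D uxx"
    and e: "\<And>x t. (x, t) \<in> D \<Longrightarrow> pdx u x t = ux (x, t)"
      "\<And>x t. (x, t) \<in> D \<Longrightarrow> pdx (pdx u) x t = uxx (x, t)"
      "\<And>x t. (x, t) \<in> D \<Longrightarrow> pdt (pdx u) x t = uxt (x, t)"
    by (rule is_solution_partials[OF sol]) blast
  \<comment> \<open>Rolle applies because \<open>u0\<close> vanishes at both ends.\<close>
  obtain \<rho> where \<rho>: "0 < \<rho>" "\<rho> < 1" "g \<rho> = 0"
  proof -
    have "continuous_on {0..1} u0"
      using u0_DERIV DERIV_isCont by (blast intro: continuous_at_imp_continuous_on)
    then obtain z where "0 < z" "z < 1" "(\<lambda>y. g z * y) = (\<lambda>y. 0)"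
      using Rolle_deriv[of 0 1 u0 "\<lambda>x y. g x * y"] u0_0 u0_1 u0_DERIV
      unfolding has_field_derivative_def by auto
    then show ?thesis using that[of z] by (metis mult.right_neutral)
  qed
  \<comment> \<open>The initial condition holds on \<open>[0, 1]\<close> only, so at the endpoints
    the derivatives of \<open>u\<close> and \<open>u0\<close> can be compared from inside the
    interval alone.\<close>
  have init: "ux (\<alpha>, 0) = g \<alpha>" if \<alpha>: "\<alpha> \<in> {0..1}" for \<alpha>
  proof -
    have "(\<alpha>, 0) \<in> D" using D(2) \<alpha> ts_pos by auto
    from has_partials_fst_DERIV[OF p(1)[OF this]]
    have "((\<lambda>y. u y 0) has_real_derivative ux (\<alpha>, 0)) (at \<alpha> within {0..1})"
      by (simp add: has_field_derivative_at_within)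
    moreover have "u y 0 = u0 y" if "y \<in> {0..1}" for y
      using sol that unfolding is_solution_def by blast
    ultimately have "(u0 has_real_derivative ux (\<alpha>, 0)) (at \<alpha> within {0..1})"
      unfolding has_field_derivative_def
      by (intro has_derivative_transform[of \<alpha> "{0..1}" u0 "\<lambda>y. u y 0"]) (use \<alpha> in auto)
    then show ?thesis
      using DERIV_within_Icc_unique[OF _ has_field_derivative_at_within[OF u0_DERIV]] \<alpha> by simp
  qed
  interpret profile_paths u0 M a0 u \<gamma> D ux ut uxx uxt "\<lambda>t. - 2 * integral {0..1} (\<lambda>y. (pdx u y t)\<^sup>2)" \<rho>
  proof unfold_locales
    fix t c :: real assume "t \<in> {0..<ts}" "c \<in> {0, 1}"
    then show "u c t = 0" using sol unfolding is_solution_def by auto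
  next
    fix x t :: real assume t: "0 < t" "t < ts" and x: "x \<in> {0..1}"
    have xt: "(x, t) \<in> D" using D(2) t x by auto
    have "pdt (pdx u) x t + u x t * pdx (pdx u) x t - (pdx u x t)\<^sup>2
          = - 2 * integral {0..1} (\<lambda>y. (pdx u y t)\<^sup>2)"
      using sol t x unfolding is_solution_def by auto
    then show "uxt (x, t) + u x t * uxx (x, t) - (ux (x, t))\<^sup>2
          = - 2 * integral {0..1} (\<lambda>y. (pdx u y t)\<^sup>2)"
      by (simp add: e[OF xt])
  qed (use D p flow init \<rho> in auto)
  have ev: "\<forall>\<^sub>F t in at_left ts. t \<in> {0..<ts}"
    unfolding eventually_at_left_field using ts_pos by (intro exI[of _ 0]) auto
  have ux: "pdx u x t = ux (x, t)" if "x \<in> {0..1}" "t \<in> {0..<ts}" for x t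
    using e(1) D(2) that by blast
  have v: "pdx u (\<gamma> \<alpha> t) t = v \<alpha> t" if "\<alpha> \<in> {0..1}" "t \<in> {0..<ts}" for \<alpha> t
    using ux flow_in that by (simp add: v_def)
  have vl: "filterlim (\<lambda>t. pdx u (\<gamma> \<alpha> t) t) \<F> (at_left ts)"
    if "\<alpha> \<in> {0..1}" "filterlim (v \<alpha>) \<F> (at_left ts)" for \<alpha> \<F>
  proof -
    have "\<forall>\<^sub>F t in at_left ts. pdx u (\<gamma> \<alpha> t) t = v \<alpha> t"
      using ev by eventually_elim (rule v[OF that(1)])
    from filterlim_cong[OF refl refl this] that(2) show ?thesis by simp
  qed
  have "\<forall>\<^sub>F t in at_left ts. Sup ((\<lambda>x. \<bar>pdx u x t\<bar>) ` {0..1}) = (SUP x\<in>{0..1}. \<bar>ux (x, t)\<bar>)"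
    using ev
  proof eventually_elim
    case (elim t)
    show ?case by (rule arg_cong[where f = Sup], rule image_cong[OF refl]) (simp only: ux[OF _ elim])
  qed
  from filterlim_cong[OF refl refl this] sup_norm_at_top
  show "filterlim (\<lambda>t. Sup ((\<lambda>x. \<bar>pdx u x t\<bar>) ` {0..1})) at_top (at_left ts)" by simp
  {
    fix a assume a: "a \<in> {0..1}" "g a = M"
    have "Sup ((\<lambda>\<alpha>. pdx u (\<gamma> \<alpha> t) t) ` {0..1}) = pdx u (\<gamma> a t) t" if "t \<in> {0..<ts}" for t
      unfolding v[OF a(1) that] v_at_max(2)[OF a that, symmetric]
      by (rule arg_cong[where f = Sup], rule image_cong[OF refl]) (rule v[OF _ that])
    then show "(\<forall>t\<in>{0..<ts}. Sup ((\<lambda>\<alpha>. pdx u (\<gamma> \<alpha> t) t) ` {0..1}) = pdx u (\<gamma> a t) t) \<and>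
      filterlim (\<lambda>t. pdx u (\<gamma> a t) t) at_top (at_left ts)"
      using vl[OF a(1) v_at_max(1)[OF a]] by blast
  }
  show "filterlim (\<lambda>t. pdx u (\<gamma> \<alpha> t) t) at_bot (at_left ts)" if "\<alpha> \<in> {0..1}" "g \<alpha> \<noteq> M" for \<alpha>
    using vl[OF that(1) v_at_other[OF that]] .
qed

end

theorem theorem3p1:
  fixes u0 :: "real \<Rightarrow> real" and M0 :: real and A :: "real set"
  assumes "smooth_on UNIV u0"
    and "u0 0 = 0" and "u0 1 = 0"
    and "M0 > 0"
    and "\<forall>x\<in>{0..1}. deriv u0 x \<le> M0"
    and "A = {a \<in> {0..1}. deriv u0 a = M0}"
    and "A \<noteq> {}" and "finite A"
    and "\<forall>a\<in>A. deriv (deriv u0) a \<noteq> 0"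
  shows "\<exists>ts > 0. (\<exists>u. is_solution u0 ts u) \<and>
     (\<forall>u \<gamma>. is_solution u0 ts u \<and> lagrangian_flow u ts \<gamma> \<longrightarrow>
        filterlim (\<lambda>t. Sup ((\<lambda>x. \<bar>pdx u x t\<bar>) ` {0..1})) at_top (at_left ts) \<and>
        (\<forall>a\<in>A. (\<forall>t\<in>{0..<ts}. Sup ((\<lambda>\<alpha>. pdx u (\<gamma> \<alpha> t) t) ` {0..1}) = pdx u (\<gamma> a t) t) \<and>
                filterlim (\<lambda>t. pdx u (\<gamma> a t) t) at_top (at_left ts)) \<and>
        (\<forall>\<alpha>\<in>{0..1} - A. filterlim (\<lambda>t. pdx u (\<gamma> \<alpha> t) t) at_bot (at_left ts)))"
proof -
  \<comment> \<open>An interior maximum of \<open>u0'\<close> would be a zero of \<open>u0''\<close>, so only endpoints occur.\<close>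
  have ends: "a \<in> {0, 1}" if "a \<in> A" for a
  proof (rule ccontr)
    assume "a \<notin> {0, 1}"
    then have a: "0 < a" "a < 1" "deriv u0 a = M0" using that assms(6) by auto
    have "deriv (deriv u0) a = 0"
    proof (rule DERIV_local_max)
      show "(deriv u0 has_real_derivative deriv (deriv u0) a) (at a)"
        using smooth_on_UNIV_deriv[OF smooth_on_UNIV_deriv(2)[OF assms(1)]] by blast
      show "0 < min a (1 - a)" using a by simp
      show "\<forall>y. \<bar>a - y\<bar> < min a (1 - a) \<longrightarrow> deriv u0 y \<le> deriv u0 a"
        using assms(5) a by (auto simp: abs_if split: if_splits)
    qed
    then show False using assms(9) that by blast
  qed
  obtain a0 where a0: "a0 \<in> A" using assms(7) by blast
  interpret profile u0 M0 a0
  proof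
    show "deriv u0 x < M0" if "x \<in> {0<..<1}" for x
    proof -
      have "x \<notin> A" using ends[of x] that by auto
      then show ?thesis using assms(5,6) that by (simp add: order_less_le)
    qed
    show "deriv (deriv u0) x \<noteq> 0" if "x \<in> {0, 1}" "deriv u0 x = M0" for x
      using assms(6,9) that by auto
  qed (use assms(1-6) ends a0 in auto)
  show ?thesis
  proof (intro exI[of _ ts] conjI allI impI ballI)
    show "ts > 0" by (rule ts_pos)
    show "\<exists>u. is_solution u0 ts u" using is_solution_sol by blast
    fix u \<gamma> assume "is_solution u0 ts u \<and> lagrangian_flow u ts \<gamma>"
    then have s: "is_solution u0 ts u" "lagrangian_flow u ts \<gamma>" by auto
    show "filterlim (\<lambda>t. Sup ((\<lambda>x. \<bar>pdx u x t\<bar>) ` {0..1})) at_top (at_left ts)"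
      by (rule blowup(1)[OF s])
    fix \<alpha> assume \<alpha>: "\<alpha> \<in> {0..1} - A"
    show "filterlim (\<lambda>t. pdx u (\<gamma> \<alpha> t) t) at_bot (at_left ts)"
      by (rule blowup(3)[OF s]) (use \<alpha> assms(6) in auto)
  next
    fix u \<gamma> a assume "is_solution u0 ts u \<and> lagrangian_flow u ts \<gamma>" "a \<in> A"
    then have s: "is_solution u0 ts u" "lagrangian_flow u ts \<gamma>" and a: "a \<in> {0..1}" "deriv u0 a = M0"
      using assms(6) by auto
    show "filterlim (\<lambda>t. pdx u (\<gamma> a t) t) at_top (at_left ts)"
      using blowup(2)[OF s a] by blast
    fix t assume "t \<in> {0..<ts}"
    then show "Sup ((\<lambda>\<alpha>. pdx u (\<gamma> \<alpha> t) t) ` {0..1}) = pdx u (\<gamma> a t) t"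
      using blowup(2)[OF s a] by blast
  qed
qed

end
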